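(* Let $\mathbb M\xrightarrow{\iota}\mathbb E\xrightarrow{\tau}\mathbb H$ be an extension of partial groups. (a) $\tau$ admits a regular section if and only if a given obstruction class $[\eta]\in H^2(\mathbb H;N(\mathbb M))$ vanishes. (b) A regular section defines an action $\rho\colon\mathbb H\to B\mathrm{Aut}(\mathbb M)$, given by conjugation in $\mathbb E$, and a bijective correspondence between the sets $H^1(\mathbb H;\mathbb M)$ and $\mathfrak X(\tau)$. Furthermore, under this bijection regular derivations correspond to regular sections.
   Context: Partial groups. A partial monoid is a nonempty simplicial set $\mathbb M$ with exactly one vertex $v$ such that for all $n\ge1$ the spine map $\mathbb M_n\to(\mathbb M_1)^n$, whose $i$-th component is induced by the map $[1]\to[n]$ with image $\{i-1,i\}$, is injective. The $n$-simplex with spine $(x_1,\dots,x_n)$ is written $[x_1|\dots|x_n]$. $\Pi\colon\mathbb M_n\to\mathbb M_1$ is induced by $[1]\to[n]$ with image $\{0,n\}$; $x_1\cdots x_n=\Pi[x_1|\dots|x_n]$ (its use asserts that the simplex exists), $1=s_0(v)$. A partial group is a partial monoid with an inversion: a simplicial map $\nu\colon\mathbb M\to\mathbb M^{\mathrm{op}}$ with $\nu^{-1}=\nu^{\mathrm{op}}$ such that for every $u\in\mathbb M_n$, $n\ge1$, there is a simplex $[\nu(u)|u]\in\mathbb M_{2n}$ (concatenated spines) with $\Pi[\nu(u)|u]=1$; $u^{-1}=\nu(u)$. Homomorphisms are simplicial maps; $\mathrm{Aut}(\mathbb M)$ is the group of automorphisms. For a group $G$, $BG$ is the bar construction, a partial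 group. Homotopies. With $\iota_1\in\Delta[1]_1$ the nondegenerate edge, $v_0=d_1\iota_1$, $v_1=d_0\iota_1$, a homotopy from $g$ to $f$ (simplicial maps $Y\to X$) is a simplicial map $F\colon Y\times\Delta[1]\to X$ with $f=F\circ(\mathrm{Id}\times v_0)$, $g=F\circ(\mathrm{Id}\times v_1)$. For homomorphisms of partial groups write $f\xleftarrow{\eta}g$ if there is such an $F$ with $F(1,\iota_1)=\eta$; $\eta$ and $g$ determine $f$. $N(\mathbb M)$ is the set of $\eta\in\mathbb M_1$ that define a homotopy of the identity, i.e. for which there is a homomorphism $c_\eta\colon\mathbb M\to\mathbb M$ with $c_\eta\xleftarrow{\eta}1_{\mathbb M}$; in the source $N(\mathbb M)$ is a group under the product of $\mathbb M$, and $BN(\mathbb M)\subseteq\mathbb M$. Extensions. A fibre bundle with fibre $F$ is a surjective simplicial map $E\to B$ whose pullback along each simplex $\Delta[n]\to B$ is isomorphic over $\Delta[n]$ to $F\times\Delta[n]$. An extension $\mathbb M\xrightarrow{\iota}\mathbb E\xrightarrow{\tau}\mathbb H$ of $\mathbb H$ by $\mathbb M$ is a fibre bundle $\tau$ with fibre $\mathbb M$, where $\mathbb M,\mathbb H$ are partial groups and $\iota$ identifies $\mathbb M$ with the fibre over the vertex of $\mathbb H$; the total space $\mathbb E$ is then a partial group. The obstruction class. An $\mathbb H$-twisting pair for $\mathbb M$ is a pair of functions $t\colon\mathbb H_1\to\mathrm{Aut}(\mathbb M)$, $\eta\colon\mathbb H_2\to N(\mathbb M)$ with: $t(g)\circ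 t(h)\xleftarrow{\eta(g,h)}t(gh)$ for $[g|h]\in\mathbb H_2$; $t(1)=\mathrm{Id}$ and $\eta(g,1)=1=\eta(1,g)$ for $g\in\mathbb H_1$; $t(g)(\eta(h,k))\cdot\eta(g,hk)=\eta(g,h)\cdot\eta(gh,k)$ for $[g|h|k]\in\mathbb H_3$. It defines an extension $\mathbb M\times_{(t,\eta)}\mathbb H$ of $\mathbb H$ by $\mathbb M$ with $1$-simplices the pairs $(x,g)\in\mathbb M_1\times\mathbb H_1$, product $(x,g)(z,h)=(x\cdot t(g)(z)\cdot\eta(g,h),gh)$ and projection $(x,g)\mapsto g$, and every extension is equivalent (isomorphic compatibly with $\mathrm{Id}_{\mathbb M}$ and $\mathrm{Id}_{\mathbb H}$) to one of this form. The source does not define the non-abelian $H^2(\mathbb H;N(\mathbb M))$ separately; the class $[\eta]$ is the one represented by the second component $\eta$ of a twisting pair $(t,\eta)$ with $\mathbb E$ equivalent to $\mathbb M\times_{(t,\eta)}\mathbb H$, and its vanishing is understood as $\eta$ being a coboundary, $\eta(g,h)=t(g)(\theta(h)^{-1})\cdot\theta(g)^{-1}\cdot\theta(gh)$ for all $[g|h]\in\mathbb H_2$, for some $\theta\colon\mathbb H_1\to N(\mathbb M)$. Sections. $\Gamma(\tau)$ is the set of sections of $\tau$, i.e. homomorphisms $\sigma\colon\mathbb H\to\mathbb E$ with $\tau\circ\sigma=\mathrm{Id}_{\mathbb H}$. $\mathbb N_{\mathbb E}(\mathbb M)$ is the set of simplices $[z_1|\dots|z_n]\in\mathbb E$ such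 that each $z_i$ defines a homotopy of the inclusion $\iota\colon\mathbb M\to\mathbb E$, i.e. there is a homomorphism $f_i\colon\mathbb M\to\mathbb E$ with $f_i\xleftarrow{z_i}\iota$. A section is regular if its image lies in $\mathbb N_{\mathbb E}(\mathbb M)$. Two sections $\sigma,\sigma'$ are equivalent, $\sigma\approx\sigma'$, if there are sections $\sigma_0=\sigma,\sigma_1,\dots,\sigma_n=\sigma'$ and elements $x_i\in\mathbb E_1$ with $\sigma_0\xleftarrow{x_1}\sigma_1\xleftarrow{x_2}\cdots\xleftarrow{x_n}\sigma_n$. $\mathfrak X(\tau)=\Gamma(\tau)/{\approx}$. Derivations. An action of $\mathbb H$ on $\mathbb M$ is a homomorphism $\rho\colon\mathbb H\to B\mathrm{Aut}(\mathbb M)$; write ${}^hx=\rho(h)(x)$. With respect to such an action (in (b), the action defined by the regular section), a derivation $\theta\colon\mathbb H\to\mathbb M$ is a collection of maps $\theta_n\colon\mathbb H_n\to\mathbb M_n$, $n\ge0$, with $d_0(\theta_n(\mathbf h))={}^{h_1}\theta_{n-1}(d_0\mathbf h)$, $d_i(\theta_n(\mathbf h))=\theta_{n-1}(d_i\mathbf h)$ for $1\le i\le n$, and $s_i(\theta_n(\mathbf h))=\theta_{n+1}(s_i\mathbf h)$ for $0\le i\le n$, for all $\mathbf h=[h_1|\dots|h_n]\in\mathbb H_n$. It is determined by $\theta=\theta_1$: $\theta_n(\mathbf h)=[\theta(h_1)|{}^{h_1}\theta(h_2)|\dots|{}^{h_1\cdots h_{n-1}}\theta(h_n)]$. It is regular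 if its image lies in $BN(\mathbb M)$. An element $y\in\mathbb M_1$ defines an equivalence $\theta\sim\theta'$ if for every $[h_1|\dots|h_n]\in\mathbb H_n$, $n\ge0$, there are simplices $\mathbf v_k=[\theta(h_1)|{}^{h_1}\theta(h_2)|\dots|{}^{h_1\cdots h_{k-1}}\theta(h_k)|{}^{h_1\cdots h_k}y|{}^{h_1\cdots h_k}\theta'(h_{k+1})|\dots|{}^{h_1\cdots h_{n-1}}\theta'(h_n)]\in\mathbb M_{n+1}$, $k=0,\dots,n$, with $\Pi(\mathbf v_0)=\dots=\Pi(\mathbf v_n)$. $H^1(\mathbb H;\mathbb M)$ is the quotient of the set of derivations by the equivalence relation generated by $\sim$. *)

theory Defs
  imports "HOL-Library.FuncSet" "HOL-Algebra.Group"
begin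

section \<open>Simplicial sets\<close>

text \<open>A weakly monotone map from [m] to [n] is encoded by the list of its m + 1 values; the
  composite of \<open>\<alpha>\<close> after \<open>\<beta>\<close> is \<open>map ((!) \<alpha>) \<beta>\<close>, and the identity of [n] is \<open>[0..<Suc n]\<close>.\<close>

definition mono_maps :: "nat \<Rightarrow> nat \<Rightarrow> nat list set" where
  "mono_maps m n = {\<alpha>. length \<alpha> = Suc m \<and> sorted \<alpha> \<and> set \<alpha> \<subseteq> {..n}}"

text \<open>\<open>act X n \<alpha>\<close> is the map from n-simplices to m-simplices induced by \<open>\<alpha> \<in> mono_maps m n\<close>.
  The sets of simplices in different degrees need not be disjoint, so simplicial maps are
  families indexed by the degree.\<close>

record 'a sset =
  cells :: "nat \<Rightarrow> 'a set"
  act :: "nat \<Rightarrow> nat list \<Rightarrow> 'a \<Rightarrow> 'a"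

definition simplicial_set :: "'a sset \<Rightarrow> bool" where
  "simplicial_set X \<longleftrightarrow>
     (\<forall>m n. \<forall>\<alpha> \<in> mono_maps m n. \<forall>x \<in> cells X n. act X n \<alpha> x \<in> cells X m) \<and>
     (\<forall>n. \<forall>x \<in> cells X n. act X n [0..<Suc n] x = x) \<and>
     (\<forall>l m n. \<forall>\<alpha> \<in> mono_maps m n. \<forall>\<beta> \<in> mono_maps l m. \<forall>x \<in> cells X n.
        act X n (map ((!) \<alpha>) \<beta>) x = act X m \<beta> (act X n \<alpha> x))"

definition face :: "'a sset \<Rightarrow> nat \<Rightarrow> nat \<Rightarrow> 'a \<Rightarrow> 'a" where
  "face X n i x = act X n ([0..<i] @ [Suc i..<Suc n]) x"

definition degen :: "'a sset \<Rightarrow> nat \<Rightarrow> nat \<Rightarrow> 'a \<Rightarrow> 'a" where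
  "degen X n i x = act X n ([0..<Suc i] @ [i..<Suc n]) x"

definition simplicial_map :: "'a sset \<Rightarrow> 'b sset \<Rightarrow> (nat \<Rightarrow> 'a \<Rightarrow> 'b) \<Rightarrow> bool" where
  "simplicial_map X Y f \<longleftrightarrow>
     (\<forall>n. \<forall>x \<in> cells X n. f n x \<in> cells Y n) \<and>
     (\<forall>m n. \<forall>\<alpha> \<in> mono_maps m n. \<forall>x \<in> cells X n. f m (act X n \<alpha> x) = act Y n \<alpha> (f n x))"

text \<open>Where simplicial maps are elements of a set, they are normalised to be \<open>undefined\<close> off the
  simplices, so that equality of functions is equality of simplicial maps.\<close>

definition Hom :: "'a sset \<Rightarrow> 'b sset \<Rightarrow> (nat \<Rightarrow> 'a \<Rightarrow> 'b) set" where
  "Hom X Y = {f. simplicial_map X Y f \<and> (\<forall>n. f n \<in> extensional (cells X n))}"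

definition simplicial_iso :: "'a sset \<Rightarrow> 'b sset \<Rightarrow> (nat \<Rightarrow> 'a \<Rightarrow> 'b) \<Rightarrow> bool" where
  "simplicial_iso X Y f \<longleftrightarrow>
     simplicial_map X Y f \<and> (\<forall>n. bij_betw (f n) (cells X n) (cells Y n))"

definition opposite :: "'a sset \<Rightarrow> 'a sset" where
  "opposite X = \<lparr>cells = cells X, act = (\<lambda>n \<alpha>. act X n (rev (map (\<lambda>j. n - j) \<alpha>)))\<rparr>"

definition std_simplex :: "nat \<Rightarrow> nat list sset" where
  "std_simplex n = \<lparr>cells = (\<lambda>m. mono_maps m n), act = (\<lambda>_ \<beta> \<alpha>. map ((!) \<alpha>) \<beta>)\<rparr>"

definition product_sset :: "'a sset \<Rightarrow> 'b sset \<Rightarrow> ('a \<times> 'b) sset" where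
  "product_sset X Y = \<lparr>cells = (\<lambda>n. cells X n \<times> cells Y n),
     act = (\<lambda>n \<alpha> p. (act X n \<alpha> (fst p), act Y n \<alpha> (snd p)))\<rparr>"

definition pullback ::
    "'e sset \<Rightarrow> (nat \<Rightarrow> 'e \<Rightarrow> 'b) \<Rightarrow> 'c sset \<Rightarrow> (nat \<Rightarrow> 'c \<Rightarrow> 'b) \<Rightarrow> ('e \<times> 'c) sset" where
  "pullback E \<tau> C f = \<lparr>cells = (\<lambda>n. {(e, c). e \<in> cells E n \<and> c \<in> cells C n \<and> \<tau> n e = f n c}),
     act = (\<lambda>n \<alpha> p. (act E n \<alpha> (fst p), act C n \<alpha> (snd p)))\<rparr>"

section \<open>Partial groups\<close>

definition spine :: "'a sset \<Rightarrow> nat \<Rightarrow> 'a \<Rightarrow> 'a list" where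
  "spine X n u = map (\<lambda>i. act X n [i, Suc i] u) [0..<n]"

definition vertex :: "'a sset \<Rightarrow> 'a" where
  "vertex X = (THE v. v \<in> cells X 0)"

definition vertex_cell :: "'a sset \<Rightarrow> nat \<Rightarrow> 'a" where
  "vertex_cell X n = act X 0 (replicate (Suc n) 0) (vertex X)"

definition unit :: "'a sset \<Rightarrow> 'a" where
  "unit X = degen X 0 0 (vertex X)"

definition partial_monoid :: "'a sset \<Rightarrow> bool" where
  "partial_monoid M \<longleftrightarrow> simplicial_set M \<and> (\<exists>!v. v \<in> cells M 0) \<and>
     (\<forall>n\<ge>1. inj_on (spine M n) (cells M n))"

text \<open>\<open>[x\<^sub>1, \<dots>, x\<^sub>n] \<in> words M\<close> says that the simplex with this spine exists; \<open>word M\<close> is that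
  simplex and \<open>mprod M [x\<^sub>1, \<dots>, x\<^sub>n]\<close> is its product. The values of \<open>word\<close> and \<open>mprod\<close> on lists
  outside \<open>words M\<close> are meaningless.\<close>

definition words :: "'a sset \<Rightarrow> 'a list set" where
  "words M = {xs. \<exists>u \<in> cells M (length xs). spine M (length xs) u = xs}"

definition word :: "'a sset \<Rightarrow> 'a list \<Rightarrow> 'a" where
  "word M xs = (THE u. u \<in> cells M (length xs) \<and> spine M (length xs) u = xs)"

definition mprod :: "'a sset \<Rightarrow> 'a list \<Rightarrow> 'a" where
  "mprod M xs = act M (length xs) [0, length xs] (word M xs)"

definition inversion :: "'a sset \<Rightarrow> (nat \<Rightarrow> 'a \<Rightarrow> 'a) \<Rightarrow> bool" where
  "inversion M \<nu> \<longleftrightarrow>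
     simplicial_map M (opposite M) \<nu> \<and>
     (\<forall>n. \<forall>u \<in> cells M n. \<nu> n (\<nu> n u) = u) \<and>
     (\<forall>n\<ge>1. \<forall>u \<in> cells M n.
        spine M n (\<nu> n u) @ spine M n u \<in> words M \<and>
        mprod M (spine M n (\<nu> n u) @ spine M n u) = unit M)"

definition partial_group :: "'a sset \<Rightarrow> bool" where
  "partial_group M \<longleftrightarrow> partial_monoid M \<and> (\<exists>\<nu>. inversion M \<nu>)"

text \<open>The inversion of a partial group is unique on simplices, so the choice is immaterial.\<close>

definition inverse_elt :: "'a sset \<Rightarrow> 'a \<Rightarrow> 'a" where
  "inverse_elt M x = (SOME \<nu>. inversion M \<nu>) 1 x"

definition Aut :: "'a sset \<Rightarrow> (nat \<Rightarrow> 'a \<Rightarrow> 'a) monoid" where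
  "Aut M = \<lparr>carrier = {f \<in> Hom M M. simplicial_iso M M f},
     mult = (\<lambda>f g n. compose (cells M n) (f n) (g n)),
     one = (\<lambda>n. \<lambda>x \<in> cells M n. x)\<rparr>"

definition bar :: "('g, 'k) monoid_scheme \<Rightarrow> 'g list sset" where
  "bar G = \<lparr>cells = (\<lambda>n. {gs. length gs = n \<and> set gs \<subseteq> carrier G}),
     act = (\<lambda>n \<alpha> gs. map (\<lambda>i. foldr (mult G) (map ((!) gs) [\<alpha> ! i..<\<alpha> ! Suc i]) (one G))
       [0..<length \<alpha> - 1])\<rparr>"

section \<open>Homotopies\<close>

text \<open>\<open>htpy Y X f \<eta> g\<close>: there is a homotopy from \<open>g\<close> to \<open>f\<close> whose value at the pair of the unit
  of \<open>Y\<close> and the nondegenerate edge \<open>[0, 1]\<close> is \<open>\<eta>\<close>; note that \<open>f\<close> sits over the vertex 0 and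
  \<open>g\<close> over the vertex 1.\<close>

definition htpy ::
    "'b sset \<Rightarrow> 'a sset \<Rightarrow> (nat \<Rightarrow> 'b \<Rightarrow> 'a) \<Rightarrow> 'a \<Rightarrow> (nat \<Rightarrow> 'b \<Rightarrow> 'a) \<Rightarrow> bool" where
  "htpy Y X f \<eta> g \<longleftrightarrow> (\<exists>F. simplicial_map (product_sset Y (std_simplex 1)) X F \<and>
     (\<forall>n. \<forall>y \<in> cells Y n. F n (y, replicate (Suc n) 0) = f n y) \<and>
     (\<forall>n. \<forall>y \<in> cells Y n. F n (y, replicate (Suc n) 1) = g n y) \<and>
     F 1 (unit Y, [0, 1]) = \<eta>)"

definition defines_htpy :: "'b sset \<Rightarrow> 'a sset \<Rightarrow> (nat \<Rightarrow> 'b \<Rightarrow> 'a) \<Rightarrow> 'a \<Rightarrow> bool" where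
  "defines_htpy Y X g \<eta> \<longleftrightarrow> (\<exists>f. simplicial_map Y X f \<and> htpy Y X f \<eta> g)"

definition NN :: "'a sset \<Rightarrow> 'a set" where
  "NN M = {\<eta> \<in> cells M 1. defines_htpy M M (\<lambda>_ x. x) \<eta>}"

text \<open>The image of \<open>BN(M)\<close> in \<open>M\<close>.\<close>

definition BN :: "'a sset \<Rightarrow> nat \<Rightarrow> 'a set" where
  "BN M n = {u \<in> cells M n. set (spine M n u) \<subseteq> NN M}"

section \<open>Extensions and twisting pairs\<close>

definition fibre_bundle :: "'f sset \<Rightarrow> 'e sset \<Rightarrow> (nat \<Rightarrow> 'e \<Rightarrow> 'b) \<Rightarrow> 'b sset \<Rightarrow> bool" where
  "fibre_bundle F E \<tau> B \<longleftrightarrow>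
     simplicial_set F \<and> simplicial_set E \<and> simplicial_set B \<and> simplicial_map E B \<tau> \<and>
     (\<forall>n. \<tau> n ` cells E n = cells B n) \<and>
     (\<forall>n b. simplicial_map (std_simplex n) B b \<longrightarrow>
        (\<exists>\<phi>. simplicial_iso (pullback E \<tau> (std_simplex n) b) (product_sset F (std_simplex n)) \<phi> \<and>
           (\<forall>m. \<forall>p \<in> cells (pullback E \<tau> (std_simplex n) b) m. snd (\<phi> m p) = snd p)))"

definition extension ::
    "'a sset \<Rightarrow> (nat \<Rightarrow> 'a \<Rightarrow> 'e) \<Rightarrow> 'e sset \<Rightarrow> (nat \<Rightarrow> 'e \<Rightarrow> 'h) \<Rightarrow> 'h sset \<Rightarrow> bool" where
  "extension M \<iota> E \<tau> H \<longleftrightarrow>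
     partial_group M \<and> partial_group H \<and> fibre_bundle M E \<tau> H \<and> simplicial_map M E \<iota> \<and>
     (\<forall>n. bij_betw (\<iota> n) (cells M n) {e \<in> cells E n. \<tau> n e = vertex_cell H n})"

definition equivalent_extensions ::
    "'a sset \<Rightarrow> (nat \<Rightarrow> 'a \<Rightarrow> 'e) \<Rightarrow> 'e sset \<Rightarrow> (nat \<Rightarrow> 'e \<Rightarrow> 'h) \<Rightarrow>
     (nat \<Rightarrow> 'a \<Rightarrow> 'd) \<Rightarrow> 'd sset \<Rightarrow> (nat \<Rightarrow> 'd \<Rightarrow> 'h) \<Rightarrow> bool" where
  "equivalent_extensions M \<iota> E \<tau> \<iota>' E' \<tau>' \<longleftrightarrow> (\<exists>\<phi>. simplicial_iso E E' \<phi> \<and>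
     (\<forall>n. \<forall>x \<in> cells M n. \<phi> n (\<iota> n x) = \<iota>' n x) \<and>
     (\<forall>n. \<forall>e \<in> cells E n. \<tau>' n (\<phi> n e) = \<tau> n e))"

text \<open>Since spines are injective, a function on 2-simplices [g|h] is given as a function
  \<open>\<eta>\<close> of two arguments; only its values at pairs with \<open>[g, h] \<in> words H\<close> matter.\<close>

definition twisting_pair ::
    "'a sset \<Rightarrow> 'h sset \<Rightarrow> ('h \<Rightarrow> nat \<Rightarrow> 'a \<Rightarrow> 'a) \<Rightarrow> ('h \<Rightarrow> 'h \<Rightarrow> 'a) \<Rightarrow> bool" where
  "twisting_pair M H t \<eta> \<longleftrightarrow>
     (\<forall>g \<in> cells H 1. t g \<in> carrier (Aut M)) \<and>
     (\<forall>g h. [g, h] \<in> words H \<longrightarrow> \<eta> g h \<in> NN M) \<and>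
     (\<forall>g h. [g, h] \<in> words H \<longrightarrow>
        htpy M M (\<lambda>n. t g n \<circ> t h n) (\<eta> g h) (t (mprod H [g, h]))) \<and>
     t (unit H) = one (Aut M) \<and>
     (\<forall>g \<in> cells H 1. \<eta> g (unit H) = unit M \<and> \<eta> (unit H) g = unit M) \<and>
     (\<forall>g h k. [g, h, k] \<in> words H \<longrightarrow>
        [t g 1 (\<eta> h k), \<eta> g (mprod H [h, k])] \<in> words M \<and>
        [\<eta> g h, \<eta> (mprod H [g, h]) k] \<in> words M \<and>
        mprod M [t g 1 (\<eta> h k), \<eta> g (mprod H [h, k])] =
        mprod M [\<eta> g h, \<eta> (mprod H [g, h]) k])"

definition twisted_mult :: "'a sset \<Rightarrow> 'h sset \<Rightarrow> ('h \<Rightarrow> nat \<Rightarrow> 'a \<Rightarrow> 'a) \<Rightarrow> ('h \<Rightarrow> 'h \<Rightarrow> 'a)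
    \<Rightarrow> 'a \<times> 'h \<Rightarrow> 'a \<times> 'h \<Rightarrow> 'a \<times> 'h" where
  "twisted_mult M H t \<eta> p q =
     (mprod M [fst p, t (snd p) 1 (fst q), \<eta> (snd p) (snd q)], mprod H [snd p, snd q])"

text \<open>For a list of pairs \<open>(x\<^sub>i, g\<^sub>i)\<close> this is the list of the elements
  \<open>t(g\<^sub>1)(t(g\<^sub>2)(\<dots> t(g\<^sub>i\<^sub>-\<^sub>1)(x\<^sub>i)))\<close> obtained by moving all the \<open>g\<^sub>i\<close> to the right.\<close>

fun untwist :: "('h \<Rightarrow> nat \<Rightarrow> 'a \<Rightarrow> 'a) \<Rightarrow> ('a \<times> 'h) list \<Rightarrow> 'a list" where
  "untwist t [] = []"
| "untwist t ((x, g) # ps) = x # map (t g 1) (untwist t ps)"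

text \<open>An n-simplex of the twisted product is represented by its spine. Because the values of
  \<open>\<eta>\<close> lie in \<open>N(M)\<close>, inserting them into the untwisted word does not affect whether it is a
  simplex of \<open>M\<close>, so they do not occur in the condition. The edges of a face are the products
  of consecutive entries.\<close>

definition twisted_product :: "'a sset \<Rightarrow> 'h sset \<Rightarrow> ('h \<Rightarrow> nat \<Rightarrow> 'a \<Rightarrow> 'a) \<Rightarrow> ('h \<Rightarrow> 'h \<Rightarrow> 'a)
    \<Rightarrow> ('a \<times> 'h) list sset" where
  "twisted_product M H t \<eta> = \<lparr>
     cells = (\<lambda>n. {ps. length ps = n \<and> set ps \<subseteq> cells M 1 \<times> cells H 1 \<and>
       map snd ps \<in> words H \<and> untwist t ps \<in> words M}),
     act = (\<lambda>n \<alpha> ps. map (\<lambda>i. foldl (twisted_mult M H t \<eta>) (unit M, unit H)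
         (map ((!) ps) [\<alpha> ! i..<\<alpha> ! Suc i])) [0..<length \<alpha> - 1])\<rparr>"

definition twisted_incl :: "'a sset \<Rightarrow> 'h sset \<Rightarrow> nat \<Rightarrow> 'a \<Rightarrow> ('a \<times> 'h) list" where
  "twisted_incl M H n u = map (\<lambda>x. (x, unit H)) (spine M n u)"

definition twisted_proj :: "'h sset \<Rightarrow> nat \<Rightarrow> ('a \<times> 'h) list \<Rightarrow> 'h" where
  "twisted_proj H n ps = word H (map snd ps)"

text \<open>The second component of such a pair represents the obstruction class of the extension.\<close>

definition classifying_pair :: "'a sset \<Rightarrow> (nat \<Rightarrow> 'a \<Rightarrow> 'e) \<Rightarrow> 'e sset \<Rightarrow> (nat \<Rightarrow> 'e \<Rightarrow> 'h)
    \<Rightarrow> 'h sset \<Rightarrow> ('h \<Rightarrow> nat \<Rightarrow> 'a \<Rightarrow> 'a) \<Rightarrow> ('h \<Rightarrow> 'h \<Rightarrow> 'a) \<Rightarrow> bool" where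
  "classifying_pair M \<iota> E \<tau> H t \<eta> \<longleftrightarrow> twisting_pair M H t \<eta> \<and>
     equivalent_extensions M \<iota> E \<tau>
       (twisted_incl M H) (twisted_product M H t \<eta>) (twisted_proj H)"

definition class_vanishes ::
    "'a sset \<Rightarrow> 'h sset \<Rightarrow> ('h \<Rightarrow> nat \<Rightarrow> 'a \<Rightarrow> 'a) \<Rightarrow> ('h \<Rightarrow> 'h \<Rightarrow> 'a) \<Rightarrow> bool" where
  "class_vanishes M H t \<eta> \<longleftrightarrow> (\<exists>\<theta>. (\<forall>g \<in> cells H 1. \<theta> g \<in> NN M) \<and>
     (\<forall>g h. [g, h] \<in> words H \<longrightarrow>
        [t g 1 (inverse_elt M (\<theta> h)), inverse_elt M (\<theta> g), \<theta> (mprod H [g, h])] \<in> words M \<and>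
        \<eta> g h = mprod M
          [t g 1 (inverse_elt M (\<theta> h)), inverse_elt M (\<theta> g), \<theta> (mprod H [g, h])]))"

section \<open>Sections\<close>

definition sections :: "'e sset \<Rightarrow> (nat \<Rightarrow> 'e \<Rightarrow> 'h) \<Rightarrow> 'h sset \<Rightarrow> (nat \<Rightarrow> 'h \<Rightarrow> 'e) set" where
  "sections E \<tau> H = {\<sigma> \<in> Hom H E. \<forall>n. \<forall>h \<in> cells H n. \<tau> n (\<sigma> n h) = h}"

definition normalizer_cells ::
    "'a sset \<Rightarrow> (nat \<Rightarrow> 'a \<Rightarrow> 'e) \<Rightarrow> 'e sset \<Rightarrow> nat \<Rightarrow> 'e set" where
  "normalizer_cells M \<iota> E n = {u \<in> cells E n. \<forall>z \<in> set (spine E n u). defines_htpy M E \<iota> z}"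

definition regular_section ::
    "'a sset \<Rightarrow> (nat \<Rightarrow> 'a \<Rightarrow> 'e) \<Rightarrow> 'e sset \<Rightarrow> 'h sset \<Rightarrow> (nat \<Rightarrow> 'h \<Rightarrow> 'e) \<Rightarrow> bool" where
  "regular_section M \<iota> E H \<sigma> \<longleftrightarrow> (\<forall>n. \<forall>h \<in> cells H n. \<sigma> n h \<in> normalizer_cells M \<iota> E n)"

definition section_equiv ::
    "'e sset \<Rightarrow> (nat \<Rightarrow> 'e \<Rightarrow> 'h) \<Rightarrow> 'h sset \<Rightarrow> (nat \<Rightarrow> 'h \<Rightarrow> 'e) rel" where
  "section_equiv E \<tau> H = {(\<sigma>, \<sigma>'). \<sigma> \<in> sections E \<tau> H \<and> \<sigma>' \<in> sections E \<tau> H \<and>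
     (\<exists>x \<in> cells E 1. htpy H E \<sigma> x \<sigma>')}\<^sup>*"

definition section_classes ::
    "'e sset \<Rightarrow> (nat \<Rightarrow> 'e \<Rightarrow> 'h) \<Rightarrow> 'h sset \<Rightarrow> (nat \<Rightarrow> 'h \<Rightarrow> 'e) set set" where
  "section_classes E \<tau> H = sections E \<tau> H // section_equiv E \<tau> H"

section \<open>Actions and derivations\<close>

definition actions :: "'h sset \<Rightarrow> 'a sset \<Rightarrow> (nat \<Rightarrow> 'h \<Rightarrow> (nat \<Rightarrow> 'a \<Rightarrow> 'a) list) set" where
  "actions H M = Hom H (bar (Aut M))"

text \<open>The 1-simplices of a bar construction are the one-element lists.\<close>

definition act_by ::
    "(nat \<Rightarrow> 'h \<Rightarrow> (nat \<Rightarrow> 'a \<Rightarrow> 'a) list) \<Rightarrow> 'h \<Rightarrow> nat \<Rightarrow> 'a \<Rightarrow> 'a" where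
  "act_by \<rho> h = hd (\<rho> 1 h)"

definition derivations ::
    "'h sset \<Rightarrow> 'a sset \<Rightarrow> (nat \<Rightarrow> 'h \<Rightarrow> (nat \<Rightarrow> 'a \<Rightarrow> 'a) list) \<Rightarrow> (nat \<Rightarrow> 'h \<Rightarrow> 'a) set" where
  "derivations H M \<rho> = {\<theta>.
     (\<forall>n. \<theta> n \<in> cells H n \<rightarrow>\<^sub>E cells M n) \<and>
     (\<forall>n\<ge>1. \<forall>h \<in> cells H n.
        face M n 0 (\<theta> n h) = act_by \<rho> (act H n [0, 1] h) (n - 1) (\<theta> (n - 1) (face H n 0 h))) \<and>
     (\<forall>n\<ge>1. \<forall>h \<in> cells H n. \<forall>i \<in> {1..n}. face M n i (\<theta> n h) = \<theta> (n - 1) (face H n i h)) \<and>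
     (\<forall>n. \<forall>h \<in> cells H n. \<forall>i \<in> {0..n}. degen M n i (\<theta> n h) = \<theta> (Suc n) (degen H n i h))}"

definition regular_derivation :: "'h sset \<Rightarrow> 'a sset \<Rightarrow> (nat \<Rightarrow> 'h \<Rightarrow> 'a) \<Rightarrow> bool" where
  "regular_derivation H M \<theta> \<longleftrightarrow> (\<forall>n. \<forall>h \<in> cells H n. \<theta> n h \<in> BN M n)"

text \<open>The spine of the simplex \<open>v\<^sub>k\<close>; here \<open>act H n [0, i] h\<close> is the product \<open>h\<^sub>1 \<cdots> h\<^sub>i\<close>
  (the unit if \<open>i = 0\<close>) and \<open>act H n [i, Suc i] h\<close> is the (i + 1)-st entry of the spine of h.\<close>

definition mixed_word :: "'h sset \<Rightarrow> (nat \<Rightarrow> 'h \<Rightarrow> (nat \<Rightarrow> 'a \<Rightarrow> 'a) list) \<Rightarrow>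
    (nat \<Rightarrow> 'h \<Rightarrow> 'a) \<Rightarrow> 'a \<Rightarrow> (nat \<Rightarrow> 'h \<Rightarrow> 'a) \<Rightarrow> nat \<Rightarrow> 'h \<Rightarrow> nat \<Rightarrow> 'a list" where
  "mixed_word H \<rho> \<theta> y \<theta>' n h k =
     map (\<lambda>i. act_by \<rho> (act H n [0, i] h) 1 (\<theta> 1 (act H n [i, Suc i] h))) [0..<k] @
     [act_by \<rho> (act H n [0, k] h) 1 y] @
     map (\<lambda>i. act_by \<rho> (act H n [0, i] h) 1 (\<theta>' 1 (act H n [i, Suc i] h))) [k..<n]"

definition defines_equiv :: "'h sset \<Rightarrow> 'a sset \<Rightarrow> (nat \<Rightarrow> 'h \<Rightarrow> (nat \<Rightarrow> 'a \<Rightarrow> 'a) list) \<Rightarrow>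
    (nat \<Rightarrow> 'h \<Rightarrow> 'a) \<Rightarrow> 'a \<Rightarrow> (nat \<Rightarrow> 'h \<Rightarrow> 'a) \<Rightarrow> bool" where
  "defines_equiv H M \<rho> \<theta> y \<theta>' \<longleftrightarrow> (\<forall>n. \<forall>h \<in> cells H n.
     (\<forall>k\<le>n. mixed_word H \<rho> \<theta> y \<theta>' n h k \<in> words M) \<and>
     (\<forall>k\<le>n. mprod M (mixed_word H \<rho> \<theta> y \<theta>' n h k) = mprod M (mixed_word H \<rho> \<theta> y \<theta>' n h 0)))"

definition derivation_equiv ::
    "'h sset \<Rightarrow> 'a sset \<Rightarrow> (nat \<Rightarrow> 'h \<Rightarrow> (nat \<Rightarrow> 'a \<Rightarrow> 'a) list) \<Rightarrow> (nat \<Rightarrow> 'h \<Rightarrow> 'a) rel" where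
  "derivation_equiv H M \<rho> =
     (let r = {(\<theta>, \<theta>'). \<theta> \<in> derivations H M \<rho> \<and> \<theta>' \<in> derivations H M \<rho> \<and>
                (\<exists>y \<in> cells M 1. defines_equiv H M \<rho> \<theta> y \<theta>')}
      in (r \<union> r\<inverse>)\<^sup>*)"

definition H1 ::
    "'h sset \<Rightarrow> 'a sset \<Rightarrow> (nat \<Rightarrow> 'h \<Rightarrow> (nat \<Rightarrow> 'a \<Rightarrow> 'a) list) \<Rightarrow> (nat \<Rightarrow> 'h \<Rightarrow> 'a) set set" where
  "H1 H M \<rho> = derivations H M \<rho> // derivation_equiv H M \<rho>"

text \<open>\<open>\<rho>(h)\<close> is conjugation by \<open>\<sigma>(h)\<close> in \<open>E\<close>, in the sense of homotopies of the inclusion: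
  on elements, \<open>\<iota>(\<rho>(h)(x)) \<cdot> \<sigma>(h) = \<sigma>(h) \<cdot> \<iota>(x)\<close>.\<close>

definition conjugation_action :: "'a sset \<Rightarrow> (nat \<Rightarrow> 'a \<Rightarrow> 'e) \<Rightarrow> 'e sset \<Rightarrow> 'h sset \<Rightarrow>
    (nat \<Rightarrow> 'h \<Rightarrow> 'e) \<Rightarrow> (nat \<Rightarrow> 'h \<Rightarrow> (nat \<Rightarrow> 'a \<Rightarrow> 'a) list) \<Rightarrow> bool" where
  "conjugation_action M \<iota> E H \<sigma> \<rho> \<longleftrightarrow>
     (\<forall>h \<in> cells H 1. htpy M E (\<lambda>n. \<iota> n \<circ> act_by \<rho> h n) (\<sigma> 1 h) \<iota>)"

end

theory Submission
  imports Defs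
begin

text \<open>
  Cells of a partial monoid are determined by their edges \<open>x\<^sub>i\<^sub>j\<close>, so identities between simplicial
  maps into it reduce to products of two edges; only the existence of cells needs an argument, and
  it always comes from the local trivialisations \<open>M \<times> \<Delta>[n] \<cong> b\<^sup>*E\<close>. Comparing a homotopy of
  \<open>\<iota>\<close> over an edge h of H with such a trivialisation turns it into a homotopy of the identity of M.
  Hence if s is the element of one homotopy of \<open>\<iota>\<close> over h whose other end is an isomorphism onto
  the fibre, then the elements over h that define homotopies of \<open>\<iota>\<close> are the products \<open>\<theta> s\<close> with
  \<open>\<theta> \<in> N(M)\<close>.

  For (a), the elements \<open>s(g) = (1, g)\<close> of the twisted product are of this kind. A regular section
  has the form \<open>g \<mapsto> \<theta>(g) s(g)\<close>, and multiplicativity is the coboundary equation for \<open>\<theta>\<close>.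

  For (b), the homotopies belonging to a regular section \<open>\<sigma>\<close> are composed over the simplices of H to
  coordinates \<open>E\<^sub>n \<cong> M\<^sub>n \<times> H\<^sub>n\<close> in which only the face \<open>d\<^sub>0\<close> is twisted by the action. So sections
  are derivations, E has an inversion, and homotopies of sections whose element lies in the fibre
  are equivalences of derivations. A homotopy whose element x lies over \<open>z \<noteq> 1\<close> is moved into the
  fibre by means of the reverse of its image in H.
\<close>

section \<open>Monotone maps\<close>

text \<open>The end of a homotopy of \<iota> at the vertex 0 is not known in advance to be an
  isomorphism onto the fibre. Without this, the inverse of its element may fail to lie in
  \<open>NN M\<close>, and the homotopy need not be a trivialisation. Hence the double notions
  \<open>NN\<close>, \<open>NNs\<close> and \<open>ihtpy\<close>, \<open>strong_ihtpy\<close>. A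
  regular section supplies the missing bijectivity: homotopies of \<iota> along the spine of a
  simplex assemble, bijective or not, to a map M \<times> \<Delta>[n] \<rightarrow> E. Over
  2-simplices of H this makes conjugation by \<sigma> multiplicative. So conjugation by
  \<sigma>(h\<inverse>) inverts conjugation by \<sigma>(h), and the homotopies of \<sigma> are
  strong after all. The other obstacle is that M and H have cancellation, while E starts out as a
  mere simplicial set. Uniqueness statements in E are therefore pulled back to M through
  trivialisations. An inversion of E is available only once the section has given coordinates, and
  reversing homotopies of sections depends on it.\<close>

declare One_nat_def [simp del] replicate_Suc [simp del] upt_Suc [simp del]

lemma Suc_0_eq_1 [simp]: "Suc 0 = 1"
  by (simp add: One_nat_def)

lemma upt_0_1 [simp]: "[0..<1] = [0::nat]"
  by (simp add: One_nat_def upt_Suc del: Suc_0_eq_1)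

lemma mono_maps_iff: "\<alpha> \<in> mono_maps m n \<longleftrightarrow> length \<alpha> = Suc m \<and> (\<forall>i j. i \<le> j \<longrightarrow> j \<le> m \<longrightarrow> \<alpha> ! i \<le> \<alpha> ! j) \<and> \<alpha> ! m \<le> n"
proof
  assume a: "\<alpha> \<in> mono_maps m n"
  then have l: "length \<alpha> = Suc m" and s: "sorted \<alpha>" and le: "set \<alpha> \<subseteq> {..n}"
    by (auto simp: mono_maps_def)
  have "\<alpha> ! m \<in> set \<alpha>" using l by simp
  then have "\<alpha> ! m \<le> n" using le by auto
  moreover have "\<forall>i j. i \<le> j \<longrightarrow> j \<le> m \<longrightarrow> \<alpha> ! i \<le> \<alpha> ! j"
    using s l by (simp add: sorted_iff_nth_mono)
  ultimately show "length \<alpha> = Suc m \<and> (\<forall>i j. i \<le> j \<longrightarrow> j \<le> m \<longrightarrow> \<alpha> ! i \<le> \<alpha> ! j) \<and> \<alpha> ! m \<le> n"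
    using l by blast
next
  assume a: "length \<alpha> = Suc m \<and> (\<forall>i j. i \<le> j \<longrightarrow> j \<le> m \<longrightarrow> \<alpha> ! i \<le> \<alpha> ! j) \<and> \<alpha> ! m \<le> n"
  have "\<alpha> ! i \<le> n" if "i < length \<alpha>" for i
    using a that by (metis le_trans less_Suc_eq_le order_refl)
  then show "\<alpha> \<in> mono_maps m n"
    using a by (auto simp: mono_maps_def sorted_iff_nth_mono in_set_conv_nth)
qed

lemma mono_maps_length: "\<alpha> \<in> mono_maps m n \<Longrightarrow> length \<alpha> = Suc m"
  by (simp add: mono_maps_iff)

lemma mono_maps_nth_mono: "\<alpha> \<in> mono_maps m n \<Longrightarrow> i \<le> j \<Longrightarrow> j \<le> m \<Longrightarrow> \<alpha> ! i \<le> \<alpha> ! j"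
  by (simp add: mono_maps_iff)

lemma mono_maps_nth_le: "\<alpha> \<in> mono_maps m n \<Longrightarrow> i \<le> m \<Longrightarrow> \<alpha> ! i \<le> n"
  by (meson le_trans mono_maps_iff order_refl)

lemma pair_in_mono_maps [simp]: "[i, j] \<in> mono_maps 1 n \<longleftrightarrow> i \<le> j \<and> j \<le> n"
  by (auto simp: mono_maps_def)

lemma single_in_mono_maps [simp]: "[i] \<in> mono_maps 0 n \<longleftrightarrow> i \<le> n"
  by (auto simp: mono_maps_def)

lemma triple_in_mono_maps: "i \<le> j \<Longrightarrow> j \<le> k \<Longrightarrow> k \<le> n \<Longrightarrow> [i, j, k] \<in> mono_maps 2 n"
  by (auto simp: mono_maps_def)

lemma replicate_in_mono_maps [simp]: "replicate (Suc m) i \<in> mono_maps m n \<longleftrightarrow> i \<le> n"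
  by (auto simp: mono_maps_def)

lemma id_in_mono_maps: "[0..<Suc n] \<in> mono_maps n n"
  by (auto simp: mono_maps_def)

lemma comp_in_mono_maps:
  assumes "\<alpha> \<in> mono_maps m n" "\<beta> \<in> mono_maps l m"
  shows "map ((!) \<alpha>) \<beta> \<in> mono_maps l n"
proof -
  have "\<beta> ! i \<le> m" if "i \<le> l" for i using assms(2) that by (rule mono_maps_nth_le)
  moreover have "\<beta> ! i \<le> \<beta> ! j" if "i \<le> j" "j \<le> l" for i j
    using assms(2) that by (rule mono_maps_nth_mono)
  ultimately show ?thesis
    using assms mono_maps_nth_mono[OF assms(1)] mono_maps_nth_le[OF assms(1)]
    by (auto simp: mono_maps_iff[of _ l n] mono_maps_length)
qed

lemma map_replicate_nth:
  "\<beta> \<in> mono_maps l m \<Longrightarrow> map ((!) (replicate (Suc m) i)) \<beta> = replicate (Suc l) i"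
  by (rule nth_equalityI) (auto simp: mono_maps_length less_Suc_eq_le nth_replicate mono_maps_nth_le)

lemma map_nth_id:
  "\<alpha> \<in> mono_maps m n \<Longrightarrow> map ((!) \<alpha>) [0..<Suc m] = \<alpha>"
  by (rule nth_equalityI) (auto simp: mono_maps_length less_Suc_eq_le)

lemma mono_maps_map:
  assumes "\<And>i j. i \<le> j \<Longrightarrow> j \<le> m \<Longrightarrow> f i \<le> f j" "f m \<le> n"
  shows "map f [0..<Suc m] \<in> mono_maps m n"
  using assms by (auto simp: mono_maps_iff)

text \<open>As tables of a function these lists can be evaluated at each index, which is what the
  edges of faces and degeneracies require.\<close>

lemma degen_list: "i \<le> n \<Longrightarrow> [0..<Suc i] @ [i..<Suc n] = map (\<lambda>j. if j \<le> i then j else j - 1) [0..<Suc (Suc n)]"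
  by (rule nth_equalityI) (auto simp: nth_append)

lemma face_list: "i \<le> n \<Longrightarrow> 1 \<le> n \<Longrightarrow> [0..<i] @ [Suc i..<Suc n] = map (\<lambda>j. if j < i then j else Suc j) [0..<Suc (n - 1)]"
  by (rule nth_equalityI) (auto simp: nth_append)

lemma degen_list_mono: "i \<le> n \<Longrightarrow> [0..<Suc i] @ [i..<Suc n] \<in> mono_maps (Suc n) n"
  by (subst degen_list, assumption, rule mono_maps_map) auto

lemma face_list_mono: "i \<le> n \<Longrightarrow> 1 \<le> n \<Longrightarrow> [0..<i] @ [Suc i..<Suc n] \<in> mono_maps (n - 1) n"
  by (subst face_list, assumption, assumption, rule mono_maps_map) auto

lemma degen_list_nth: "i \<le> n \<Longrightarrow> j \<le> Suc n \<Longrightarrow> ([0..<Suc i] @ [i..<Suc n]) ! j = (if j \<le> i then j else j - 1)"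
  by (subst degen_list) auto

lemma face_list_nth: "i \<le> n \<Longrightarrow> 1 \<le> n \<Longrightarrow> j < n \<Longrightarrow> ([0..<i] @ [Suc i..<Suc n]) ! j = (if j < i then j else Suc j)"
  by (subst face_list) auto

section \<open>Simplicial sets and edges\<close>

abbreviation edge :: "'a sset \<Rightarrow> nat \<Rightarrow> nat \<Rightarrow> nat \<Rightarrow> 'a \<Rightarrow> 'a" where
  "edge X n i j u \<equiv> act X n [i, j] u"

lemma act_cells:
  "simplicial_set X \<Longrightarrow> \<alpha> \<in> mono_maps m n \<Longrightarrow> x \<in> cells X n \<Longrightarrow> act X n \<alpha> x \<in> cells X m"
  by (simp add: simplicial_set_def)

lemma act_id: "simplicial_set X \<Longrightarrow> x \<in> cells X n \<Longrightarrow> act X n [0..<Suc n] x = x"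
  by (simp add: simplicial_set_def)

lemma act_act:
  "simplicial_set X \<Longrightarrow> \<alpha> \<in> mono_maps m n \<Longrightarrow> \<beta> \<in> mono_maps l m \<Longrightarrow> x \<in> cells X n \<Longrightarrow>
    act X m \<beta> (act X n \<alpha> x) = act X n (map ((!) \<alpha>) \<beta>) x"
  by (simp add: simplicial_set_def)

lemma edge_cells:
  "simplicial_set X \<Longrightarrow> x \<in> cells X n \<Longrightarrow> i \<le> j \<Longrightarrow> j \<le> n \<Longrightarrow> edge X n i j x \<in> cells X 1"
  by (simp add: act_cells)

lemma edge_act:
  "simplicial_set X \<Longrightarrow> \<alpha> \<in> mono_maps m n \<Longrightarrow> x \<in> cells X n \<Longrightarrow> i \<le> j \<Longrightarrow> j \<le> m \<Longrightarrow>
    edge X m i j (act X n \<alpha> x) = edge X n (\<alpha> ! i) (\<alpha> ! j) x"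
  using act_act[of X \<alpha> m n "[i, j]" 1 x] by simp

lemma edge_id: "simplicial_set X \<Longrightarrow> x \<in> cells X 1 \<Longrightarrow> edge X 1 0 1 x = x"
  using act_id[of X x 1] by (simp add: upt_conv_Cons)

lemma simplicial_map_cells: "simplicial_map X Y f \<Longrightarrow> x \<in> cells X n \<Longrightarrow> f n x \<in> cells Y n"
  by (simp add: simplicial_map_def)

lemma simplicial_map_act:
  "simplicial_map X Y f \<Longrightarrow> \<alpha> \<in> mono_maps m n \<Longrightarrow> x \<in> cells X n \<Longrightarrow>
    f m (act X n \<alpha> x) = act Y n \<alpha> (f n x)"
  by (simp add: simplicial_map_def)

lemma simplicial_map_edge:
  "simplicial_map X Y f \<Longrightarrow> x \<in> cells X n \<Longrightarrow> i \<le> j \<Longrightarrow> j \<le> n \<Longrightarrow>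
    edge Y n i j (f n x) = f 1 (edge X n i j x)"
  by (simp add: simplicial_map_def)

lemma simplicial_map_comp:
  "simplicial_map X Y f \<Longrightarrow> simplicial_map Y Z g \<Longrightarrow> simplicial_map X Z (\<lambda>n. g n \<circ> f n)"
  by (simp add: simplicial_map_def)

lemma simplicial_map_cong:
  assumes "simplicial_map X Y f" "simplicial_set X" "\<And>n x. x \<in> cells X n \<Longrightarrow> f n x = g n x"
  shows "simplicial_map X Y g"
  using assms by (auto simp: simplicial_map_def simplicial_set_def)

section \<open>Partial monoids\<close>

lemma pm_simplicial: "partial_monoid M \<Longrightarrow> simplicial_set M"
  by (simp add: partial_monoid_def)

lemma pg_pm: "partial_group M \<Longrightarrow> partial_monoid M"
  by (simp add: partial_group_def)

lemma pm_vertex: "partial_monoid M \<Longrightarrow> vertex M \<in> cells M 0"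
  by (metis partial_monoid_def theI' vertex_def)

lemma pm_vertex_unique: "partial_monoid M \<Longrightarrow> x \<in> cells M 0 \<Longrightarrow> x = vertex M"
  using pm_vertex by (metis partial_monoid_def)

lemma pm_eqI:
  assumes M: "partial_monoid M" and "u \<in> cells M n" "v \<in> cells M n"
    and "\<And>i. i < n \<Longrightarrow> edge M n i (Suc i) u = edge M n i (Suc i) v"
  shows "u = v"
proof (cases "n = 0")
  \<comment> \<open>Spines are injective only from degree 1 on; in degree 0 there is just the
    vertex.\<close>
  case True then show ?thesis using assms pm_vertex_unique by metis
next
  case False
  then have "inj_on (spine M n) (cells M n)" using M by (simp add: partial_monoid_def)
  moreover have "spine M n u = spine M n v" using assms(4) by (auto simp: spine_def)
  ultimately show ?thesis using assms by (meson inj_onD)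
qed

lemma pm_eqI_edges:
  assumes M: "partial_monoid M" and "u \<in> cells M n" "v \<in> cells M n"
    and "\<And>i j. i \<le> j \<Longrightarrow> j \<le> n \<Longrightarrow> edge M n i j u = edge M n i j v"
  shows "u = v"
  using assms pm_eqI[OF M] by simp

text \<open>Operators send edges to edges and a cell of the target is determined by its edges, so
  naturality has to be tested on the maps [1] \<rightarrow> [n] only. Sections of E are shown to be
  simplicial in this way.\<close>

lemma simplicial_map_edgeI:
  assumes Y: "simplicial_set Y" and X: "partial_monoid X"
    and c: "\<And>n y. y \<in> cells Y n \<Longrightarrow> f n y \<in> cells X n"
    and e: "\<And>n y i j. y \<in> cells Y n \<Longrightarrow> i \<le> j \<Longrightarrow> j \<le> n \<Longrightarrow> edge X n i j (f n y) = f 1 (edge Y n i j y)"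
  shows "simplicial_map Y X f"
  unfolding simplicial_map_def
proof (intro conjI allI ballI)
  fix m n \<alpha> y assume a: "\<alpha> \<in> mono_maps m n" and y: "y \<in> cells Y n"
  show "f m (act Y n \<alpha> y) = act X n \<alpha> (f n y)"
    by (rule pm_eqI_edges[OF X, of _ m])
      (use a y in \<open>auto simp: c e act_cells[OF Y] act_cells[OF pm_simplicial[OF X]] edge_act[OF Y]
        edge_act[OF pm_simplicial[OF X]] mono_maps_nth_le mono_maps_nth_mono\<close>)
qed (use c in auto)

lemma unit_eq: "unit M = act M 0 [0, 0] (vertex M)"
  by (simp add: unit_def degen_def)

lemma unit_cells: "partial_monoid M \<Longrightarrow> unit M \<in> cells M 1"
  unfolding unit_eq by (rule act_cells[OF pm_simplicial]) (auto simp: pm_vertex)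

lemma edge_degenerate:
  assumes M: "partial_monoid M" and u: "u \<in> cells M n" and i: "i \<le> n"
  shows "edge M n i i u = unit M"
proof -
  have "act M n [i] u = vertex M"
    by (rule pm_vertex_unique[OF M]) (simp add: act_cells[OF pm_simplicial[OF M]] u i)
  moreover have "act M 0 [0, 0] (act M n [i] u) = edge M n i i u"
    by (subst act_act[OF pm_simplicial[OF M], of _ 0 n _ 1]) (simp_all add: u i)
  ultimately show ?thesis by (simp add: unit_eq)
qed

lemma vertex_cell_cells: "partial_monoid M \<Longrightarrow> vertex_cell M n \<in> cells M n"
  unfolding vertex_cell_def
  by (rule act_cells[OF pm_simplicial]) (auto simp: pm_vertex)

lemma edge_vertex_cell:
  assumes "partial_monoid M" "i \<le> j" "j \<le> n"
  shows "edge M n i j (vertex_cell M n) = unit M"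
  unfolding vertex_cell_def unit_eq
  by (subst edge_act[OF pm_simplicial[OF assms(1)], of _ n 0])
    (use assms in \<open>auto simp: pm_vertex nth_replicate\<close>)

lemma vertex_cell_1: "vertex_cell M 1 = unit M"
  unfolding vertex_cell_def unit_eq One_nat_def replicate_Suc replicate_0 ..

lemma act_const:
  assumes M: "partial_monoid M" and u: "u \<in> cells M n" and i: "i \<le> n"
  shows "act M n (replicate (Suc m) i) u = vertex_cell M m"
  by (rule pm_eqI_edges[OF M, of _ m])
    (use assms in \<open>auto simp: act_cells[OF pm_simplicial] vertex_cell_cells edge_act[OF pm_simplicial]
      edge_vertex_cell edge_degenerate nth_replicate\<close>)

lemma simplicial_map_vertex_cell:
  assumes "partial_monoid X" "partial_monoid Y" "simplicial_map X Y f"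
  shows "f n (vertex_cell X n) = vertex_cell Y n"
proof -
  have "f 0 (vertex X) = vertex Y"
    using assms by (meson pm_vertex pm_vertex_unique simplicial_map_cells)
  then show ?thesis
    unfolding vertex_cell_def using assms
    by (simp add: simplicial_map_act pm_vertex)
qed

lemma simplicial_map_unit:
  assumes "partial_monoid X" "partial_monoid Y" "simplicial_map X Y f"
  shows "f 1 (unit X) = unit Y"
  using simplicial_map_vertex_cell[OF assms, of 1] by (simp add: vertex_cell_1)

text \<open>Unlike \<open>mprod\<close>, which has a value on every list, this relation carries the
  existence of the 2-simplex with it. It can be read off any three vertices of a larger cell, and
  injectivity of spines makes it functional.\<close>

definition mul :: "'a sset \<Rightarrow> 'a \<Rightarrow> 'a \<Rightarrow> 'a \<Rightarrow> bool" where
  "mul X a b c \<longleftrightarrow> (\<exists>u \<in> cells X 2. edge X 2 0 1 u = a \<and> edge X 2 1 2 u = b \<and> edge X 2 0 2 u = c)"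

lemma mul_edges:
  assumes X: "simplicial_set X" and u: "u \<in> cells X n" and "i \<le> j" "j \<le> k" "k \<le> n"
  shows "mul X (edge X n i j u) (edge X n j k u) (edge X n i k u)"
  unfolding mul_def
  by (rule bexI[of _ "act X n [i, j, k] u"])
    (use assms triple_in_mono_maps[of i j k n] in \<open>auto simp: edge_act[OF X] act_cells[OF X]\<close>)

lemma mul_cells: "simplicial_set X \<Longrightarrow> mul X a b c \<Longrightarrow> a \<in> cells X 1 \<and> b \<in> cells X 1 \<and> c \<in> cells X 1"
  by (auto simp: mul_def edge_cells)

lemma mul_fun:
  assumes X: "partial_monoid X" and "mul X a b c" "mul X a b c'"
  shows "c = c'"
proof -
  obtain u v where uv: "u \<in> cells X 2" "v \<in> cells X 2" "edge X 2 0 1 u = a" "edge X 2 1 2 u = b" "edge X 2 0 2 u = c"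
    "edge X 2 0 1 v = a" "edge X 2 1 2 v = b" "edge X 2 0 2 v = c'"
    using assms(2,3) unfolding mul_def by blast
  have "u = v"
  proof (rule pm_eqI[OF X uv(1,2)])
    fix i :: nat assume "i < 2"
    then consider "i = 0" | "i = 1" by linarith
    then show "edge X 2 i (Suc i) u = edge X 2 i (Suc i) v"
      using uv by cases auto
  qed
  then show ?thesis using uv by simp
qed

lemma mul_map:
  assumes f: "simplicial_map X Y f" and "mul X a b c"
  shows "mul Y (f 1 a) (f 1 b) (f 1 c)"
proof -
  obtain u where u: "u \<in> cells X 2" "edge X 2 0 1 u = a" "edge X 2 1 2 u = b" "edge X 2 0 2 u = c"
    using assms(2) unfolding mul_def by blast
  show ?thesis
    unfolding mul_def
    by (rule bexI[of _ "f 2 u"])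
      (use u simplicial_map_edge[OF f u(1)] in \<open>auto simp: simplicial_map_cells[OF f]\<close>)
qed

text \<open>The 2-simplex is the degeneracy of the edge with vertices 0, 1, 1.\<close>

lemma mul_unit_right:
  assumes X: "partial_monoid X" and a: "a \<in> cells X 1"
  shows "mul X a (unit X) a"
  using mul_edges[OF pm_simplicial[OF X] a, of 0 1 1] edge_degenerate[OF X a, of 1]
  by (simp add: edge_id[OF pm_simplicial[OF X] a, simplified])

lemma mul_unit_left:
  assumes X: "partial_monoid X" and a: "a \<in> cells X 1"
  shows "mul X (unit X) a a"
  using mul_edges[OF pm_simplicial[OF X] a, of 0 0 1] edge_degenerate[OF X a, of 0]
  by (simp add: edge_id[OF pm_simplicial[OF X] a, simplified])

section \<open>Spines, words and their products\<close>

lemma length_spine [simp]: "length (spine X n u) = n"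
  by (simp add: spine_def)

lemma spine_nth: "i < n \<Longrightarrow> spine X n u ! i = edge X n i (Suc i) u"
  by (simp add: spine_def)

lemma spine_eq_iff: "spine X n u = xs \<longleftrightarrow> length xs = n \<and> (\<forall>i<n. edge X n i (Suc i) u = xs ! i)"
  by (auto simp: list_eq_iff_nth_eq spine_nth)

lemma words_iff: "length xs = n \<Longrightarrow> xs \<in> words X \<longleftrightarrow> (\<exists>u \<in> cells X n. \<forall>i<n. edge X n i (Suc i) u = xs ! i)"
  by (auto simp: words_def spine_eq_iff)

lemma word_eqI:
  assumes X: "partial_monoid X" and "u \<in> cells X n" "length xs = n" "\<And>i. i < n \<Longrightarrow> edge X n i (Suc i) u = xs ! i"
  shows "word X xs = u"
  unfolding word_def
proof (rule the_equality)
  show "u \<in> cells X (length xs) \<and> spine X (length xs) u = xs" using assms by (simp add: spine_eq_iff)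
next
  fix v assume "v \<in> cells X (length xs) \<and> spine X (length xs) v = xs"
  then show "v = u" using assms by (auto simp: spine_eq_iff intro!: pm_eqI[OF X, of v n u])
qed

lemma mprod_eqI:
  assumes X: "partial_monoid X" and "u \<in> cells X n" "length xs = n" "\<And>i. i < n \<Longrightarrow> edge X n i (Suc i) u = xs ! i"
  shows "mprod X xs = edge X n 0 n u"
  unfolding mprod_def using word_eqI[OF assms] assms(3) by simp

lemma spine_in_words: "u \<in> cells X n \<Longrightarrow> spine X n u \<in> words X"
  by (auto simp: words_def)

lemma all_less_2: "(\<forall>i<(2::nat). P i) \<longleftrightarrow> P 0 \<and> P 1"
  by (auto simp: less_2_cases_iff)

lemma words_pair_iff:
  assumes X: "partial_monoid X"
  shows "[a, b] \<in> words X \<longleftrightarrow> (\<exists>c. mul X a b c)"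
  by (subst words_iff[of _ 2]) (auto simp: mul_def[abs_def] all_less_2)

lemma mprod_pair:
  assumes X: "partial_monoid X" and "mul X a b c"
  shows "mprod X [a, b] = c"
proof -
  obtain u where u: "u \<in> cells X 2" "edge X 2 0 1 u = a" "edge X 2 1 2 u = b" "edge X 2 0 2 u = c"
    using assms(2) unfolding mul_def by blast
  show ?thesis using u
    by (subst mprod_eqI[OF X u(1)]) (auto simp: less_2_cases_iff)
qed

lemma mul_mprod: "partial_monoid X \<Longrightarrow> [a, b] \<in> words X \<Longrightarrow> mul X a b (mprod X [a, b])"
  using words_pair_iff mprod_pair by metis

section \<open>Partial groups\<close>

lemma upt_mono_maps: "i \<le> j \<Longrightarrow> j \<le> n \<Longrightarrow> [i..<Suc j] \<in> mono_maps (j - i) n"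
  by (auto simp: mono_maps_iff)

definition nu :: "'a sset \<Rightarrow> nat \<Rightarrow> 'a \<Rightarrow> 'a" where
  "nu M = (SOME \<nu>. inversion M \<nu>)"

abbreviation inv1 :: "'a sset \<Rightarrow> 'a \<Rightarrow> 'a" where
  "inv1 M \<equiv> nu M 1"

lemma inverse_elt_eq: "inverse_elt M x = inv1 M x"
  by (simp add: inverse_elt_def nu_def)

lemma nu_inversion: "partial_group M \<Longrightarrow> inversion M (nu M)"
  unfolding nu_def partial_group_def by (metis someI)

lemma nu_cells: "partial_group M \<Longrightarrow> u \<in> cells M n \<Longrightarrow> nu M n u \<in> cells M n"
  using nu_inversion[of M] by (simp add: inversion_def simplicial_map_def opposite_def)

lemma nu_nu: "partial_group M \<Longrightarrow> u \<in> cells M n \<Longrightarrow> nu M n (nu M n u) = u"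
  using nu_inversion[of M] by (simp add: inversion_def)

lemma nu_edge:
  assumes "partial_group M" "u \<in> cells M n" "i \<le> j" "j \<le> n"
  shows "edge M n i j (nu M n u) = inv1 M (edge M n (n - j) (n - i) u)"
proof -
  have m: "[n - j, n - i] \<in> mono_maps 1 n" using assms by auto
  have "nu M 1 (act M n [n - j, n - i] u) = act (opposite M) n [n - j, n - i] (nu M n u)"
    using nu_inversion[OF assms(1)] m assms(2) unfolding inversion_def simplicial_map_def by blast
  then show ?thesis using assms by (simp add: opposite_def)
qed

lemma nu_word:
  assumes M: "partial_group M" and u: "u \<in> cells M n" and n: "n \<ge> 1"
  shows "\<exists>w \<in> cells M (n + n). (\<forall>i<n. edge M (n + n) i (Suc i) w = edge M n i (Suc i) (nu M n u)) \<and>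
     (\<forall>i<n. edge M (n + n) (n + i) (Suc (n + i)) w = edge M n i (Suc i) u) \<and>
     edge M (n + n) 0 (n + n) w = unit M"
proof -
  have *: "spine M n (nu M n u) @ spine M n u \<in> words M"
    "mprod M (spine M n (nu M n u) @ spine M n u) = unit M"
    using nu_inversion[OF M] u n unfolding inversion_def by blast+
  then obtain w where w: "w \<in> cells M (n + n)"
    "\<And>i. i < n + n \<Longrightarrow> edge M (n + n) i (Suc i) w = (spine M n (nu M n u) @ spine M n u) ! i"
    by (subst (asm) words_iff[of _ "n + n"]) auto
  have "mprod M (spine M n (nu M n u) @ spine M n u) = edge M (n + n) 0 (n + n) w"
    by (rule mprod_eqI[OF pg_pm[OF M] w(1)]) (use w(2) in auto)
  with * w show ?thesis
    by (intro bexI[of _ w]) (auto simp: nth_append spine_nth)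
qed

lemma nu_faces:
  assumes M: "partial_group M" and u: "u \<in> cells M n" and n: "n \<ge> 1"
  shows "\<exists>w \<in> cells M (n + n). act M (n + n) [0..<Suc n] w = nu M n u \<and>
    act M (n + n) [n..<Suc (n + n)] w = u \<and> edge M (n + n) 0 (n + n) w = unit M"
proof -
  have P: "partial_monoid M" and S: "simplicial_set M" using M by (simp_all add: pg_pm pm_simplicial)
  obtain w where w: "w \<in> cells M (n + n)"
    and w1: "\<And>i. i < n \<Longrightarrow> edge M (n + n) i (Suc i) w = edge M n i (Suc i) (nu M n u)"
    and w2: "\<And>i. i < n \<Longrightarrow> edge M (n + n) (n + i) (Suc (n + i)) w = edge M n i (Suc i) u"
    and w3: "edge M (n + n) 0 (n + n) w = unit M"
    using nu_word[OF assms] by blast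
  have a: "[0..<Suc n] \<in> mono_maps n (n + n)" and b: "[n..<Suc (n + n)] \<in> mono_maps n (n + n)"
    using upt_mono_maps[of 0 n "n + n"] upt_mono_maps[of n "n + n" "n + n"] by auto
  have "act M (n + n) [0..<Suc n] w = nu M n u"
    by (rule pm_eqI[OF P act_cells[OF S a w] nu_cells[OF M u]]) (simp add: edge_act[OF S a w] w1)
  moreover have "act M (n + n) [n..<Suc (n + n)] w = u"
    by (rule pm_eqI[OF P act_cells[OF S b w] u]) (simp add: edge_act[OF S b w] w2)
  ultimately show ?thesis using w w3 by blast
qed

text \<open>In a partial monoid naturality and involutivity of \<nu> can be tested on edges. The
  existence of [\<nu>(u)|u] cannot; it is required as a cell with two given faces, a form that can
  be verified in coordinates on E.\<close>

lemma inversionI: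
  assumes X: "partial_monoid X"
    and c: "\<And>n u. u \<in> cells X n \<Longrightarrow> \<nu> n u \<in> cells X n"
    and e: "\<And>n u i j. u \<in> cells X n \<Longrightarrow> i \<le> j \<Longrightarrow> j \<le> n \<Longrightarrow> edge X n i j (\<nu> n u) = \<nu> 1 (edge X n (n - j) (n - i) u)"
    and i: "\<And>a. a \<in> cells X 1 \<Longrightarrow> \<nu> 1 (\<nu> 1 a) = a"
    and w: "\<And>n u. u \<in> cells X n \<Longrightarrow> n \<ge> 1 \<Longrightarrow> \<exists>w \<in> cells X (n + n). act X (n + n) [0..<Suc n] w = \<nu> n u \<and>
      act X (n + n) [n..<Suc (n + n)] w = u \<and> edge X (n + n) 0 (n + n) w = unit X"
  shows "inversion X \<nu>"
  unfolding inversion_def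
proof (intro conjI allI ballI impI)
  note S = pm_simplicial[OF X]
  show "simplicial_map X (opposite X) \<nu>"
    unfolding simplicial_map_def
  proof (intro conjI allI ballI)
    show "\<nu> n u \<in> cells (opposite X) n" if "u \<in> cells X n" for n u using c[OF that] by (simp add: opposite_def)
    fix m n \<alpha> u assume a: "\<alpha> \<in> mono_maps m n" and u: "u \<in> cells X n"
    let ?a = "rev (map (\<lambda>j. n - j) \<alpha>)"
    have a': "?a \<in> mono_maps m n"
      using a by (auto simp: mono_maps_iff rev_nth intro!: diff_le_mono2)
    have n: "?a ! k = n - \<alpha> ! (m - k)" if "k \<le> m" for k
      using a that by (simp add: rev_nth mono_maps_length)
    have "\<nu> m (act X n \<alpha> u) = act X n ?a (\<nu> n u)"
    proof (rule pm_eqI_edges[OF X c[OF act_cells[OF S a u]] act_cells[OF S a' c[OF u]]])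
      fix p q assume pq: "p \<le> q" "q \<le> m"
      have le: "\<alpha> ! (m - q) \<le> \<alpha> ! (m - p)" "\<alpha> ! (m - p) \<le> n"
        using mono_maps_nth_mono[OF a, of "m - q" "m - p"] mono_maps_nth_le[OF a, of "m - p"] pq by auto
      then show "edge X m p q (\<nu> m (act X n \<alpha> u)) = edge X m p q (act X n ?a (\<nu> n u))"
        using pq by (simp add: e[OF act_cells[OF S a u]] edge_act[OF S a u] edge_act[OF S a' c[OF u]] e[OF u] n)
    qed
    then show "\<nu> m (act X n \<alpha> u) = act (opposite X) n \<alpha> (\<nu> n u)" by (simp add: opposite_def)
  qed
  show "\<nu> n (\<nu> n u) = u" if u: "u \<in> cells X n" for n u
    by (rule pm_eqI_edges[OF X c[OF c[OF u]] u]) (use u in \<open>simp add: e c edge_cells[OF S] i\<close>)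
  fix n u assume n: "1 \<le> (n::nat)" and u: "u \<in> cells X n"
  obtain w where w: "w \<in> cells X (n + n)" and w1: "act X (n + n) [0..<Suc n] w = \<nu> n u"
    and w2: "act X (n + n) [n..<Suc (n + n)] w = u" and w3: "edge X (n + n) 0 (n + n) w = unit X"
    using w[OF u n] by blast
  have a: "[0..<Suc n] \<in> mono_maps n (n + n)" and b: "[n..<Suc (n + n)] \<in> mono_maps n (n + n)"
    using upt_mono_maps[of 0 n "n + n"] upt_mono_maps[of n "n + n" "n + n"] by auto
  have "edge X (n + n) i (Suc i) w = (spine X n (\<nu> n u) @ spine X n u) ! i" if i: "i < n + n" for i
  proof (cases "i < n")
    case True
    then show ?thesis using edge_act[OF S a w, of i "Suc i"] w1 by (simp add: nth_append spine_nth)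
  next
    case False
    then show ?thesis using edge_act[OF S b w, of "i - n" "Suc (i - n)"] w2 i
      by (simp add: nth_append spine_nth Suc_diff_le)
  qed
  note we = this
  show "spine X n (\<nu> n u) @ spine X n u \<in> words X"
    by (subst words_iff[of _ "n + n"]) (use w we in auto)
  show "mprod X (spine X n (\<nu> n u) @ spine X n u) = unit X"
    by (subst mprod_eqI[OF X w _ we]) (auto simp: w3)
qed

lemma inv1_cells: "partial_group M \<Longrightarrow> a \<in> cells M 1 \<Longrightarrow> inv1 M a \<in> cells M 1"
  by (rule nu_cells)

lemma inv1_mul:
  assumes M: "partial_group M" and a: "a \<in> cells M 1"
  shows "mul M (inv1 M a) a (unit M)"
proof -
  have S: "simplicial_set M" using M by (simp add: pg_pm pm_simplicial)
  obtain w where w: "w \<in> cells M (1 + 1)" "edge M (1 + 1) 0 1 w = edge M 1 0 1 (nu M 1 a)"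
    "edge M (1 + 1) 1 2 w = edge M 1 0 1 a" "edge M (1 + 1) 0 2 w = unit M"
    using nu_word[OF M a] by auto
  then show ?thesis
    unfolding mul_def using a M by (auto simp: edge_id[OF S] inv1_cells)
qed

lemma mul_inv1:
  assumes M: "partial_group M" and a: "a \<in> cells M 1"
  shows "mul M a (inv1 M a) (unit M)"
  using inv1_mul[OF M inv1_cells[OF M a]] nu_nu[OF M a] by simp

text \<open>Associativity presupposes that [a|b|b\<inverse>] exists. It is a face of
  [a|b|b\<inverse>|a\<inverse>], which is the simplex [\<nu>(v)|v] of the axiom for v = \<nu>(u) and
  u = [a|b].\<close>

lemma mul_cancel_right_inv:
  assumes M: "partial_group M" and ab: "mul M a b c"
  shows "mul M c (inv1 M b) a"
proof -
  have P: "partial_monoid M" and S: "simplicial_set M" using M by (simp_all add: pg_pm pm_simplicial)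
  obtain u where u: "u \<in> cells M 2" "edge M 2 0 1 u = a" "edge M 2 1 2 u = b" "edge M 2 0 2 u = c"
    using ab unfolding mul_def by blast
  obtain w where w: "w \<in> cells M 4" and
    w1: "\<And>i. i < 2 \<Longrightarrow> edge M 4 i (Suc i) w = edge M 2 i (Suc i) u" and
    w2: "\<And>i. i < 2 \<Longrightarrow> edge M 4 (2 + i) (Suc (2 + i)) w = edge M 2 i (Suc i) (nu M 2 u)"
    using nu_word[OF M nu_cells[OF M u(1)]] u(1) by (auto simp: nu_nu[OF M])
  have e01: "edge M 4 0 1 w = a" and e12: "edge M 4 1 2 w = b" using w1[of 0] w1[of 1] u by auto
  have e23: "edge M 4 2 3 w = inv1 M b"
    using w2[of 0] nu_edge[OF M u(1), of 0 1] u by simp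
  have a: "a \<in> cells M 1" and b: "b \<in> cells M 1" using mul_cells[OF S ab] by auto
  have e02: "edge M 4 0 2 w = c"
    using mul_edges[OF S w, of 0 1 2] e01 e12 ab mul_fun[OF P] by auto
  have e13: "edge M 4 1 3 w = unit M"
    using mul_edges[OF S w, of 1 2 3] e12 e23 mul_inv1[OF M b] mul_fun[OF P] by auto
  have e03: "edge M 4 0 3 w = a"
    using mul_edges[OF S w, of 0 1 3] e01 e13 mul_unit_right[OF P a] mul_fun[OF P] by auto
  show ?thesis using mul_edges[OF S w, of 0 2 3] e02 e23 e03 by simp
qed

lemma inv1_inv1: "partial_group M \<Longrightarrow> a \<in> cells M 1 \<Longrightarrow> inv1 M (inv1 M a) = a"
  by (rule nu_nu)

lemma inv1_mul_rev:
  assumes M: "partial_group M" and ab: "mul M a b c"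
  shows "mul M (inv1 M b) (inv1 M a) (inv1 M c)"
proof -
  have S: "simplicial_set M" using M by (simp add: pg_pm pm_simplicial)
  obtain u where u: "u \<in> cells M 2" "edge M 2 0 1 u = a" "edge M 2 1 2 u = b" "edge M 2 0 2 u = c"
    using ab unfolding mul_def by blast
  show ?thesis
    using mul_edges[OF S nu_cells[OF M u(1)], of 0 1 2] nu_edge[OF M u(1), of 0 1]
      nu_edge[OF M u(1), of 1 2] nu_edge[OF M u(1), of 0 2] u by simp
qed

text \<open>Mirror image of cancellation on the right, since inverting reverses products.\<close>

lemma mul_cancel_left_inv:
  assumes M: "partial_group M" and ab: "mul M a b c"
  shows "mul M (inv1 M a) c b"
  using inv1_mul_rev[OF M mul_cancel_right_inv[OF M inv1_mul_rev[OF M ab]]]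
    mul_cells[OF pm_simplicial[OF pg_pm[OF M]] ab] by (simp add: inv1_inv1[OF M] inv1_cells[OF M])

lemma mul_right_cancel:
  "partial_group M \<Longrightarrow> mul M a b c \<Longrightarrow> mul M a' b c \<Longrightarrow> a = a'"
  by (metis mul_cancel_right_inv mul_fun pg_pm)

lemma mul_left_cancel:
  "partial_group M \<Longrightarrow> mul M a b c \<Longrightarrow> mul M a b' c \<Longrightarrow> b = b'"
  by (metis mul_cancel_left_inv mul_fun pg_pm)

lemma inv1_eqI:
  "partial_group M \<Longrightarrow> mul M a b (unit M) \<Longrightarrow> a = inv1 M b"
  by (meson mul_right_cancel inv1_mul mul_cells pg_pm pm_simplicial)

lemma inv1_unit: "partial_group M \<Longrightarrow> inv1 M (unit M) = unit M"
  by (metis inv1_eqI mul_unit_left pg_pm unit_cells)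

text \<open>Cancellation makes inverses unique, so a simplicial map respects the chosen inversions
  automatically.\<close>

lemma simplicial_map_inv1:
  assumes X: "partial_group X" and Y: "partial_group Y" and f: "simplicial_map X Y f" and x: "x \<in> cells X 1"
  shows "f 1 (inv1 X x) = inv1 Y (f 1 x)"
  using mul_map[OF f inv1_mul[OF X x]] simplicial_map_unit[OF pg_pm[OF X] pg_pm[OF Y] f]
  by (simp add: inv1_eqI[OF Y])

lemma simplicial_map_nu:
  assumes X: "partial_group X" and Y: "partial_group Y" and f: "simplicial_map X Y f" and x: "x \<in> cells X n"
  shows "f n (nu X n x) = nu Y n (f n x)"
proof (rule pm_eqI_edges[OF pg_pm[OF Y]])
  fix i j assume ij: "i \<le> j" "j \<le> n"
  then show "edge Y n i j (f n (nu X n x)) = edge Y n i j (nu Y n (f n x))"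
    using x by (simp add: simplicial_map_edge[OF f] nu_cells[OF X] nu_edge[OF X] nu_edge[OF Y] simplicial_map_cells[OF f]
      simplicial_map_inv1[OF X Y f] edge_cells[OF pm_simplicial[OF pg_pm[OF X]]])
qed (use assms in \<open>auto simp: nu_cells simplicial_map_cells[OF f]\<close>)

section \<open>Simplicial maps out of a product with a simplex\<close>

text \<open>A simplicial map Y \<times> \<Delta>[n] \<rightarrow> X in curried form, so that the
  simplex coordinate \<alpha> can be fixed, restricted or reversed separately from the cell of
  Y.\<close>

definition smap2 :: "'b sset \<Rightarrow> nat \<Rightarrow> 'a sset \<Rightarrow> (nat \<Rightarrow> 'b \<Rightarrow> nat list \<Rightarrow> 'a) \<Rightarrow> bool" where
  "smap2 Y n X K \<longleftrightarrow>
    (\<forall>m y \<alpha>. y \<in> cells Y m \<longrightarrow> \<alpha> \<in> mono_maps m n \<longrightarrow> K m y \<alpha> \<in> cells X m) \<and>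
    (\<forall>l m y \<alpha> \<beta>. y \<in> cells Y m \<longrightarrow> \<alpha> \<in> mono_maps m n \<longrightarrow> \<beta> \<in> mono_maps l m \<longrightarrow>
       K l (act Y m \<beta> y) (map ((!) \<alpha>) \<beta>) = act X m \<beta> (K m y \<alpha>))"

lemma simplicial_map_product_iff:
  "simplicial_map (product_sset Y (std_simplex n)) X F \<longleftrightarrow> smap2 Y n X (\<lambda>m y \<alpha>. F m (y, \<alpha>))"
  unfolding simplicial_map_def smap2_def product_sset_def std_simplex_def by auto

lemma htpy_iff:
  "htpy Y X f \<eta> g \<longleftrightarrow> (\<exists>K. smap2 Y 1 X K \<and>
     (\<forall>n. \<forall>y \<in> cells Y n. K n y (replicate (Suc n) 0) = f n y) \<and>
     (\<forall>n. \<forall>y \<in> cells Y n. K n y (replicate (Suc n) 1) = g n y) \<and>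
     K 1 (unit Y) [0, 1] = \<eta>)" (is "?L \<longleftrightarrow> (\<exists>K. ?P K)")
proof
  assume ?L then show "\<exists>K. ?P K"
    unfolding htpy_def simplicial_map_product_iff
    by (elim exE) (rule_tac x="\<lambda>m y \<alpha>. F m (y, \<alpha>)" in exI, simp)
next
  assume "\<exists>K. ?P K" then show ?L
    unfolding htpy_def simplicial_map_product_iff
    by (elim exE) (rule_tac x="\<lambda>m p. K m (fst p) (snd p)" in exI, simp)
qed

lemma smap2_cells: "smap2 Y n X K \<Longrightarrow> y \<in> cells Y m \<Longrightarrow> \<alpha> \<in> mono_maps m n \<Longrightarrow> K m y \<alpha> \<in> cells X m"
  by (simp add: smap2_def)

lemma smap2_act: "smap2 Y n X K \<Longrightarrow> y \<in> cells Y m \<Longrightarrow> \<alpha> \<in> mono_maps m n \<Longrightarrow> \<beta> \<in> mono_maps l m \<Longrightarrow>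
    act X m \<beta> (K m y \<alpha>) = K l (act Y m \<beta> y) (map ((!) \<alpha>) \<beta>)"
  by (simp add: smap2_def)

lemma smap2_edge: "smap2 Y n X K \<Longrightarrow> y \<in> cells Y m \<Longrightarrow> \<alpha> \<in> mono_maps m n \<Longrightarrow> i \<le> j \<Longrightarrow> j \<le> m \<Longrightarrow>
    edge X m i j (K m y \<alpha>) = K 1 (edge Y m i j y) [\<alpha> ! i, \<alpha> ! j]"
  using smap2_act[of Y n X K y m \<alpha> "[i, j]" 1] by simp

lemma smap2_edgeI:
  assumes Y: "simplicial_set Y" and X: "partial_monoid X"
    and c: "\<And>m y \<alpha>. y \<in> cells Y m \<Longrightarrow> \<alpha> \<in> mono_maps m n \<Longrightarrow> K m y \<alpha> \<in> cells X m"
    and e: "\<And>m y \<alpha> i j. y \<in> cells Y m \<Longrightarrow> \<alpha> \<in> mono_maps m n \<Longrightarrow> i \<le> j \<Longrightarrow> j \<le> m \<Longrightarrow>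
       edge X m i j (K m y \<alpha>) = K 1 (edge Y m i j y) [\<alpha> ! i, \<alpha> ! j]"
  shows "smap2 Y n X K"
  unfolding smap2_def
proof (intro conjI allI impI)
  fix l m y \<alpha> \<beta> assume y: "y \<in> cells Y m" and a: "\<alpha> \<in> mono_maps m n" and b: "\<beta> \<in> mono_maps l m"
  note S = pm_simplicial[OF X]
  note ab = comp_in_mono_maps[OF a b]
  have y': "act Y m \<beta> y \<in> cells Y l" by (rule act_cells[OF Y b y])
  show "K l (act Y m \<beta> y) (map ((!) \<alpha>) \<beta>) = act X m \<beta> (K m y \<alpha>)"
  proof (rule pm_eqI_edges[OF X, of _ l])
    fix i j assume ij: "i \<le> j" "j \<le> l"
    have "i < length \<beta>" "j < length \<beta>" using ij b by (auto simp: mono_maps_length)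
    then show "edge X l i j (K l (act Y m \<beta> y) (map ((!) \<alpha>) \<beta>)) = edge X l i j (act X m \<beta> (K m y \<alpha>))"
      by (subst e[OF y' ab ij], subst edge_act[OF S b c[OF y a] ij], subst edge_act[OF Y b y ij],
          subst e[OF y a mono_maps_nth_mono[OF b ij] mono_maps_nth_le[OF b ij(2)]]) simp
  qed (use c[OF y' ab] c[OF y a] b in \<open>auto simp: act_cells[OF S]\<close>)
qed (rule c)

lemma smap2_restrict:
  assumes "smap2 Y n X K" "\<gamma> \<in> mono_maps k n"
  shows "smap2 Y k X (\<lambda>m y \<alpha>. K m y (map ((!) \<gamma>) \<alpha>))"
  unfolding smap2_def
proof (intro conjI allI impI)
  fix l m y \<alpha> \<beta> assume y: "y \<in> cells Y m" and a: "\<alpha> \<in> mono_maps m k" and b: "\<beta> \<in> mono_maps l m"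
  have eq: "map ((!) (map ((!) \<gamma>) \<alpha>)) \<beta> = map ((!) \<gamma>) (map ((!) \<alpha>) \<beta>)"
    using a b by (auto simp: mono_maps_def)
  show "K l (act Y m \<beta> y) (map ((!) \<gamma>) (map ((!) \<alpha>) \<beta>)) = act X m \<beta> (K m y (map ((!) \<gamma>) \<alpha>))"
    using smap2_act[OF assms(1) y comp_in_mono_maps[OF assms(2) a] b] by (simp only: eq)
qed (rule smap2_cells[OF assms(1) _ comp_in_mono_maps[OF assms(2)]])

lemma smap2_at:
  assumes "smap2 Y n X K" "i \<le> n"
  shows "simplicial_map Y X (\<lambda>m y. K m y (replicate (Suc m) i))"
  unfolding simplicial_map_def
proof (intro conjI allI ballI)
  fix l m \<beta> y assume b: "\<beta> \<in> mono_maps l m" and y: "y \<in> cells Y m"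
  have "replicate (Suc m) i \<in> mono_maps m n" using assms(2) by simp
  from smap2_act[OF assms(1) y this b]
  show "K l (act Y m \<beta> y) (replicate (Suc l) i) = act X m \<beta> (K m y (replicate (Suc m) i))"
    by (simp only: map_replicate_nth[OF b])
qed (use assms in \<open>auto intro!: smap2_cells[OF assms(1)]\<close>)

lemma smap2_pre:
  assumes "smap2 Y n X K" "simplicial_map Z Y f"
  shows "smap2 Z n X (\<lambda>m y \<alpha>. K m (f m y) \<alpha>)"
  using assms unfolding smap2_def simplicial_map_def by auto

lemma smap2_post:
  assumes "smap2 Y n X K" "simplicial_map X Z f"
  shows "smap2 Y n Z (\<lambda>m y \<alpha>. f m (K m y \<alpha>))"
  using assms unfolding smap2_def simplicial_map_def by auto

lemma smap2_comp:
  assumes "smap2 Y n X K" "smap2 X n Z L"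
  shows "smap2 Y n Z (\<lambda>m y \<alpha>. L m (K m y \<alpha>) \<alpha>)"
  using assms unfolding smap2_def by simp

lemma smap2_const:
  assumes "simplicial_map Y X f"
  shows "smap2 Y n X (\<lambda>m y \<alpha>. f m y)"
  using assms unfolding smap2_def simplicial_map_def by auto

lemma smap2_cong:
  assumes "smap2 Y n X K" "simplicial_set Y" "\<And>m y \<alpha>. y \<in> cells Y m \<Longrightarrow> \<alpha> \<in> mono_maps m n \<Longrightarrow> L m y \<alpha> = K m y \<alpha>"
  shows "smap2 Y n X L"
  unfolding smap2_def
proof (intro conjI allI impI)
  fix l m y \<alpha> \<beta> assume y: "y \<in> cells Y m" and a: "\<alpha> \<in> mono_maps m n" and b: "\<beta> \<in> mono_maps l m"
  show "L l (act Y m \<beta> y) (map ((!) \<alpha>) \<beta>) = act X m \<beta> (L m y \<alpha>)"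
    using smap2_act[OF assms(1) y a b] assms(3)[OF y a] assms(3)[OF act_cells[OF assms(2) b y] comp_in_mono_maps[OF a b]]
    by simp
qed (simp add: assms(3) smap2_cells[OF assms(1)])

text \<open>The edge (y, [i, j]) is the diagonal of a square in Y \<times> \<Delta>[n] and factors
  through either of the other two corners. Here the triangle is (\<open>s\<^sub>1 y\<close>,
  [i, i, j]); the other corner gives \<open>smap2_mul_right\<close>. For a homotopy the two together
  say f(y) \<eta> = \<eta> g(y).\<close>

lemma smap2_mul_left:
  assumes X: "partial_monoid X" and Y: "partial_monoid Y" and K: "smap2 Y n X K"
    and y: "y \<in> cells Y 1" and ij: "i \<le> j" "j \<le> n"
  shows "mul X (K 1 y [i, i]) (K 1 (unit Y) [i, j]) (K 1 y [i, j])"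
proof -
  note SY = pm_simplicial[OF Y]
  have d: "[0, 1, 1] \<in> mono_maps 2 1" and a: "[i, i, j] \<in> mono_maps 2 n"
    using ij by (auto simp: mono_maps_def)
  have z: "act Y 1 [0, 1, 1] y \<in> cells Y 2" by (rule act_cells[OF SY d y])
  have "K 2 (act Y 1 [0, 1, 1] y) [i, i, j] \<in> cells X 2" by (rule smap2_cells[OF K z a])
  from mul_edges[OF pm_simplicial[OF X] this, of 0 1 2]
  show ?thesis
    using y by (simp add: smap2_edge[OF K z a] edge_act[OF SY d y] edge_degenerate[OF Y y] edge_id[OF SY] nth_Cons')
qed

lemma smap2_mul_right:
  assumes X: "partial_monoid X" and Y: "partial_monoid Y" and K: "smap2 Y n X K"
    and y: "y \<in> cells Y 1" and ij: "i \<le> j" "j \<le> n"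
  shows "mul X (K 1 (unit Y) [i, j]) (K 1 y [j, j]) (K 1 y [i, j])"
proof -
  note SY = pm_simplicial[OF Y]
  have d: "[0, 0, 1] \<in> mono_maps 2 1" and a: "[i, j, j] \<in> mono_maps 2 n"
    using ij by (auto simp: mono_maps_def)
  have z: "act Y 1 [0, 0, 1] y \<in> cells Y 2" by (rule act_cells[OF SY d y])
  have "K 2 (act Y 1 [0, 0, 1] y) [i, j, j] \<in> cells X 2" by (rule smap2_cells[OF K z a])
  from mul_edges[OF pm_simplicial[OF X] this, of 0 1 2]
  show ?thesis
    using y by (simp add: smap2_edge[OF K z a] edge_act[OF SY d y] edge_degenerate[OF Y y] edge_id[OF SY] nth_Cons')
qed

lemma replicate_2 [simp]: "replicate (Suc 1) i = [i, i]"
  unfolding One_nat_def replicate_Suc replicate_0 ..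

lemma smap2_unit:
  assumes X: "partial_monoid X" and Y: "partial_monoid Y" and K: "smap2 Y n X K" and i: "i \<le> n"
  shows "K 1 (unit Y) [i, i] = unit X"
  using simplicial_map_unit[OF Y X smap2_at[OF K i]] by (simp only: replicate_2)

text \<open>By \<open>smap2_mul_left\<close> the value at any edge is a product of a value over a
  vertex of \<Delta>[n] and a value over the unit of Y.\<close>

lemma smap2_eqI:
  assumes X: "partial_monoid X" and Y: "partial_monoid Y" and K: "smap2 Y n X K" and L: "smap2 Y n X L"
    and 1: "\<And>y i. y \<in> cells Y 1 \<Longrightarrow> i \<le> n \<Longrightarrow> K 1 y [i, i] = L 1 y [i, i]"
    and 2: "\<And>i j. i \<le> j \<Longrightarrow> j \<le> n \<Longrightarrow> K 1 (unit Y) [i, j] = L 1 (unit Y) [i, j]"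
    and y: "y \<in> cells Y m" and a: "\<alpha> \<in> mono_maps m n"
  shows "K m y \<alpha> = L m y \<alpha>"
proof (rule pm_eqI_edges[OF X smap2_cells[OF K y a] smap2_cells[OF L y a]])
  have e: "K 1 z [i, j] = L 1 z [i, j]" if "z \<in> cells Y 1" "i \<le> j" "j \<le> n" for z i j
    using smap2_mul_left[OF X Y K that] smap2_mul_left[OF X Y L that] 1[OF that(1), of i] 2[OF that(2,3)] that
      mul_fun[OF X] by auto
  fix i j assume ij: "i \<le> j" "j \<le> m"
  show "edge X m i j (K m y \<alpha>) = edge X m i j (L m y \<alpha>)"
    by (subst smap2_edge[OF K y a ij], subst smap2_edge[OF L y a ij], rule e)
      (use y a ij in \<open>auto simp: edge_cells[OF pm_simplicial[OF Y]] mono_maps_nth_mono mono_maps_nth_le\<close>)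
qed

text \<open>The isomorphism of \<Delta>[1] with its opposite that exchanges the vertices, on
  simplices.\<close>

definition revl :: "nat list \<Rightarrow> nat list" where
  "revl \<alpha> = rev (map (\<lambda>i. 1 - i) \<alpha>)"

lemma revl_mono: "\<alpha> \<in> mono_maps m 1 \<Longrightarrow> revl \<alpha> \<in> mono_maps m 1"
  by (auto simp: mono_maps_iff revl_def rev_nth intro!: diff_le_mono2)

lemma revl_nth: "\<alpha> \<in> mono_maps m 1 \<Longrightarrow> i \<le> m \<Longrightarrow> revl \<alpha> ! i = 1 - \<alpha> ! (m - i)"
  by (auto simp: revl_def rev_nth mono_maps_length)

text \<open>The inversions of Y and X are maps to the opposites, and \<Delta>[1] is its own
  opposite. Conjugation with them is again a map out of Y \<times> \<Delta>[1], with its two ends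
  exchanged.\<close>

lemma smap2_reverse:
  assumes X: "partial_group X" and Y: "partial_group Y" and K: "smap2 Y 1 X K"
  shows "smap2 Y 1 X (\<lambda>m y \<alpha>. nu X m (K m (nu Y m y) (revl \<alpha>)))"
proof (rule smap2_edgeI)
  note SY = pm_simplicial[OF pg_pm[OF Y]]
  fix m y \<alpha> i j assume y: "y \<in> cells Y m" and a: "\<alpha> \<in> mono_maps m 1" and ij: "i \<le> j" "j \<le> m"
  note k = smap2_cells[OF K nu_cells[OF Y y] revl_mono[OF a]]
  have rep: "revl [\<alpha> ! i, \<alpha> ! j] = [1 - \<alpha> ! j, 1 - \<alpha> ! i]" by (simp add: revl_def)
  show "edge X m i j (nu X m (K m (nu Y m y) (revl \<alpha>))) =
    inv1 X (K 1 (inv1 Y (edge Y m i j y)) (revl [\<alpha> ! i, \<alpha> ! j]))"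
    unfolding rep using ij a
    by (simp add: nu_edge[OF X k] smap2_edge[OF K nu_cells[OF Y y] revl_mono[OF a]] nu_edge[OF Y y] revl_nth)
qed (auto simp: pm_simplicial pg_pm X Y intro!: nu_cells smap2_cells[OF K] revl_mono)

section \<open>Homotopies in terms of words\<close>

definition step :: "nat \<Rightarrow> nat \<Rightarrow> nat list" where
  "step k m = map (\<lambda>i. if i < k then 0 else 1) [0..<Suc m]"

lemma step_mono: "step k m \<in> mono_maps m 1"
  unfolding step_def by (rule mono_maps_map) auto

lemma step_nth: "i \<le> m \<Longrightarrow> step k m ! i = (if i < k then 0 else 1)"
  unfolding step_def by simp

text \<open>The cell is the image of the k-th top simplex of the prism over y, which pairs the k-th
  degeneracy of y with \<open>step (Suc k) (Suc n)\<close>. All n + 1 top simplices share their long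
  edge; this is why the product in the last line does not depend on k.\<close>

lemma smap2_word:
  assumes X: "partial_monoid X" and Y: "partial_monoid Y" and K: "smap2 Y 1 X K"
    and y: "y \<in> cells Y n" and k: "k \<le> n"
  shows "\<exists>v \<in> cells X (Suc n).
    (\<forall>i<k. edge X (Suc n) i (Suc i) v = K 1 (edge Y n i (Suc i) y) [0, 0]) \<and>
    edge X (Suc n) k (Suc k) v = K 1 (unit Y) [0, 1] \<and>
    (\<forall>i. k \<le> i \<longrightarrow> i < n \<longrightarrow> edge X (Suc n) (Suc i) (Suc (Suc i)) v = K 1 (edge Y n i (Suc i) y) [1, 1]) \<and>
    edge X (Suc n) 0 (Suc n) v = K 1 (edge Y n 0 n y) [0, 1]"
proof -
  note SY = pm_simplicial[OF Y]
  let ?d = "[0..<Suc k] @ [k..<Suc n]"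
  have d: "?d \<in> mono_maps (Suc n) n" by (rule degen_list_mono[OF k])
  have z: "act Y n ?d y \<in> cells Y (Suc n)" by (rule act_cells[OF SY d y])
  have e: "edge X (Suc n) i j (K (Suc n) (act Y n ?d y) (step (Suc k) (Suc n))) =
    K 1 (edge Y n (if i \<le> k then i else i - 1) (if j \<le> k then j else j - 1) y)
     [if i \<le> k then 0 else 1, if j \<le> k then 0 else 1]"
    if "i \<le> j" "j \<le> Suc n" for i j
    using that k
    by (simp add: smap2_edge[OF K z step_mono that] edge_act[OF SY d y that] degen_list_nth[OF k] step_nth
       less_Suc_eq_le)
  show ?thesis
    by (rule bexI[of _ "K (Suc n) (act Y n ?d y) (step (Suc k) (Suc n))"])
     (use k edge_degenerate[OF Y y k] in \<open>auto simp: e plus_1_eq_Suc smap2_cells[OF K z step_mono]\<close>)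
qed

text \<open>Converse of \<open>smap2_word\<close>. Agreement of the long edges is assumed for the
  squares over edges of Y only; over larger cells it follows from the prisms over triangles.\<close>

lemma htpyI:
  assumes X: "partial_monoid X" and Y: "partial_monoid Y"
    and f: "simplicial_map Y X f" and g: "simplicial_map Y X g" and \<eta>: "\<eta> \<in> cells X 1"
    and w: "\<And>n y k. y \<in> cells Y n \<Longrightarrow> k \<le> n \<Longrightarrow> \<exists>v \<in> cells X (Suc n).
      (\<forall>i<k. edge X (Suc n) i (Suc i) v = f 1 (edge Y n i (Suc i) y)) \<and>
      edge X (Suc n) k (Suc k) v = \<eta> \<and>
      (\<forall>i. k \<le> i \<longrightarrow> i < n \<longrightarrow> edge X (Suc n) (Suc i) (Suc (Suc i)) v = g 1 (edge Y n i (Suc i) y))"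
    and m: "\<And>y. y \<in> cells Y 1 \<Longrightarrow> \<exists>c. mul X (f 1 y) \<eta> c \<and> mul X \<eta> (g 1 y) c"
  shows "htpy Y X f \<eta> g"
proof -
  note SX = pm_simplicial[OF X] and SY = pm_simplicial[OF Y]
  obtain c where cf: "\<And>y. y \<in> cells Y 1 \<Longrightarrow> mul X (f 1 y) \<eta> (c y)"
    and cg: "\<And>y. y \<in> cells Y 1 \<Longrightarrow> mul X \<eta> (g 1 y) (c y)"
    using m by metis
  have w': "\<exists>v \<in> cells X (Suc n).
      (\<forall>i j. i \<le> j \<longrightarrow> j \<le> k \<longrightarrow> edge X (Suc n) i j v = f 1 (edge Y n i j y)) \<and>
      (\<forall>i j. k \<le> i \<longrightarrow> i \<le> j \<longrightarrow> j \<le> n \<longrightarrow> edge X (Suc n) (Suc i) (Suc j) v = g 1 (edge Y n i j y)) \<and>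
      edge X (Suc n) k (Suc k) v = \<eta>"
    if y: "y \<in> cells Y n" and k: "k \<le> n" for y n k
  proof -
    obtain v where v: "v \<in> cells X (Suc n)"
      and v1: "\<And>i. i < k \<Longrightarrow> edge X (Suc n) i (Suc i) v = f 1 (edge Y n i (Suc i) y)"
      and v2: "edge X (Suc n) k (Suc k) v = \<eta>"
      and v3: "\<And>i. k \<le> i \<Longrightarrow> i < n \<Longrightarrow> edge X (Suc n) (Suc i) (Suc (Suc i)) v = g 1 (edge Y n i (Suc i) y)"
      using w[OF y k] by blast
    have a: "[0..<Suc k] \<in> mono_maps k (Suc n)" and a': "[0..<Suc k] \<in> mono_maps k n"
      using upt_mono_maps[of 0 k] k by auto
    have b: "[Suc k..<Suc (Suc n)] \<in> mono_maps (n - k) (Suc n)" and b': "[k..<Suc n] \<in> mono_maps (n - k) n"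
      using upt_mono_maps[of "Suc k" "Suc n" "Suc n"] upt_mono_maps[of k n n] k by auto
    \<comment> \<open>The vertices up to k of v lie over the vertex 0 of \<Delta>[1], the later ones
      over 1. Each half has the spine of a value of f or g, hence is that value, and this gives its
      remaining edges.\<close>
    have 1: "act X (Suc n) [0..<Suc k] v = f k (act Y n [0..<Suc k] y)"
      by (rule pm_eqI[OF X, of _ k])
        (use v y a a' v1 in \<open>auto simp: act_cells[OF SX] act_cells[OF SY] simplicial_map_cells[OF f] edge_act[OF SX]
         edge_act[OF SY] simplicial_map_edge[OF f]\<close>)
    have 2: "act X (Suc n) [Suc k..<Suc (Suc n)] v = g (n - k) (act Y n [k..<Suc n] y)"
    proof (rule pm_eqI[OF X, of _ "n - k"])
      fix i assume i: "i < n - k"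
      show "edge X (n - k) i (Suc i) (act X (Suc n) [Suc k..<Suc (Suc n)] v) =
         edge X (n - k) i (Suc i) (g (n - k) (act Y n [k..<Suc n] y))"
        using i v3[of "k + i"]
        by (simp add: edge_act[OF SX b v] simplicial_map_edge[OF g] act_cells[OF SY b' y] edge_act[OF SY b' y])
    qed (use v y b b' in \<open>auto simp: act_cells[OF SX] act_cells[OF SY] simplicial_map_cells[OF g]\<close>)
    show ?thesis
    proof (rule bexI[OF _ v], intro conjI allI impI)
      fix i j assume ij: "i \<le> j" "j \<le> k"
      show "edge X (Suc n) i j v = f 1 (edge Y n i j y)"
        using arg_cong[OF 1, of "edge X k i j"] ij
        by (simp add: edge_act[OF SX a v] simplicial_map_edge[OF f] act_cells[OF SY a' y] edge_act[OF SY a' y])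
    next
      fix i j assume ij: "k \<le> i" "i \<le> j" "j \<le> n"
      then have "i - k \<le> j - k" "j - k \<le> n - k" by auto
      then show "edge X (Suc n) (Suc i) (Suc j) v = g 1 (edge Y n i j y)"
        using arg_cong[OF 2, of "edge X (n - k) (i - k) (j - k)"] ij
        by (simp add: edge_act[OF SX b v] simplicial_map_edge[OF g] act_cells[OF SY b' y] edge_act[OF SY b' y])
    qed (rule v2)
  qed
  have w'': "\<exists>v \<in> cells X (Suc n).
      (\<forall>i j. i \<le> j \<longrightarrow> j \<le> k \<longrightarrow> edge X (Suc n) i j v = f 1 (edge Y n i j y)) \<and>
      (\<forall>i j. k \<le> i \<longrightarrow> i \<le> j \<longrightarrow> j \<le> n \<longrightarrow> edge X (Suc n) (Suc i) (Suc j) v = g 1 (edge Y n i j y)) \<and>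
      (\<forall>i j. i \<le> k \<longrightarrow> k \<le> j \<longrightarrow> j \<le> n \<longrightarrow> edge X (Suc n) i (Suc j) v = c (edge Y n i j y))"
    if y: "y \<in> cells Y n" and k: "k \<le> n" for y n k
  proof -
    obtain v where v: "v \<in> cells X (Suc n)"
      and v1: "\<And>i j. i \<le> j \<Longrightarrow> j \<le> k \<Longrightarrow> edge X (Suc n) i j v = f 1 (edge Y n i j y)"
      and v2: "\<And>i j. k \<le> i \<Longrightarrow> i \<le> j \<Longrightarrow> j \<le> n \<Longrightarrow> edge X (Suc n) (Suc i) (Suc j) v = g 1 (edge Y n i j y)"
      and v3: "edge X (Suc n) k (Suc k) v = \<eta>"
      using w'[OF y k] by blast
    have "edge X (Suc n) i (Suc j) v = c (edge Y n i j y)" if ij: "i \<le> k" "k \<le> j" "j \<le> n" for i j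
    proof -
      have "mul X \<eta> (g 1 (edge Y n k j y)) (edge X (Suc n) k (Suc j) v)"
        using mul_edges[OF SX v, of k "Suc k" "Suc j"] ij v2[of k j] v3 by simp
      then have kj: "edge X (Suc n) k (Suc j) v = c (edge Y n k j y)"
        using cg[OF edge_cells[OF SY y ij(2,3)]] mul_fun[OF X] by blast
      have 1: "mul X (f 1 (edge Y n i k y)) (c (edge Y n k j y)) (edge X (Suc n) i (Suc j) v)"
        using mul_edges[OF SX v, of i k "Suc j"] ij v1[of i k] kj by simp
      \<comment> \<open>The crossing edge is f(ik) c(kj) and has to be c(ij). Over the triangle i,
        k, j of y the simplex [f(ik)|f(kj)|\<eta>] exists, and its two bracketings are these two
        elements.\<close>
      have t: "[i, k, j] \<in> mono_maps 2 n" using ij by (auto intro: triple_in_mono_maps)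
      let ?t = "act Y n [i, k, j] y"
      have tc: "?t \<in> cells Y 2" by (rule act_cells[OF SY t y])
      obtain u where u: "u \<in> cells X (Suc 2)"
        and u1: "\<And>i j. i \<le> j \<Longrightarrow> j \<le> 2 \<Longrightarrow> edge X (Suc 2) i j u = f 1 (edge Y 2 i j ?t)"
        and u3: "edge X (Suc 2) 2 (Suc 2) u = \<eta>"
        using w'[OF tc, of 2] by blast
      have e: "edge Y 2 0 1 ?t = edge Y n i k y" "edge Y 2 1 2 ?t = edge Y n k j y" "edge Y 2 0 2 ?t = edge Y n i j y"
        by (auto simp: edge_act[OF SY t y])
      have a: "edge X (Suc 2) 1 (Suc 2) u = c (edge Y n k j y)"
        using mul_edges[OF SX u, of 1 2 "Suc 2"] u1[of 1 2] u3 e mul_fun[OF X] cf[OF edge_cells[OF SY y ij(2,3)]] by simp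
      have b: "edge X (Suc 2) 0 (Suc 2) u = c (edge Y n i j y)"
        using mul_edges[OF SX u, of 0 2 "Suc 2"] u1[of 0 2] u3 e mul_fun[OF X] cf[OF edge_cells[OF SY y, of i j]] ij by simp
      show ?thesis
        using mul_edges[OF SX u, of 0 1 "Suc 2"] u1[of 0 1] e a b 1 mul_fun[OF X] by simp
    qed
    then show ?thesis using v v1 v2 by blast
  qed
  define k1 where "k1 z a b = (if b = 0 then f 1 z else if a = 0 then c z else g 1 z)" for z and a b :: nat
  have "\<exists>v \<in> cells X n. \<forall>p q. p \<le> q \<longrightarrow> q \<le> n \<longrightarrow> edge X n p q v = k1 (edge Y n p q y) (\<alpha> ! p) (\<alpha> ! q)"
    if y: "y \<in> cells Y n" and \<alpha>: "\<alpha> \<in> mono_maps n 1" for y n \<alpha>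
  proof (cases "\<alpha> ! n = 0")
    case True
    then have "\<alpha> ! q = 0" if "q \<le> n" for q using mono_maps_nth_mono[OF \<alpha> that] by simp
    then show ?thesis
      using y by (intro bexI[of _ "f n y"]) (auto simp: k1_def simplicial_map_edge[OF f] simplicial_map_cells[OF f])
  next
    case False
    define a where "a = (LEAST p. \<alpha> ! p \<noteq> 0)"
    have a1: "\<alpha> ! a \<noteq> 0" unfolding a_def using False by (rule LeastI)
    have a2: "\<alpha> ! p = 0" if "p < a" for p using not_less_Least[OF that[unfolded a_def]] by simp
    have an: "a \<le> n" unfolding a_def using False by (rule Least_le)
    have a3: "\<alpha> ! p \<noteq> 0" if "a \<le> p" "p \<le> n" for p
      using mono_maps_nth_mono[OF \<alpha> that] a1 by simp
    obtain v where v: "v \<in> cells X (Suc n)"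
      and v1: "\<And>i j. i \<le> j \<Longrightarrow> j \<le> a \<Longrightarrow> edge X (Suc n) i j v = f 1 (edge Y n i j y)"
      and v2: "\<And>i j. a \<le> i \<Longrightarrow> i \<le> j \<Longrightarrow> j \<le> n \<Longrightarrow> edge X (Suc n) (Suc i) (Suc j) v = g 1 (edge Y n i j y)"
      and v3: "\<And>i j. i \<le> a \<Longrightarrow> a \<le> j \<Longrightarrow> j \<le> n \<Longrightarrow> edge X (Suc n) i (Suc j) v = c (edge Y n i j y)"
      using w''[OF y an] by blast
    \<comment> \<open>Here a is the first vertex that \<alpha> sends to 1. In v the vertex a occurs
      twice, once on either side of the edge \<eta>; omitting the copy on the side of f leaves the
      edges prescribed by \<alpha>.\<close>
    let ?d = "map (\<lambda>p. if p < a then p else Suc p) [0..<Suc n]"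
    have d: "?d \<in> mono_maps n (Suc n)" by (rule mono_maps_map) auto
    show ?thesis
    proof (intro bexI allI impI)
      fix p q assume pq: "p \<le> q" "q \<le> n"
      have "edge X n p q (act X (Suc n) ?d v) =
        edge X (Suc n) (if p < a then p else Suc p) (if q < a then q else Suc q) v"
        using pq by (simp add: edge_act[OF SX d v])
      moreover consider "q < a" | "p < a" "a \<le> q" | "a \<le> p" by linarith
      then have "edge X (Suc n) (if p < a then p else Suc p) (if q < a then q else Suc q) v =
        k1 (edge Y n p q y) (\<alpha> ! p) (\<alpha> ! q)"
      proof cases
        case 1 then show ?thesis using pq a2 v1 by (simp add: k1_def)
      next
        case 2 then show ?thesis using pq a2[of p] a3[of q] v3[of p q] by (simp add: k1_def)
      next
        case 3 then show ?thesis using pq a3[of p] a3[of q] v2[of p q] by (simp add: k1_def)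
      qed
      ultimately show "edge X n p q (act X (Suc n) ?d v) = k1 (edge Y n p q y) (\<alpha> ! p) (\<alpha> ! q)" by simp
    qed (rule act_cells[OF SX d v])
  qed
  note ex = this
  define K where "K n y \<alpha> = (SOME v. v \<in> cells X n \<and>
    (\<forall>p q. p \<le> q \<longrightarrow> q \<le> n \<longrightarrow> edge X n p q v = k1 (edge Y n p q y) (\<alpha> ! p) (\<alpha> ! q)))" for n y \<alpha>
  have Kex: "K n y \<alpha> \<in> cells X n \<and>
    (\<forall>p q. p \<le> q \<longrightarrow> q \<le> n \<longrightarrow> edge X n p q (K n y \<alpha>) = k1 (edge Y n p q y) (\<alpha> ! p) (\<alpha> ! q))"
    if "y \<in> cells Y n" "\<alpha> \<in> mono_maps n 1" for n y \<alpha>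
    unfolding K_def by (rule someI_ex) (use ex[OF that] in blast)
  have Kc: "\<And>n y \<alpha>. y \<in> cells Y n \<Longrightarrow> \<alpha> \<in> mono_maps n 1 \<Longrightarrow> K n y \<alpha> \<in> cells X n"
    and Ke: "\<And>n y \<alpha> p q. y \<in> cells Y n \<Longrightarrow> \<alpha> \<in> mono_maps n 1 \<Longrightarrow> p \<le> q \<Longrightarrow> q \<le> n \<Longrightarrow>
      edge X n p q (K n y \<alpha>) = k1 (edge Y n p q y) (\<alpha> ! p) (\<alpha> ! q)"
    using Kex by auto
  have K1: "K 1 z [a, b] = k1 z a b" if "z \<in> cells Y 1" "a \<le> b" "b \<le> 1" for z a b
    using Ke[OF that(1), of "[a, b]" 0 1] that Kc[OF that(1), of "[a, b]"] by (simp add: edge_id[OF SX] edge_id[OF SY])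
  have K: "smap2 Y 1 X K"
  proof (rule smap2_edgeI[OF SY X Kc])
    fix m y \<alpha> i j assume y: "y \<in> cells Y m" and a: "\<alpha> \<in> mono_maps m 1" and ij: "i \<le> j" "j \<le> m"
    show "edge X m i j (K m y \<alpha>) = K 1 (edge Y m i j y) [\<alpha> ! i, \<alpha> ! j]"
      by (subst Ke[OF y a ij], subst K1) (use y ij a in \<open>auto simp: edge_cells[OF SY] mono_maps_nth_mono mono_maps_nth_le\<close>)
  qed
  show ?thesis
    unfolding htpy_iff
  proof (intro exI conjI allI ballI)
    show "smap2 Y 1 X K" by (rule K)
    fix n y assume y: "y \<in> cells Y n"
    have rep: "replicate (Suc n) i \<in> mono_maps n 1" if "i \<le> 1" for i using that by simp
    show "K n y (replicate (Suc n) 0) = f n y"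
      by (rule pm_eqI[OF X, of _ n])
       (use y rep[of 0] in \<open>auto simp: Kc Ke simplicial_map_cells[OF f] simplicial_map_edge[OF f] nth_replicate k1_def\<close>)
    show "K n y (replicate (Suc n) 1) = g n y"
      by (rule pm_eqI[OF X, of _ n])
       (use y rep[of 1] in \<open>auto simp: Kc Ke simplicial_map_cells[OF g] simplicial_map_edge[OF g] nth_replicate k1_def\<close>)
  next
    \<comment> \<open>Over the unit the square reads c(1) = f(1) \<eta> = \<eta>.\<close>
    show "K 1 (unit Y) [0, 1] = \<eta>"
      using K1[OF unit_cells[OF Y], of 0 1] cf[OF unit_cells[OF Y]] simplicial_map_unit[OF Y X f]
        mul_unit_left[OF X \<eta>] mul_fun[OF X] by (simp add: k1_def)
  qed
qed

section \<open>Homotopies of the identity\<close>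

lemma simplicial_map_inv_into:
  assumes f: "simplicial_iso X Y f" and X: "simplicial_set X"
  shows "simplicial_map Y X (\<lambda>n. inv_into (cells X n) (f n))"
  unfolding simplicial_map_def
proof (intro conjI allI ballI)
  have fm: "simplicial_map X Y f" and b: "\<And>n. bij_betw (f n) (cells X n) (cells Y n)"
    using f by (auto simp: simplicial_iso_def)
  have c: "inv_into (cells X n) (f n) y \<in> cells X n" if "y \<in> cells Y n" for n y
    using that b[of n] by (metis bij_betw_def inv_into_into)
  then show "\<And>n y. y \<in> cells Y n \<Longrightarrow> inv_into (cells X n) (f n) y \<in> cells X n" .
  fix m n \<alpha> y assume a: "\<alpha> \<in> mono_maps m n" and y: "y \<in> cells Y n"
  let ?x = "inv_into (cells X n) (f n) y"
  have "f n ?x = y" using y b[of n] by (simp add: bij_betw_inv_into_right)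
  then have "f m (act X n \<alpha> ?x) = act Y n \<alpha> y" using simplicial_map_act[OF fm a c[OF y]] by simp
  moreover have "act X n \<alpha> ?x \<in> cells X m" by (rule act_cells[OF X a c[OF y]])
  ultimately show "inv_into (cells X m) (f m) (act Y n \<alpha> y) = act X n \<alpha> ?x"
    using b[of m] by (metis bij_betw_inv_into_left)
qed

definition id_htpy :: "'a sset \<Rightarrow> (nat \<Rightarrow> 'a \<Rightarrow> nat list \<Rightarrow> 'a) \<Rightarrow> bool" where
  "id_htpy M F \<longleftrightarrow> smap2 M 1 M F \<and> (\<forall>n. \<forall>x \<in> cells M n. F n x (replicate (Suc n) 1) = x)"

lemma NN_iff: 
  assumes M: "partial_monoid M"
  shows "\<eta> \<in> NN M \<longleftrightarrow> (\<exists>F. id_htpy M F \<and> F 1 (unit M) [0, 1] = \<eta>)"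
proof
  assume "\<eta> \<in> NN M"
  then show "\<exists>F. id_htpy M F \<and> F 1 (unit M) [0, 1] = \<eta>"
    unfolding NN_def defines_htpy_def htpy_iff id_htpy_def by blast
next
  assume "\<exists>F. id_htpy M F \<and> F 1 (unit M) [0, 1] = \<eta>"
  then obtain F where F: "smap2 M 1 M F" "\<forall>n. \<forall>x \<in> cells M n. F n x (replicate (Suc n) 1) = x"
    and e: "F 1 (unit M) [0, 1] = \<eta>"
    unfolding id_htpy_def by blast
  have "\<eta> \<in> cells M 1" using smap2_cells[OF F(1) unit_cells[OF M], of "[0, 1]"] e by simp
  moreover have "simplicial_map M M (\<lambda>m y. F m y (replicate (Suc m) 0))"
    by (rule smap2_at[OF F(1)]) simp
  ultimately show "\<eta> \<in> NN M"
    unfolding NN_def defines_htpy_def htpy_iff using F e by blast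
qed

text \<open>The elements for which the end \<open>c_\<eta>\<close> at the vertex 0 is an
  automorphism. This bijectivity is what puts their inverses in \<open>NN M\<close> and makes the
  homotopy bijective over every simplex of \<Delta>[1].\<close>

definition NNs :: "'a sset \<Rightarrow> 'a set" where
  "NNs M = {\<eta>. \<exists>F. id_htpy M F \<and> F 1 (unit M) [0, 1] = \<eta> \<and>
     (\<forall>n. bij_betw (\<lambda>x. F n x (replicate (Suc n) 0)) (cells M n) (cells M n))}"

lemma NNs_subset: "partial_monoid M \<Longrightarrow> NNs M \<subseteq> NN M"
  by (auto simp: NNs_def NN_iff)

lemma NN_cells: "\<eta> \<in> NN M \<Longrightarrow> \<eta> \<in> cells M 1"
  by (simp add: NN_def)

lemma edges_01: "i \<le> j \<Longrightarrow> j \<le> 1 \<Longrightarrow> (i, j) = (0, 0) \<or> (i, j) = (0, 1) \<or> (i, j) = (1, 1::nat)"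
  by (auto simp: le_Suc_eq)

text \<open>The reversed homotopy has c instead of the identity at the vertex 1. Precomposing with
  the inverse of c repairs this, and the element becomes the inverse of the element of F.\<close>

lemma id_htpy_inverse:
  assumes M: "partial_group M" and F: "id_htpy M F"
    and bij: "\<And>n. bij_betw (\<lambda>x. F n x (replicate (Suc n) 0)) (cells M n) (cells M n)"
  defines "c \<equiv> \<lambda>n x. F n x (replicate (Suc n) 0)"
  shows "simplicial_map M M (\<lambda>n. inv_into (cells M n) (c n))"
    and "id_htpy M (\<lambda>m x \<alpha>. nu M m (F m (nu M m (inv_into (cells M m) (c m) x)) (revl \<alpha>)))"
proof -
  note P = pg_pm[OF M]
  note S = pm_simplicial[OF P]
  have Fs: "smap2 M 1 M F" and F1: "\<And>n x. x \<in> cells M n \<Longrightarrow> F n x (replicate (Suc n) 1) = x"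
    using F by (auto simp: id_htpy_def)
  have iso: "simplicial_iso M M c"
    unfolding simplicial_iso_def c_def using bij smap2_at[OF Fs, of 0] by simp
  show inv: "simplicial_map M M (\<lambda>n. inv_into (cells M n) (c n))"
    by (rule simplicial_map_inv_into[OF iso S])
  note inv_cells = simplicial_map_cells[OF inv]
  have c: "simplicial_map M M c" using iso by (simp add: simplicial_iso_def)
  show "id_htpy M (\<lambda>m x \<alpha>. nu M m (F m (nu M m (inv_into (cells M m) (c m) x)) (revl \<alpha>)))"
    unfolding id_htpy_def
  proof (intro conjI allI ballI)
    show "smap2 M 1 M (\<lambda>m x \<alpha>. nu M m (F m (nu M m (inv_into (cells M m) (c m) x)) (revl \<alpha>)))"
      using smap2_pre[OF smap2_reverse[OF M M Fs] inv] .
    fix n x assume x: "x \<in> cells M n"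
    have "revl (replicate (Suc n) 1) = replicate (Suc n) 0" by (simp add: revl_def map_replicate_const)
    then have "nu M n (F n (nu M n (inv_into (cells M n) (c n) x)) (revl (replicate (Suc n) 1))) =
      nu M n (c n (nu M n (inv_into (cells M n) (c n) x)))" by (simp add: c_def)
    also have "\<dots> = nu M n (nu M n (c n (inv_into (cells M n) (c n) x)))"
      using simplicial_map_nu[OF M M c inv_cells[OF x]] by simp
    also have "\<dots> = x"
      using x inv_cells[OF x] bij_betw_inv_into_right[OF bij[of n] x]
      by (simp add: nu_nu[OF M] simplicial_map_cells[OF c]) (simp add: c_def)
    finally show "nu M n (F n (nu M n (inv_into (cells M n) (c n) x)) (revl (replicate (Suc n) 1))) = x" .
  qed
qed

lemma NNs_inv:
  assumes M: "partial_group M" and \<eta>: "\<eta> \<in> NNs M"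
  shows "inv1 M \<eta> \<in> NN M"
proof -
  note P = pg_pm[OF M]
  obtain F where F: "id_htpy M F" "F 1 (unit M) [0, 1] = \<eta>"
    and b: "\<And>n. bij_betw (\<lambda>x. F n x (replicate (Suc n) 0)) (cells M n) (cells M n)"
    using \<eta> unfolding NNs_def by blast
  note i = id_htpy_inverse[OF M F(1) b]
  show ?thesis
    unfolding NN_iff[OF P]
    by (rule exI, rule conjI[OF i(2)])
      (use simplicial_map_unit[OF P P i(1)] F(2) inv1_unit[OF M] in \<open>simp add: revl_def\<close>)
qed

text \<open>The inverse of \<open>F(-, \<alpha>)\<close> is the reversed homotopy followed by the inverse of \<open>F(-, 0)\<close>.
  Without bijectivity at the vertex 0 this fails, and \<open>NN M\<close> need not be closed under inverses:
  let M be the simplices of BG, G the Baumslag-Solitar group of \<open>\<eta> a \<eta>\<inverse> = a\<^sup>2\<close>, whose sets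
  of vertices are contained in some translate of \<open>{\<eta>\<^sup>-\<^sup>i, a \<eta>\<^sup>-\<^sup>i | i \<le> n}\<close>.\<close>

lemma id_htpy_bij:
  assumes M: "partial_group M" and F: "id_htpy M F"
    and bij: "\<And>n. bij_betw (\<lambda>x. F n x (replicate (Suc n) 0)) (cells M n) (cells M n)"
    and a: "\<alpha> \<in> mono_maps m 1"
  shows "bij_betw (\<lambda>x. F m x \<alpha>) (cells M m) (cells M m)"
proof -
  note P = pg_pm[OF M]
  note S = pm_simplicial[OF P]
  have Fs: "smap2 M 1 M F" and F1: "\<And>n x. x \<in> cells M n \<Longrightarrow> F n x (replicate (Suc n) 1) = x"
    using F by (auto simp: id_htpy_def)
  define c where "c = (\<lambda>n x. F n x (replicate (Suc n) 0))"
  define d where "d = (\<lambda>n. inv_into (cells M n) (c n))"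
  define \<eta> where "\<eta> = F 1 (unit M) [0, 1]"
  have cm: "simplicial_map M M c" unfolding c_def by (rule smap2_at[OF Fs]) simp
  have c1: "c 1 x = F 1 x [0, 0]" for x unfolding c_def by (simp only: replicate_2)
  have F11: "F 1 x [1, 1] = x" if "x \<in> cells M 1" for x using F1[OF that] by (simp only: replicate_2)
  have dm: "simplicial_map M M d" unfolding d_def c_def by (rule id_htpy_inverse[OF M F bij])
  have cd: "c n (d n x) = x" if "x \<in> cells M n" for n x
    unfolding d_def using bij_betw_inv_into_right[OF bij that] unfolding c_def .
  have dc: "d n (c n x) = x" if "x \<in> cells M n" for n x
    unfolding d_def using bij_betw_inv_into_left[OF bij that] unfolding c_def .
  note cc = simplicial_map_cells[OF cm] and dcell = simplicial_map_cells[OF dm]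
  define G where "G = (\<lambda>m x \<alpha>. d m (nu M m (F m (nu M m x) (revl \<alpha>))))"
  have G: "smap2 M 1 M G"
    unfolding G_def by (rule smap2_post[OF smap2_reverse[OF M M Fs] dm])
  have \<eta>: "\<eta> \<in> cells M 1" unfolding \<eta>_def by (rule smap2_cells[OF Fs unit_cells[OF P]]) simp
  have G00: "G 1 x [0, 0] = d 1 x" if "x \<in> cells M 1" for x
    using that F11[OF inv1_cells[OF M that]] by (simp add: G_def revl_def inv1_inv1[OF M])
  have G11: "G 1 x [1, 1] = x" if x: "x \<in> cells M 1" for x
    using x simplicial_map_inv1[OF M M cm x] by (simp add: G_def revl_def c1[symmetric] inv1_inv1[OF M] dc cc)
  have F01: "mul M \<eta> x (F 1 x [0, 1])" if "x \<in> cells M 1" for x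
    using smap2_mul_right[OF P P Fs that, of 0 1] F11[OF that] by (simp add: \<eta>_def)
  have F01': "mul M (c 1 x) \<eta> (F 1 x [0, 1])" if "x \<in> cells M 1" for x
    using smap2_mul_left[OF P P Fs that, of 0 1] by (simp add: \<eta>_def c1)
  have inv_u: "nu M 1 (unit M) = unit M" by (rule inv1_unit[OF M])
  \<comment> \<open>The square of G is a product of two values of the inverse of c. Applying c turns
    it into x \<eta>\<inverse>, which undoes F(x, [0, 1]) = c(x) \<eta> and is undone by it.\<close>
  have G01: "mul M x (inv1 M \<eta>) (c 1 (G 1 x [0, 1]))" if x: "x \<in> cells M 1" for x
  proof -
    have "mul M (G 1 x [0, 0]) (G 1 (unit M) [0, 1]) (G 1 x [0, 1])"
      by (rule smap2_mul_left[OF P P G x]) auto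
    then have "mul M (c 1 (d 1 x)) (c 1 (d 1 (inv1 M \<eta>))) (c 1 (G 1 x [0, 1]))"
      using mul_map[OF cm] G00[OF x] inv_u by (simp add: G_def revl_def \<eta>_def)
    then show ?thesis using x inv1_cells[OF M \<eta>] by (simp add: cd)
  qed
  show ?thesis
  proof (rule bij_betw_byWitness[where f' = "\<lambda>x. G m x \<alpha>"]; (intro ballI subsetI)?)
    fix x assume x: "x \<in> cells M m"
    show "G m (F m x \<alpha>) \<alpha> = x"
    proof (rule pm_eqI[OF P, of _ m])
      have Fx: "F m x \<alpha> \<in> cells M m" by (rule smap2_cells[OF Fs x a])
      fix i assume i: "i < m"
      let ?x = "edge M m i (Suc i) x"
      have xc: "?x \<in> cells M 1" using edge_cells[OF S x, of i "Suc i"] i by simp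
      have "edge M m i (Suc i) (G m (F m x \<alpha>) \<alpha>) = G 1 (F 1 ?x [\<alpha> ! i, \<alpha> ! Suc i]) [\<alpha> ! i, \<alpha> ! Suc i]"
        using i by (simp add: smap2_edge[OF G Fx a] smap2_edge[OF Fs x a])
      moreover have "c 1 (G 1 (F 1 ?x [0, 1]) [0, 1]) = c 1 ?x"
        using mul_cancel_right_inv[OF M F01'[OF xc]] G01[OF smap2_cells[OF Fs xc, of "[0, 1]"]] mul_fun[OF P] by simp
      then have "G 1 (F 1 ?x [0, 1]) [0, 1] = ?x"
        using dc[OF xc] dc[OF smap2_cells[OF G smap2_cells[OF Fs xc, of "[0, 1]"], of "[0, 1]"]] by simp
      moreover have "G 1 (F 1 ?x [0, 0]) [0, 0] = ?x" "G 1 (F 1 ?x [1, 1]) [1, 1] = ?x"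
        using xc by (simp_all add: G00 G11 F11 c1[symmetric] cc dc)
      moreover have "\<alpha> ! i \<le> \<alpha> ! Suc i" "\<alpha> ! Suc i \<le> 1"
        using mono_maps_nth_mono[OF a, of i "Suc i"] mono_maps_nth_le[OF a, of "Suc i"] i by auto
      ultimately show "edge M m i (Suc i) (G m (F m x \<alpha>) \<alpha>) = ?x"
        using edges_01[of "\<alpha> ! i" "\<alpha> ! Suc i"] by auto
    qed (use smap2_cells[OF G smap2_cells[OF Fs x a] a] x in auto)
    show "F m (G m x \<alpha>) \<alpha> = x"
    proof (rule pm_eqI[OF P, of _ m])
      have Gx: "G m x \<alpha> \<in> cells M m" by (rule smap2_cells[OF G x a])
      fix i assume i: "i < m"
      let ?x = "edge M m i (Suc i) x"
      have xc: "?x \<in> cells M 1" using edge_cells[OF S x, of i "Suc i"] i by simp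
      have gc: "G 1 ?x [0, 1] \<in> cells M 1" by (rule smap2_cells[OF G xc]) simp
      have "edge M m i (Suc i) (F m (G m x \<alpha>) \<alpha>) = F 1 (G 1 ?x [\<alpha> ! i, \<alpha> ! Suc i]) [\<alpha> ! i, \<alpha> ! Suc i]"
        using i by (simp add: smap2_edge[OF Fs Gx a] smap2_edge[OF G x a])
      moreover have "mul M (c 1 (G 1 ?x [0, 1])) \<eta> ?x"
        using mul_cancel_right_inv[OF M G01[OF xc]] inv1_inv1[OF M \<eta>] by simp
      then have "F 1 (G 1 ?x [0, 1]) [0, 1] = ?x"
        using F01'[OF gc] mul_fun[OF P] by blast
      moreover have "F 1 (G 1 ?x [0, 0]) [0, 0] = ?x" "F 1 (G 1 ?x [1, 1]) [1, 1] = ?x"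
        using xc by (simp_all add: G00 G11 F11 c1[symmetric] cd)
      moreover have "\<alpha> ! i \<le> \<alpha> ! Suc i" "\<alpha> ! Suc i \<le> 1"
        using mono_maps_nth_mono[OF a, of i "Suc i"] mono_maps_nth_le[OF a, of "Suc i"] i by auto
      ultimately show "edge M m i (Suc i) (F m (G m x \<alpha>) \<alpha>) = ?x"
        using edges_01[of "\<alpha> ! i" "\<alpha> ! Suc i"] by auto
    qed (use smap2_cells[OF Fs smap2_cells[OF G x a] a] x in auto)
  qed (use smap2_cells[OF Fs _ a] smap2_cells[OF G _ a] in auto)
qed

lemma id_htpy_conj:
  assumes M: "partial_monoid M" and f: "simplicial_iso M M f" and F: "id_htpy M F"
  shows "id_htpy M (\<lambda>m x \<alpha>. f m (F m (inv_into (cells M m) (f m) x) \<alpha>))"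
    and "f 1 (F 1 (inv_into (cells M 1) (f 1) (unit M)) \<alpha>) = f 1 (F 1 (unit M) \<alpha>)"
proof -
  have Fs: "smap2 M 1 M F" and F1: "\<And>n x. x \<in> cells M n \<Longrightarrow> F n x (replicate (Suc n) 1) = x"
    using F unfolding id_htpy_def by blast+
  let ?g = "\<lambda>n. inv_into (cells M n) (f n)"
  have g: "simplicial_map M M ?g" by (rule simplicial_map_inv_into[OF f pm_simplicial[OF M]])
  have fm: "simplicial_map M M f" and b: "\<And>n. bij_betw (f n) (cells M n) (cells M n)"
    using f by (auto simp: simplicial_iso_def)
  show "id_htpy M (\<lambda>m x \<alpha>. f m (F m (?g m x) \<alpha>))"
    unfolding id_htpy_def
  proof (intro conjI allI ballI)
    show "smap2 M 1 M (\<lambda>m x \<alpha>. f m (F m (?g m x) \<alpha>))"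
      by (rule smap2_post[OF smap2_pre[OF Fs g] fm])
    show "f n (F n (?g n x) (replicate (Suc n) 1)) = x" if "x \<in> cells M n" for n x
      using that F1[OF simplicial_map_cells[OF g that]] bij_betw_inv_into_right[OF b that] by simp
  qed
  show "f 1 (F 1 (?g 1 (unit M)) \<alpha>) = f 1 (F 1 (unit M) \<alpha>)"
    using simplicial_map_unit[OF M M g] by simp
qed

text \<open>Conjugating a homotopy of the identity with f gives another one, and f fixes the unit,
  so the new element is the image of the old.\<close>

lemma NN_iso:
  assumes M: "partial_monoid M" and f: "simplicial_iso M M f" and \<eta>: "\<eta> \<in> NN M"
  shows "f 1 \<eta> \<in> NN M"
proof -
  obtain F where "id_htpy M F" "F 1 (unit M) [0, 1] = \<eta>" using \<eta> unfolding NN_iff[OF M] by blast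
  then show ?thesis unfolding NN_iff[OF M] using id_htpy_conj[OF M f] by blast
qed

lemma simplicial_iso_inv_into:
  assumes "simplicial_iso X Y f" "simplicial_set X"
  shows "simplicial_iso Y X (\<lambda>n. inv_into (cells X n) (f n))"
  using assms simplicial_map_inv_into bij_betw_inv_into unfolding simplicial_iso_def by blast

lemma NNs_iso:
  assumes M: "partial_monoid M" and f: "simplicial_iso M M f" and \<eta>: "\<eta> \<in> NNs M"
  shows "f 1 \<eta> \<in> NNs M"
proof -
  obtain F where F: "id_htpy M F" "F 1 (unit M) [0, 1] = \<eta>"
    and b: "\<And>n. bij_betw (\<lambda>x. F n x (replicate (Suc n) 0)) (cells M n) (cells M n)"
    using \<eta> unfolding NNs_def by blast
  have fb: "\<And>n. bij_betw (f n) (cells M n) (cells M n)" using f by (simp add: simplicial_iso_def)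
  have "bij_betw (\<lambda>x. f n (F n (inv_into (cells M n) (f n) x) (replicate (Suc n) 0))) (cells M n) (cells M n)" for n
    using bij_betw_trans[OF bij_betw_trans[OF bij_betw_inv_into[OF fb] b] fb] by (simp add: comp_def)
  then show ?thesis
    unfolding NNs_def using id_htpy_conj[OF M f F(1)] F(2) by blast
qed

text \<open>The square f(y) \<eta> = \<eta> g(y) can be solved for f(y) because X has cancellation;
  so \<eta> and g determine the homotopy.\<close>

lemma smap2_unique:
  assumes X: "partial_group X" and Y: "partial_monoid Y" and K: "smap2 Y 1 X K" and L: "smap2 Y 1 X L"
    and 1: "\<And>y. y \<in> cells Y 1 \<Longrightarrow> K 1 y [1, 1] = L 1 y [1, 1]"
    and 2: "K 1 (unit Y) [0, 1] = L 1 (unit Y) [0, 1]"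
    and y: "y \<in> cells Y m" and a: "\<alpha> \<in> mono_maps m 1"
  shows "K m y \<alpha> = L m y \<alpha>"
proof (rule smap2_eqI[OF pg_pm[OF X] Y K L _ _ y a])
  note P = pg_pm[OF X]
  fix z and i :: nat assume z: "z \<in> cells Y 1" and i: "i \<le> 1"
  have "K 1 z [0, 1] = L 1 z [0, 1]"
    using smap2_mul_right[OF P Y K z, of 0 1] smap2_mul_right[OF P Y L z, of 0 1] 1[OF z] 2 mul_fun[OF P] by simp
  then have "K 1 z [0, 0] = L 1 z [0, 0]"
    using smap2_mul_left[OF P Y K z, of 0 1] smap2_mul_left[OF P Y L z, of 0 1] 2 mul_right_cancel[OF X] by simp
  then show "K 1 z [i, i] = L 1 z [i, i]" using 1[OF z] i edges_01[of i i] by auto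
next
  fix i j :: nat assume "i \<le> j" "j \<le> 1"
  then show "K 1 (unit Y) [i, j] = L 1 (unit Y) [i, j]"
    using edges_01[of i j] 2 smap2_unit[OF pg_pm[OF X] Y K] smap2_unit[OF pg_pm[OF X] Y L] by auto
qed

text \<open>The required simplex is the top simplex of the prism with k = 0: after \<eta> only the
  end at the vertex 1 is seen, where the homotopy is the identity.\<close>

lemma NN_Cons_words:
  assumes M: "partial_monoid M" and \<eta>: "\<eta> \<in> NN M" and xs: "xs \<in> words M"
  shows "\<eta> # xs \<in> words M"
proof -
  obtain F where Fs: "smap2 M 1 M F" and F1: "\<And>n x. x \<in> cells M n \<Longrightarrow> F n x (replicate (Suc n) 1) = x"
    and F0: "F 1 (unit M) [0, 1] = \<eta>"
    using \<eta> unfolding NN_iff[OF M] id_htpy_def by blast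
  obtain u where u: "u \<in> cells M (length xs)" and ui: "\<And>i. i < length xs \<Longrightarrow> edge M (length xs) i (Suc i) u = xs ! i"
    using xs by (auto simp: words_iff[OF refl])
  have F11: "F 1 x [1, 1] = x" if "x \<in> cells M 1" for x using F1[OF that] by (simp only: replicate_2)
  have ec: "edge M (length xs) i (Suc i) u \<in> cells M 1" if "i < length xs" for i
    by (rule edge_cells[OF pm_simplicial[OF M] u]) (use that in auto)
  obtain v where v: "v \<in> cells M (Suc (length xs))" "edge M (Suc (length xs)) 0 1 v = \<eta>"
    "\<And>i. i < length xs \<Longrightarrow> edge M (Suc (length xs)) (Suc i) (Suc (Suc i)) v = F 1 (edge M (length xs) i (Suc i) u) [1, 1]"
    using smap2_word[OF M M Fs u, of 0] F0 by auto
  show ?thesis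
    by (subst words_iff[of _ "Suc (length xs)"])
      (use v ui F11 ec in \<open>auto intro!: bexI[OF _ v(1)] simp: less_Suc_eq_0_disj\<close>)
qed

lemma Nil_words: "partial_monoid M \<Longrightarrow> [] \<in> words M"
  using pm_vertex by (auto simp: words_iff[of _ 0])

text \<open>This is the inclusion of BN(M) in M: between elements of \<open>NN M\<close> the
  existence of words is never in question.\<close>

lemma NN_words: "partial_monoid M \<Longrightarrow> set xs \<subseteq> NN M \<Longrightarrow> xs \<in> words M"
  by (induction xs) (auto simp: Nil_words NN_Cons_words)

section \<open>Trivialisations\<close>

locale partial_group_extension =
  fixes M :: "'a sset" and \<iota> :: "nat \<Rightarrow> 'a \<Rightarrow> 'e" and E :: "'e sset" and \<tau> :: "nat \<Rightarrow> 'e \<Rightarrow> 'h" and H :: "'h sset"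
  assumes extn: "extension M \<iota> E \<tau> H"
begin

lemma pgM: "partial_group M" and pgH: "partial_group H" and simpE: "simplicial_set E"
  and tau: "simplicial_map E H \<tau>" and iota: "simplicial_map M E \<iota>"
  and iota_bij: "bij_betw (\<iota> n) (cells M n) {e \<in> cells E n. \<tau> n e = vertex_cell H n}"
  using extn by (auto simp: extension_def fibre_bundle_def)

lemma pmM: "partial_monoid M" and pmH: "partial_monoid H" and simpM: "simplicial_set M" and simpH: "simplicial_set H"
  using pgM pgH by (auto intro: pg_pm pm_simplicial)

text \<open>The inverse of a trivialisation over \<Delta>[n], followed by the projection to E.
  Stated fibrewise, it spares the pullback and its pairs from here on.\<close>

definition triv :: "nat \<Rightarrow> 'h \<Rightarrow> (nat \<Rightarrow> 'a \<Rightarrow> nat list \<Rightarrow> 'e) \<Rightarrow> bool" where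
  "triv n c Q \<longleftrightarrow> smap2 M n E Q \<and> (\<forall>m. \<forall>\<alpha> \<in> mono_maps m n.
     bij_betw (\<lambda>x. Q m x \<alpha>) (cells M m) {e \<in> cells E m. \<tau> m e = act H n \<alpha> c})"

lemma triv_ex:
  assumes c: "c \<in> cells H n"
  shows "\<exists>Q. triv n c Q"
proof -
  let ?b = "\<lambda>m \<alpha>. act H n \<alpha> c"
  let ?P = "pullback E \<tau> (std_simplex n) ?b"
  let ?S = "product_sset M (std_simplex n)"
  have b: "simplicial_map (std_simplex n) H ?b"
    using c by (auto simp: simplicial_map_def std_simplex_def act_cells[OF simpH] act_act[OF simpH])
  obtain \<phi> where iso: "simplicial_iso ?P ?S \<phi>"
    and snd: "\<And>m p. p \<in> cells ?P m \<Longrightarrow> snd (\<phi> m p) = snd p"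
    using extn b unfolding extension_def fibre_bundle_def by meson
  have bij: "bij_betw (\<phi> m) (cells ?P m) (cells ?S m)" for m using iso by (simp add: simplicial_iso_def)
  have P: "simplicial_set ?P"
    unfolding simplicial_set_def
  proof (intro conjI allI ballI)
    fix m k \<alpha> p assume a: "\<alpha> \<in> mono_maps m k" and p: "p \<in> cells ?P k"
    then have "snd p \<in> mono_maps k n" "fst p \<in> cells E k" "\<tau> k (fst p) = act H n (snd p) c"
      by (auto simp: pullback_def std_simplex_def)
    with a show "act ?P k \<alpha> p \<in> cells ?P m"
      by (auto simp: pullback_def std_simplex_def act_cells[OF simpE] comp_in_mono_maps
          simplicial_map_act[OF tau] act_act[OF simpH _ _ c])
  next
    fix k p assume p: "p \<in> cells ?P k"
    then show "act ?P k [0..<Suc k] p = p"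
      by (auto simp: pullback_def std_simplex_def act_id[OF simpE] map_nth_id)
  next
    fix l m k \<alpha> \<beta> p assume a: "\<alpha> \<in> mono_maps m k" and b: "\<beta> \<in> mono_maps l m" and p: "p \<in> cells ?P k"
    have "\<beta> ! i \<le> m" if "i \<le> l" for i using b that by (rule mono_maps_nth_le)
    then have "map ((!) (snd p)) (map ((!) \<alpha>) \<beta>) = map ((!) (map ((!) (snd p)) \<alpha>)) \<beta>"
      using a b by (auto simp: list_eq_iff_nth_eq mono_maps_length less_Suc_eq_le)
    then show "act ?P k (map ((!) \<alpha>) \<beta>) p = act ?P m \<beta> (act ?P k \<alpha> p)"
      using p by (auto simp: pullback_def std_simplex_def act_act[OF simpE a b] simp del: map_map)
  qed
  define \<psi> where "\<psi> = (\<lambda>m. inv_into (cells ?P m) (\<phi> m))"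
  have \<psi>: "simplicial_map ?S ?P \<psi>" unfolding \<psi>_def by (rule simplicial_map_inv_into[OF iso P])
  have S: "(x, \<alpha>) \<in> cells ?S m" if "x \<in> cells M m" "\<alpha> \<in> mono_maps m n" for m x \<alpha>
    using that by (simp add: product_sset_def std_simplex_def)
  have P_mem: "(e, \<alpha>) \<in> cells ?P m \<Longrightarrow> e \<in> cells E m \<and> \<tau> m e = act H n \<alpha> c" for e \<alpha> m
    by (simp add: pullback_def)
  have \<phi>\<psi>: "\<phi> m (\<psi> m p) = p" if "p \<in> cells ?S m" for m p
    unfolding \<psi>_def by (rule bij_betw_inv_into_right[OF bij that])
  have \<psi>\<phi>: "\<psi> m (\<phi> m p) = p" if "p \<in> cells ?P m" for m p
    unfolding \<psi>_def by (rule bij_betw_inv_into_left[OF bij that])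
  have \<psi>_eq: "\<psi> m (x, \<alpha>) = (fst (\<psi> m (x, \<alpha>)), \<alpha>)" if "x \<in> cells M m" "\<alpha> \<in> mono_maps m n" for m x \<alpha>
    using snd[OF simplicial_map_cells[OF \<psi> S[OF that]]] \<phi>\<psi>[OF S[OF that]] by (metis prod.collapse snd_conv)
  have fstP: "simplicial_map ?P E (\<lambda>m. fst)"
    by (auto simp: simplicial_map_def pullback_def)
  define Q where "Q m x \<alpha> = fst (\<psi> m (x, \<alpha>))" for m x \<alpha>
  have "smap2 M n E Q"
    using simplicial_map_comp[OF \<psi> fstP] unfolding simplicial_map_product_iff Q_def by (simp add: comp_def)
  moreover have "bij_betw (\<lambda>x. Q m x \<alpha>) (cells M m) {e \<in> cells E m. \<tau> m e = act H n \<alpha> c}"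
    if a: "\<alpha> \<in> mono_maps m n" for m \<alpha>
  proof (rule bij_betw_byWitness[where f' = "\<lambda>e. fst (\<phi> m (e, \<alpha>))"]; intro ballI subsetI)
    fix x assume x: "x \<in> cells M m"
    then show "fst (\<phi> m (Q m x \<alpha>, \<alpha>)) = x"
      using \<psi>_eq[OF x a] \<phi>\<psi>[OF S[OF x a]] unfolding Q_def by simp
  next
    fix e assume e: "e \<in> {e \<in> cells E m. \<tau> m e = act H n \<alpha> c}"
    then have p: "(e, \<alpha>) \<in> cells ?P m" using a by (auto simp: pullback_def std_simplex_def)
    then have "\<phi> m (e, \<alpha>) = (fst (\<phi> m (e, \<alpha>)), \<alpha>)" using snd[OF p] by (metis prod.collapse snd_conv)
    then show "Q m (fst (\<phi> m (e, \<alpha>))) \<alpha> = e" unfolding Q_def using \<psi>\<phi>[OF p] by simp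
  next
    fix e assume "e \<in> (\<lambda>x. Q m x \<alpha>) ` cells M m"
    then obtain x where x: "x \<in> cells M m" and e: "e = Q m x \<alpha>" by auto
    have "\<psi> m (x, \<alpha>) \<in> cells ?P m" by (rule simplicial_map_cells[OF \<psi> S[OF x a]])
    then show "e \<in> {e \<in> cells E m. \<tau> m e = act H n \<alpha> c}"
      using P_mem[of "fst (\<psi> m (x, \<alpha>))" \<alpha> m] unfolding \<psi>_eq[OF x a, symmetric] e Q_def by simp
  next
    fix x assume "x \<in> (\<lambda>e. fst (\<phi> m (e, \<alpha>))) ` {e \<in> cells E m. \<tau> m e = act H n \<alpha> c}"
    then obtain e where e: "e \<in> cells E m" "\<tau> m e = act H n \<alpha> c" and x: "x = fst (\<phi> m (e, \<alpha>))" by auto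
    then have p: "(e, \<alpha>) \<in> cells ?P m" using a by (auto simp: pullback_def std_simplex_def)
    have "\<phi> m (e, \<alpha>) \<in> cells ?S m" using bij[of m] p by (auto simp: bij_betw_def)
    then show "x \<in> cells M m" unfolding x by (auto simp: product_sset_def)
  qed
  ultimately show ?thesis unfolding triv_def by blast
qed

lemma triv_smap2: "triv n c Q \<Longrightarrow> smap2 M n E Q"
  by (simp add: triv_def)

lemma triv_bij: "triv n c Q \<Longrightarrow> \<alpha> \<in> mono_maps m n \<Longrightarrow>
  bij_betw (\<lambda>x. Q m x \<alpha>) (cells M m) {e \<in> cells E m. \<tau> m e = act H n \<alpha> c}"
  by (simp add: triv_def)

lemma triv_tau: "triv n c Q \<Longrightarrow> \<alpha> \<in> mono_maps m n \<Longrightarrow> x \<in> cells M m \<Longrightarrow> \<tau> m (Q m x \<alpha>) = act H n \<alpha> c"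
  using triv_bij[of n c Q \<alpha> m] by (auto simp: bij_betw_def)

lemma triv_inj: "triv n c Q \<Longrightarrow> \<alpha> \<in> mono_maps m n \<Longrightarrow> x \<in> cells M m \<Longrightarrow> y \<in> cells M m \<Longrightarrow>
  Q m x \<alpha> = Q m y \<alpha> \<Longrightarrow> x = y"
  using triv_bij[of n c Q \<alpha> m] by (auto simp: bij_betw_def dest: inj_onD)

lemma triv_surj: "triv n c Q \<Longrightarrow> \<alpha> \<in> mono_maps m n \<Longrightarrow> e \<in> cells E m \<Longrightarrow> \<tau> m e = act H n \<alpha> c \<Longrightarrow>
  \<exists>x \<in> cells M m. Q m x \<alpha> = e"
proof -
  assume "triv n c Q" "\<alpha> \<in> mono_maps m n" "e \<in> cells E m" "\<tau> m e = act H n \<alpha> c"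
  then have "e \<in> (\<lambda>x. Q m x \<alpha>) ` cells M m"
    using triv_bij[of n c Q \<alpha> m] by (simp add: bij_betw_def)
  then show ?thesis by blast
qed

lemma triv_surj_id: "e \<in> cells E n \<Longrightarrow> triv n (\<tau> n e) Q \<Longrightarrow> \<exists>x \<in> cells M n. Q n x [0..<Suc n] = e"
  by (rule triv_surj[OF _ id_in_mono_maps]) (auto simp: act_id[OF simpH] simplicial_map_cells[OF tau])

text \<open>Two cells with the same spine have the same image in H, since spines are injective
  there. So both lie in one trivialisation and can be compared in M.\<close>

lemma pmE: "partial_monoid E"
  unfolding partial_monoid_def
proof (intro conjI allI impI)
  show "simplicial_set E" by (rule simpE)
  have v: "vertex H \<in> cells H 0" by (rule pm_vertex[OF pmH])
  obtain Q where Q: "triv 0 (vertex H) Q" using triv_ex[OF v] by blast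
  have t: "\<tau> 0 e = act H 0 [0] (vertex H)" if "e \<in> cells E 0" for e
    using pm_vertex_unique[OF pmH simplicial_map_cells[OF tau that]] act_id[OF simpH v] by simp
  show "\<exists>!v. v \<in> cells E 0"
  proof (rule ex1I)
    show "Q 0 (vertex M) [0] \<in> cells E 0"
      by (rule smap2_cells[OF triv_smap2[OF Q] pm_vertex[OF pmM]]) simp
    fix e assume "e \<in> cells E 0"
    then obtain x where "x \<in> cells M 0" "Q 0 x [0] = e" using triv_surj[OF Q, of "[0]" 0 e] t by auto
    then show "e = Q 0 (vertex M) [0]" using pm_vertex_unique[OF pmM] by blast
  qed
  fix n :: nat assume "1 \<le> n"
  show "inj_on (spine E n) (cells E n)"
  proof (rule inj_onI)
    fix e e' assume e: "e \<in> cells E n" and e': "e' \<in> cells E n" and s: "spine E n e = spine E n e'"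
    have s: "edge E n i (Suc i) e = edge E n i (Suc i) e'" if "i < n" for i
      using s that spine_nth[of i n E] by metis
    have t: "\<tau> n e' = \<tau> n e"
      by (rule pm_eqI[OF pmH, of _ n]) (use e e' s in \<open>auto simp: simplicial_map_cells[OF tau] simplicial_map_edge[OF tau]\<close>)
    obtain Q where Q: "triv n (\<tau> n e) Q" using triv_ex[OF simplicial_map_cells[OF tau e]] by blast
    obtain x where x: "x \<in> cells M n" "Q n x [0..<Suc n] = e" using triv_surj_id[OF e Q] by blast
    obtain x' where x': "x' \<in> cells M n" "Q n x' [0..<Suc n] = e'" using triv_surj_id[OF e'] Q t by metis
    have "x = x'"
    proof (rule pm_eqI[OF pmM x(1) x'(1)])
      fix i assume i: "i < n"
      have "Q 1 (edge M n i (Suc i) x) [i, Suc i] = Q 1 (edge M n i (Suc i) x') [i, Suc i]"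
        using s[OF i] smap2_edge[OF triv_smap2[OF Q] x(1) id_in_mono_maps, of i "Suc i"]
          smap2_edge[OF triv_smap2[OF Q] x'(1) id_in_mono_maps, of i "Suc i"] i x(2) x'(2) by simp
      then show "edge M n i (Suc i) x = edge M n i (Suc i) x'"
        by (rule triv_inj[OF Q, rotated 3]) (use i x x' in \<open>auto intro!: edge_cells[OF simpM]\<close>)
    qed
    then show "e = e'" using x x' by simp
  qed
qed

section \<open>The fibre over the vertex and its identification with M\<close>

definition fibre :: "nat \<Rightarrow> 'e set" where
  "fibre n = {e \<in> cells E n. \<tau> n e = vertex_cell H n}"

definition \<kappa> :: "nat \<Rightarrow> 'e \<Rightarrow> 'a" where
  "\<kappa> n = inv_into (cells M n) (\<iota> n)"

lemma iota_fibre: "x \<in> cells M n \<Longrightarrow> \<iota> n x \<in> fibre n"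
  using iota_bij[of n] by (auto simp: bij_betw_def fibre_def)

lemma iota_kappa: "e \<in> fibre n \<Longrightarrow> \<iota> n (\<kappa> n e) = e"
  unfolding \<kappa>_def fibre_def by (rule bij_betw_inv_into_right[OF iota_bij])

lemma kappa_iota: "x \<in> cells M n \<Longrightarrow> \<kappa> n (\<iota> n x) = x"
  unfolding \<kappa>_def fibre_def by (rule bij_betw_inv_into_left[OF iota_bij])

lemma kappa_cells: "e \<in> fibre n \<Longrightarrow> \<kappa> n e \<in> cells M n"
  unfolding \<kappa>_def fibre_def by (rule inv_into_into) (use iota_bij[of n] in \<open>simp add: bij_betw_def\<close>)

lemma kappa_bij: "bij_betw (\<kappa> n) (fibre n) (cells M n)"
  unfolding \<kappa>_def fibre_def by (rule bij_betw_inv_into[OF iota_bij])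

lemma iota_inj: "x \<in> cells M n \<Longrightarrow> y \<in> cells M n \<Longrightarrow> \<iota> n x = \<iota> n y \<Longrightarrow> x = y"
  using kappa_iota by metis

lemma iota_cells: "x \<in> cells M n \<Longrightarrow> \<iota> n x \<in> cells E n"
  by (rule simplicial_map_cells[OF iota])

lemma tau_iota: "x \<in> cells M n \<Longrightarrow> \<tau> n (\<iota> n x) = vertex_cell H n"
  using iota_fibre by (simp add: fibre_def)

lemma kappa_map:
  assumes f: "simplicial_map Y E f" and "\<And>n y. y \<in> cells Y n \<Longrightarrow> f n y \<in> fibre n" and Y: "simplicial_set Y"
  shows "simplicial_map Y M (\<lambda>n y. \<kappa> n (f n y))"
  unfolding simplicial_map_def
proof (intro conjI allI ballI)
  fix m n \<alpha> y assume a: "\<alpha> \<in> mono_maps m n" and y: "y \<in> cells Y n"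
  have k: "\<kappa> n (f n y) \<in> cells M n" using assms(2)[OF y] by (rule kappa_cells)
  have "\<iota> m (act M n \<alpha> (\<kappa> n (f n y))) = f m (act Y n \<alpha> y)"
    using a y k by (simp add: simplicial_map_act[OF iota] iota_kappa assms(2) simplicial_map_act[OF f])
  then show "\<kappa> m (f m (act Y n \<alpha> y)) = act M n \<alpha> (\<kappa> n (f n y))"
    using kappa_iota[OF act_cells[OF simpM a k]] by simp
qed (use assms(2) kappa_cells in blast)

section \<open>Operations on trivialisations, lifting and uniqueness\<close>

lemma triv_restrict:
  assumes c: "c \<in> cells H n" and Q: "triv n c Q" and g: "\<gamma> \<in> mono_maps k n"
  shows "triv k (act H n \<gamma> c) (\<lambda>m y \<alpha>. Q m y (map ((!) \<gamma>) \<alpha>))"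
  unfolding triv_def
  using smap2_restrict[OF triv_smap2[OF Q] g] triv_bij[OF Q comp_in_mono_maps[OF g]]
  by (auto simp: act_act[OF simpH g _ c])

lemma triv_comp:
  assumes Q: "triv n c Q" and B: "smap2 M n M B"
    and b: "\<And>m \<alpha>. \<alpha> \<in> mono_maps m n \<Longrightarrow> bij_betw (\<lambda>x. B m x \<alpha>) (cells M m) (cells M m)"
  shows "triv n c (\<lambda>m x \<alpha>. Q m (B m x \<alpha>) \<alpha>)"
  unfolding triv_def
  using smap2_comp[OF B triv_smap2[OF Q]] bij_betw_trans[OF b triv_bij[OF Q]] by (auto simp: comp_def)

lemma triv_cong:
  assumes Q: "triv n c Q" and e: "\<And>m x \<alpha>. x \<in> cells M m \<Longrightarrow> \<alpha> \<in> mono_maps m n \<Longrightarrow> L m x \<alpha> = Q m x \<alpha>"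
  shows "triv n c L"
  unfolding triv_def
proof (intro conjI allI ballI)
  show "smap2 M n E L" by (rule smap2_cong[OF triv_smap2[OF Q] simpM e])
  fix m \<alpha> assume a: "\<alpha> \<in> mono_maps m n"
  show "bij_betw (\<lambda>x. L m x \<alpha>) (cells M m) {e \<in> cells E m. \<tau> m e = act H n \<alpha> c}"
    using triv_bij[OF Q a] by (subst bij_betw_cong[of _ _ "\<lambda>x. Q m x \<alpha>"]) (auto simp: e a)
qed

lemma triv_at_fibre:
  assumes c: "c \<in> cells H n" and Q: "triv n c Q" and i: "i \<le> n"
  shows "bij_betw (\<lambda>x. Q m x (replicate (Suc m) i)) (cells M m) (fibre m)"
  using triv_bij[OF Q, of "replicate (Suc m) i" m] i act_const[OF pmH c i, of m] by (simp add: fibre_def)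

lemma triv_at_iso:
  assumes c: "c \<in> cells H n" and Q: "triv n c Q" and i: "i \<le> n"
  shows "simplicial_iso M M (\<lambda>m x. \<kappa> m (Q m x (replicate (Suc m) i)))"
  unfolding simplicial_iso_def
proof (intro conjI allI)
  have "Q m x (replicate (Suc m) i) \<in> fibre m" if "x \<in> cells M m" for m x
    using triv_at_fibre[OF assms, of m] that by (auto simp: bij_betw_def)
  then show "simplicial_map M M (\<lambda>m x. \<kappa> m (Q m x (replicate (Suc m) i)))"
    by (rule kappa_map[OF smap2_at[OF triv_smap2[OF Q] i] _ simpM])
  show "bij_betw (\<lambda>x. \<kappa> m (Q m x (replicate (Suc m) i))) (cells M m) (cells M m)" for m
    using bij_betw_trans[OF triv_at_fibre[OF assms] kappa_bij] by (simp add: comp_def)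
qed

text \<open>At the vertex i a trivialisation is \<iota> up to an automorphism of M; precomposing
  with the inverse of this automorphism over all of \<Delta>[n] removes it.\<close>

lemma triv_normalise:
  assumes c: "c \<in> cells H n" and Q: "triv n c Q" and i: "i \<le> n"
  defines "q \<equiv> \<lambda>m x. \<kappa> m (Q m x (replicate (Suc m) i))"
  shows "triv n c (\<lambda>m x \<alpha>. Q m (inv_into (cells M m) (q m) x) \<alpha>)"
    and "x \<in> cells M m \<Longrightarrow> Q m (inv_into (cells M m) (q m) x) (replicate (Suc m) i) = \<iota> m x"
proof -
  have iso: "simplicial_iso M M q" unfolding q_def by (rule triv_at_iso[OF c Q i])
  have inv: "simplicial_map M M (\<lambda>n. inv_into (cells M n) (q n))"
    by (rule simplicial_map_inv_into[OF iso simpM])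
  have qb: "bij_betw (q m) (cells M m) (cells M m)" for m using iso by (simp add: simplicial_iso_def)
  show "triv n c (\<lambda>m x \<alpha>. Q m (inv_into (cells M m) (q m) x) \<alpha>)"
    by (rule triv_comp[OF Q smap2_const[OF inv]]) (rule bij_betw_inv_into[OF qb])
  assume x: "x \<in> cells M m"
  have y: "inv_into (cells M m) (q m) x \<in> cells M m" by (rule simplicial_map_cells[OF inv x])
  have "q m (inv_into (cells M m) (q m) x) = x" by (rule bij_betw_inv_into_right[OF qb x])
  moreover have "Q m (inv_into (cells M m) (q m) x) (replicate (Suc m) i) \<in> fibre m"
    using triv_at_fibre[OF c Q i, of m] y by (auto simp: bij_betw_def)
  ultimately show "Q m (inv_into (cells M m) (q m) x) (replicate (Suc m) i) = \<iota> m x"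
    unfolding q_def using iota_kappa by metis
qed

text \<open>The last vertex is the one to normalise, because homotopies of \<iota> have \<iota> at
  the vertex 1.\<close>

definition ntriv :: "nat \<Rightarrow> 'h \<Rightarrow> (nat \<Rightarrow> 'a \<Rightarrow> nat list \<Rightarrow> 'e) \<Rightarrow> bool" where
  "ntriv n c Q \<longleftrightarrow> triv n c Q \<and> (\<forall>m. \<forall>x \<in> cells M m. Q m x (replicate (Suc m) n) = \<iota> m x)"

lemma ntriv_ex:
  assumes c: "c \<in> cells H n"
  shows "\<exists>Q. ntriv n c Q"
proof -
  obtain Q where "triv n c Q" using triv_ex[OF c] by blast
  from triv_normalise[OF c this order_refl] show ?thesis unfolding ntriv_def by blast
qed

lemma ntriv_triv: "ntriv n c Q \<Longrightarrow> triv n c Q"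
  by (simp add: ntriv_def)

text \<open>Maps into E over c become maps into M, where cancellation is available.\<close>

lemma triv_lift:
  assumes Q: "triv n c Q" and L: "smap2 Y n E L" and Y: "simplicial_set Y"
    and t: "\<And>m y \<alpha>. y \<in> cells Y m \<Longrightarrow> \<alpha> \<in> mono_maps m n \<Longrightarrow> \<tau> m (L m y \<alpha>) = act H n \<alpha> c"
  shows "\<exists>G. smap2 Y n M G \<and> (\<forall>m y \<alpha>. y \<in> cells Y m \<longrightarrow> \<alpha> \<in> mono_maps m n \<longrightarrow> Q m (G m y \<alpha>) \<alpha> = L m y \<alpha>)"
proof -
  define G where "G m y \<alpha> = inv_into (cells M m) (\<lambda>x. Q m x \<alpha>) (L m y \<alpha>)" for m y \<alpha>
  have L1: "L m y \<alpha> \<in> {e \<in> cells E m. \<tau> m e = act H n \<alpha> c}" if "y \<in> cells Y m" "\<alpha> \<in> mono_maps m n" for m y \<alpha>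
    using t that smap2_cells[OF L that] by simp
  have QG: "Q m (G m y \<alpha>) \<alpha> = L m y \<alpha>" if "y \<in> cells Y m" "\<alpha> \<in> mono_maps m n" for m y \<alpha>
    unfolding G_def by (rule bij_betw_inv_into_right[OF triv_bij[OF Q that(2)] L1[OF that]])
  have Gc: "G m y \<alpha> \<in> cells M m" if "y \<in> cells Y m" "\<alpha> \<in> mono_maps m n" for m y \<alpha>
    unfolding G_def by (rule inv_into_into) (use triv_bij[OF Q that(2)] L1[OF that] in \<open>simp add: bij_betw_def\<close>)
  have "smap2 Y n M G"
    unfolding smap2_def
  proof (intro conjI allI impI)
    fix l m y \<alpha> \<beta> assume y: "y \<in> cells Y m" and a: "\<alpha> \<in> mono_maps m n" and b: "\<beta> \<in> mono_maps l m"
    note y' = act_cells[OF Y b y] and ab = comp_in_mono_maps[OF a b]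
    show "G l (act Y m \<beta> y) (map ((!) \<alpha>) \<beta>) = act M m \<beta> (G m y \<alpha>)"
      by (rule triv_inj[OF Q ab Gc[OF y' ab] act_cells[OF simpM b Gc[OF y a]]])
        (simp only: QG[OF y' ab] smap2_act[OF L y a b, symmetric] smap2_act[OF triv_smap2[OF Q] Gc[OF y a] a b, symmetric] QG[OF y a])
  qed (rule Gc)
  then show ?thesis using QG by blast
qed

text \<open>The counterpart of \<open>smap2_unique\<close> for the target E, for which no inversion
  is known yet: both maps are lifted through a trivialisation over h and compared in M.\<close>

lemma unique_over:
  assumes h: "h \<in> cells H 1" and K: "smap2 M 1 E K" and L: "smap2 M 1 E L"
    and tK: "\<And>m y \<alpha>. y \<in> cells M m \<Longrightarrow> \<alpha> \<in> mono_maps m 1 \<Longrightarrow> \<tau> m (K m y \<alpha>) = act H 1 \<alpha> h"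
    and tL: "\<And>m y \<alpha>. y \<in> cells M m \<Longrightarrow> \<alpha> \<in> mono_maps m 1 \<Longrightarrow> \<tau> m (L m y \<alpha>) = act H 1 \<alpha> h"
    and 1: "\<And>y. y \<in> cells M 1 \<Longrightarrow> K 1 y [1, 1] = L 1 y [1, 1]"
    and 2: "K 1 (unit M) [0, 1] = L 1 (unit M) [0, 1]"
    and y: "y \<in> cells M m" and a: "\<alpha> \<in> mono_maps m 1"
  shows "K m y \<alpha> = L m y \<alpha>"
proof -
  obtain Q where Q: "triv 1 h Q" using triv_ex[OF h] by blast
  obtain F where F: "smap2 M 1 M F" and QF: "\<And>m y \<alpha>. y \<in> cells M m \<Longrightarrow> \<alpha> \<in> mono_maps m 1 \<Longrightarrow> Q m (F m y \<alpha>) \<alpha> = K m y \<alpha>"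
    using triv_lift[OF Q K simpM tK] by blast
  obtain G where G: "smap2 M 1 M G" and QG: "\<And>m y \<alpha>. y \<in> cells M m \<Longrightarrow> \<alpha> \<in> mono_maps m 1 \<Longrightarrow> Q m (G m y \<alpha>) \<alpha> = L m y \<alpha>"
    using triv_lift[OF Q L simpM tL] by blast
  have "F m y \<alpha> = G m y \<alpha>"
  proof (rule smap2_unique[OF pgM pmM F G _ _ y a])
    show "F 1 z [1, 1] = G 1 z [1, 1]" if z: "z \<in> cells M 1" for z
      by (rule triv_inj[OF Q, of "[1, 1]" 1]) (use z 1 QF[OF z] QG[OF z] smap2_cells[OF F z] smap2_cells[OF G z] in auto)
    show "F 1 (unit M) [0, 1] = G 1 (unit M) [0, 1]"
      by (rule triv_inj[OF Q, of "[0, 1]" 1])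
       (use unit_cells[OF pmM] 2 QF[OF unit_cells[OF pmM]] QG[OF unit_cells[OF pmM]]
          smap2_cells[OF F unit_cells[OF pmM]] smap2_cells[OF G unit_cells[OF pmM]] in auto)
  qed
  then show ?thesis using QF[OF y a] QG[OF y a] by simp
qed

section \<open>Elements defining homotopies of the inclusion\<close>

definition ihtpy :: "(nat \<Rightarrow> 'a \<Rightarrow> nat list \<Rightarrow> 'e) \<Rightarrow> bool" where
  "ihtpy K \<longleftrightarrow> smap2 M 1 E K \<and> (\<forall>m. \<forall>x \<in> cells M m. K m x (replicate (Suc m) 1) = \<iota> m x)"

lemma ihtpy_smap2: "ihtpy K \<Longrightarrow> smap2 M 1 E K"
  by (simp add: ihtpy_def)

lemma ihtpy_1: "ihtpy K \<Longrightarrow> x \<in> cells M m \<Longrightarrow> K m x (replicate (Suc m) 1) = \<iota> m x"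
  by (simp add: ihtpy_def)

lemma ihtpy_11: "ihtpy K \<Longrightarrow> x \<in> cells M 1 \<Longrightarrow> K 1 x [1, 1] = \<iota> 1 x"
  using ihtpy_1[of K x 1] by (simp only: replicate_2)

lemma defines_htpy_iff: "defines_htpy M E \<iota> z \<longleftrightarrow> (\<exists>K. ihtpy K \<and> K 1 (unit M) [0, 1] = z)"
proof
  assume "defines_htpy M E \<iota> z"
  then show "\<exists>K. ihtpy K \<and> K 1 (unit M) [0, 1] = z"
    unfolding defines_htpy_def htpy_iff ihtpy_def by blast
next
  assume "\<exists>K. ihtpy K \<and> K 1 (unit M) [0, 1] = z"
  then obtain K where K: "ihtpy K" "K 1 (unit M) [0, 1] = z" by blast
  have "simplicial_map M E (\<lambda>m x. K m x (replicate (Suc m) 0))"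
    by (rule smap2_at[OF ihtpy_smap2[OF K(1)]]) simp
  then show "defines_htpy M E \<iota> z"
    unfolding defines_htpy_def htpy_iff using K unfolding ihtpy_def by blast
qed

lemma ihtpy_edge_cells: "ihtpy K \<Longrightarrow> K 1 (unit M) [0, 1] \<in> cells E 1"
  by (rule smap2_cells[OF ihtpy_smap2 unit_cells[OF pmM]]) auto

text \<open>The composite of K with \<tau> is a homotopy of the constant map at the vertex. Such a
  homotopy is determined by its element because H has cancellation, so it depends on the simplex
  coordinate only.\<close>

lemma ihtpy_tau:
  assumes K: "ihtpy K" and x: "x \<in> cells M m" and a: "\<alpha> \<in> mono_maps m 1"
  shows "\<tau> m (K m x \<alpha>) = act H 1 \<alpha> (\<tau> 1 (K 1 (unit M) [0, 1]))"
proof -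
  note Ks = ihtpy_smap2[OF K]
  define h where "h = \<tau> 1 (K 1 (unit M) [0, 1])"
  have h: "h \<in> cells H 1" unfolding h_def by (rule simplicial_map_cells[OF tau ihtpy_edge_cells[OF K]])
  have T: "smap2 M 1 H (\<lambda>m x \<alpha>. \<tau> m (K m x \<alpha>))" by (rule smap2_post[OF Ks tau])
  have L: "smap2 M 1 H (\<lambda>m x \<alpha>. act H 1 \<alpha> h)"
    unfolding smap2_def using h by (auto simp: act_cells[OF simpH] act_act[OF simpH])
  have "\<tau> m (K m x \<alpha>) = act H 1 \<alpha> h"
  proof (rule smap2_unique[OF pgH pmM T L _ _ x a])
    show "\<tau> 1 (K 1 y [1, 1]) = edge H 1 1 1 h" if "y \<in> cells M 1" for y
      using that h edge_degenerate[OF pmH h, of 1] tau_iota[OF that] by (simp add: ihtpy_11[OF K] vertex_cell_1)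
    show "\<tau> 1 (K 1 (unit M) [0, 1]) = edge H 1 0 1 h"
      using h by (simp add: edge_id[OF simpH]) (simp add: h_def)
  qed
  then show ?thesis unfolding h_def .
qed

lemma ihtpy_fibre: "ihtpy K \<Longrightarrow> x \<in> cells M m \<Longrightarrow> K m x (replicate (Suc m) 0) \<in> fibre m"
  using ihtpy_tau[of K x m "replicate (Suc m) 0"] smap2_cells[OF ihtpy_smap2, of K x m "replicate (Suc m) 0"]
    act_const[OF pmH simplicial_map_cells[OF tau ihtpy_edge_cells], of K 0 m]
  by (simp add: fibre_def)

lemma ihtpy_unique:
  assumes "ihtpy K" "ihtpy L" "K 1 (unit M) [0, 1] = L 1 (unit M) [0, 1]" "x \<in> cells M m" "\<alpha> \<in> mono_maps m 1"
  shows "K m x \<alpha> = L m x \<alpha>"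
  by (rule unique_over[OF simplicial_map_cells[OF tau ihtpy_edge_cells[OF assms(1)]] ihtpy_smap2 ihtpy_smap2])
    (use assms ihtpy_tau[OF assms(1)] ihtpy_tau[OF assms(2)] ihtpy_11[OF assms(1)] ihtpy_11[OF assms(2)] in auto)

definition strong_ihtpy :: "(nat \<Rightarrow> 'a \<Rightarrow> nat list \<Rightarrow> 'e) \<Rightarrow> bool" where
  "strong_ihtpy K \<longleftrightarrow> ihtpy K \<and> (\<forall>m. bij_betw (\<lambda>x. K m x (replicate (Suc m) 0)) (cells M m) (fibre m))"

lemma ntriv_factor:
  assumes Q: "ntriv 1 h Q" and K: "ihtpy K" and h: "\<tau> 1 (K 1 (unit M) [0, 1]) = h"
  shows "\<exists>F. id_htpy M F \<and> (\<forall>m y \<alpha>. y \<in> cells M m \<longrightarrow> \<alpha> \<in> mono_maps m 1 \<longrightarrow> K m y \<alpha> = Q m (F m y \<alpha>) \<alpha>) \<and>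
    (strong_ihtpy K \<longrightarrow> (\<forall>m. bij_betw (\<lambda>x. F m x (replicate (Suc m) 0)) (cells M m) (cells M m)))"
proof -
  note Qt = ntriv_triv[OF Q]
  have hc: "h \<in> cells H 1" using simplicial_map_cells[OF tau ihtpy_edge_cells[OF K]] h by simp
  obtain F where F: "smap2 M 1 M F" and QF: "\<And>m y \<alpha>. y \<in> cells M m \<Longrightarrow> \<alpha> \<in> mono_maps m 1 \<Longrightarrow> Q m (F m y \<alpha>) \<alpha> = K m y \<alpha>"
    using triv_lift[OF Qt ihtpy_smap2[OF K] simpM] ihtpy_tau[OF K] h by blast
  have rep: "replicate (Suc m) i \<in> mono_maps m 1" if "i \<le> 1" for i m using that by simp
  have "F m x (replicate (Suc m) 1) = x" if x: "x \<in> cells M m" for m x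
    by (rule triv_inj[OF Qt rep[OF order_refl] smap2_cells[OF F x rep[OF order_refl]] x])
      (use x QF[OF x rep[OF order_refl]] ihtpy_1[OF K x] Q in \<open>simp add: ntriv_def\<close>)
  then have "id_htpy M F" unfolding id_htpy_def using F by blast
  moreover have "bij_betw (\<lambda>x. F m x (replicate (Suc m) 0)) (cells M m) (cells M m)" if "strong_ihtpy K" for m
  proof -
    let ?rep = "replicate (Suc m) (0::nat)"
    have q: "bij_betw (\<lambda>x. Q m x ?rep) (cells M m) (fibre m)"
      by (rule triv_at_fibre[OF hc Qt]) simp
    have "bij_betw (\<lambda>x. K m x ?rep) (cells M m) (fibre m)" using that by (simp add: strong_ihtpy_def)
    then have "bij_betw ((\<lambda>x. Q m x ?rep) \<circ> (\<lambda>x. F m x ?rep)) (cells M m) (fibre m)"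
      by (subst bij_betw_cong[of _ _ "\<lambda>x. K m x ?rep"]) (use QF rep in auto)
    then show ?thesis
      using bij_betw_comp_iff2[OF q, of "\<lambda>x. F m x ?rep" "cells M m"] smap2_cells[OF F _ rep[of 0]] by auto
  qed
  ultimately show ?thesis using QF by metis
qed

lemma ntriv_NN_iff:
  assumes h: "h \<in> cells H 1" and Q: "ntriv 1 h Q" and a: "a \<in> cells M 1"
  shows "defines_htpy M E \<iota> (Q 1 a [0, 1]) \<longleftrightarrow> a \<in> NN M"
proof
  note Qt = ntriv_triv[OF Q]
  assume "defines_htpy M E \<iota> (Q 1 a [0, 1])"
  then obtain K where K: "ihtpy K" "K 1 (unit M) [0, 1] = Q 1 a [0, 1]" unfolding defines_htpy_iff by blast
  have "\<tau> 1 (Q 1 a [0, 1]) = h" using triv_tau[OF Qt _ a, of "[0, 1]"] h by (simp add: edge_id[OF simpH])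
  then obtain F where F: "id_htpy M F" "\<And>m y \<alpha>. y \<in> cells M m \<Longrightarrow> \<alpha> \<in> mono_maps m 1 \<Longrightarrow> K m y \<alpha> = Q m (F m y \<alpha>) \<alpha>"
    using ntriv_factor[OF Q K(1)] K(2) by metis
  have "F 1 (unit M) [0, 1] = a"
    by (rule triv_inj[OF Qt, of "[0, 1]" 1])
      (use K(2) F(2)[OF unit_cells[OF pmM], of "[0, 1]"] a smap2_cells[of M 1 M F, OF _ unit_cells[OF pmM]] F(1) in \<open>auto simp: id_htpy_def\<close>)
  with F(1) show "a \<in> NN M" unfolding NN_iff[OF pmM] by blast
next
  note Qt = ntriv_triv[OF Q]
  assume "a \<in> NN M"
  then obtain F where F: "id_htpy M F" "F 1 (unit M) [0, 1] = a" unfolding NN_iff[OF pmM] by blast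
  have "ihtpy (\<lambda>m x \<alpha>. Q m (F m x \<alpha>) \<alpha>)"
    unfolding ihtpy_def using smap2_comp[OF _ triv_smap2[OF Qt]] F(1) Q by (auto simp: id_htpy_def ntriv_def)
  then show "defines_htpy M E \<iota> (Q 1 a [0, 1])"
    unfolding defines_htpy_iff using F(2) by (intro exI[of _ "\<lambda>m x \<alpha>. Q m (F m x \<alpha>) \<alpha>"]) simp
qed

lemma ntriv_NNs:
  assumes h: "h \<in> cells H 1" and Q: "ntriv 1 h Q" and a: "a \<in> cells M 1"
    and K: "strong_ihtpy K" "K 1 (unit M) [0, 1] = Q 1 a [0, 1]"
  shows "a \<in> NNs M"
proof -
  note Qt = ntriv_triv[OF Q]
  have Ki: "ihtpy K" using K by (simp add: strong_ihtpy_def)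
  have "\<tau> 1 (Q 1 a [0, 1]) = h" using triv_tau[OF Qt _ a, of "[0, 1]"] h by (simp add: edge_id[OF simpH])
  then obtain F where F: "id_htpy M F" "\<And>m y \<alpha>. y \<in> cells M m \<Longrightarrow> \<alpha> \<in> mono_maps m 1 \<Longrightarrow> K m y \<alpha> = Q m (F m y \<alpha>) \<alpha>"
    "\<And>m. bij_betw (\<lambda>x. F m x (replicate (Suc m) 0)) (cells M m) (cells M m)"
    using ntriv_factor[OF Q Ki] K by metis
  have "F 1 (unit M) [0, 1] = a"
    by (rule triv_inj[OF Qt, of "[0, 1]" 1])
      (use K(2) F(2)[OF unit_cells[OF pmM], of "[0, 1]"] a smap2_cells[of M 1 M F, OF _ unit_cells[OF pmM]] F(1) in \<open>auto simp: id_htpy_def\<close>)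
  with F show ?thesis unfolding NNs_def by blast
qed

text \<open>K is a normalised trivialisation composed with a homotopy F of the identity.
  \<open>id_htpy_bij\<close> extends the bijectivity of F from the vertex 0 to all simplices of
  \<Delta>[1].\<close>

lemma strong_ihtpy_ntriv:
  assumes K: "strong_ihtpy K" and h: "\<tau> 1 (K 1 (unit M) [0, 1]) = h"
  shows "ntriv 1 h K"
proof -
  have Ki: "ihtpy K" using K by (simp add: strong_ihtpy_def)
  have hc: "h \<in> cells H 1" using simplicial_map_cells[OF tau ihtpy_edge_cells[OF Ki]] h by simp
  obtain Q where Q: "ntriv 1 h Q" using ntriv_ex[OF hc] by blast
  obtain F where F: "id_htpy M F" "\<And>m y \<alpha>. y \<in> cells M m \<Longrightarrow> \<alpha> \<in> mono_maps m 1 \<Longrightarrow> K m y \<alpha> = Q m (F m y \<alpha>) \<alpha>"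
    "\<And>m. bij_betw (\<lambda>x. F m x (replicate (Suc m) 0)) (cells M m) (cells M m)"
    using ntriv_factor[OF Q Ki h] K by metis
  have "triv 1 h (\<lambda>m x \<alpha>. Q m (F m x \<alpha>) \<alpha>)"
    by (rule triv_comp[OF ntriv_triv[OF Q]]) (use F(1) id_htpy_bij[OF pgM F(1,3)] in \<open>auto simp: id_htpy_def\<close>)
  then have "triv 1 h K" by (rule triv_cong) (rule F(2))
  then show ?thesis using Ki by (simp add: ntriv_def ihtpy_def)
qed

text \<open>As K is itself a trivialisation, z = K(a, [0, 1]) for some a. Its square over a shows
  that z is \<iota>(t(a)) times the element of K, so \<theta> = t(a) with t the automorphism at the
  vertex 0. Both \<open>NN M\<close> and \<open>NNs M\<close> are stable under
  automorphisms.\<close>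

lemma regular_iff:
  assumes K: "strong_ihtpy K" and \<theta>: "\<theta> \<in> cells M 1"
    and z: "mul E (\<iota> 1 \<theta>) (K 1 (unit M) [0, 1]) z"
  shows "defines_htpy M E \<iota> z \<longleftrightarrow> \<theta> \<in> NN M"
    and "strong_ihtpy L \<Longrightarrow> L 1 (unit M) [0, 1] = z \<Longrightarrow> \<theta> \<in> NNs M"
proof -
  define h where "h = \<tau> 1 (K 1 (unit M) [0, 1])"
  have Ki: "ihtpy K" using K by (simp add: strong_ihtpy_def)
  have hc: "h \<in> cells H 1" using simplicial_map_cells[OF tau ihtpy_edge_cells[OF Ki]] h_def by simp
  have Q: "ntriv 1 h K" by (rule strong_ihtpy_ntriv[OF K h_def[symmetric]])
  define t where "t = (\<lambda>m x. \<kappa> m (K m x (replicate (Suc m) 0)))"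
  have iso: "simplicial_iso M M t" unfolding t_def by (rule triv_at_iso[OF hc ntriv_triv[OF Q]]) simp
  then have b: "bij_betw (t 1) (cells M 1) (cells M 1)" by (simp add: simplicial_iso_def)
  define s where "s = (\<lambda>m. inv_into (cells M m) (t m))"
  have siso: "simplicial_iso M M s" unfolding s_def by (rule simplicial_iso_inv_into[OF iso simpM])
  define a where "a = s 1 \<theta>"
  have a: "a \<in> cells M 1" unfolding a_def using siso \<theta> simplicial_map_cells[of M M s \<theta> 1] by (simp add: simplicial_iso_def)
  have ta: "t 1 a = \<theta>" unfolding a_def s_def using b \<theta> by (rule bij_betw_inv_into_right)
  have "K 1 a [0, 0] = \<iota> 1 \<theta>"
    using ta iota_kappa[OF ihtpy_fibre[OF Ki a]] unfolding t_def by (simp only: replicate_2)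
  then have za: "z = K 1 a [0, 1]"
    using smap2_mul_left[OF pmE pmM ihtpy_smap2[OF Ki] a, of 0 1] z mul_fun[OF pmE] by simp
  have "a \<in> NN M \<longleftrightarrow> \<theta> \<in> NN M"
    using NN_iso[OF pmM iso, of a] NN_iso[OF pmM siso, of \<theta>] ta a_def by auto
  then show "defines_htpy M E \<iota> z \<longleftrightarrow> \<theta> \<in> NN M"
    unfolding za using ntriv_NN_iff[OF hc Q a] by simp
  assume "strong_ihtpy L" "L 1 (unit M) [0, 1] = z"
  then have "a \<in> NNs M" using ntriv_NNs[OF hc Q a] za by simp
  then show "\<theta> \<in> NNs M" using NNs_iso[OF pmM iso] ta by metis
qed

end

text \<open>\<open>twist F n k\<close> applies \<open>F i\<close>, for \<open>i < k\<close>, along the map from [n] to [1] that separates the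
  vertices up to i from the later ones. Its value at the edge (i, i + 1) over the unit is that of
  \<open>F i\<close>, because the other factors are constant there, and it is the identity at the vertex n.\<close>

primrec twist :: "(nat \<Rightarrow> nat \<Rightarrow> 'a \<Rightarrow> nat list \<Rightarrow> 'a) \<Rightarrow> nat \<Rightarrow> nat \<Rightarrow> nat \<Rightarrow> 'a \<Rightarrow> nat list \<Rightarrow> 'a" where
  "twist F n 0 m x \<alpha> = x"
| "twist F n (Suc k) m x \<alpha> = twist F n k m (F k m x (map ((!) (step (Suc k) n)) \<alpha>)) \<alpha>"

lemma twist_smap2:
  assumes "\<And>i. i < k \<Longrightarrow> smap2 M 1 M (F i)"
  shows "smap2 M n M (twist F n k)"
  using assms
proof (induction k)
  case 0
  then show ?case by (simp add: smap2_def)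
next
  case (Suc k)
  have "smap2 M n M (\<lambda>m x \<alpha>. F k m x (map ((!) (step (Suc k) n)) \<alpha>))"
    by (rule smap2_restrict[OF Suc.prems step_mono]) simp
  from smap2_comp[OF this Suc.IH] Suc.prems show ?case by simp
qed

lemma map_step_const:
  assumes "\<alpha> \<in> mono_maps m n" "\<And>i. i \<le> m \<Longrightarrow> k \<le> \<alpha> ! i"
  shows "map ((!) (step k n)) \<alpha> = replicate (Suc m) 1"
proof (rule nth_equalityI)
  fix i assume "i < length (map ((!) (step k n)) \<alpha>)"
  then have i: "i \<le> m" using assms(1) by (simp add: mono_maps_length less_Suc_eq_le)
  then show "map ((!) (step k n)) \<alpha> ! i = replicate (Suc m) 1 ! i"
    using assms(1) assms(2)[OF i] mono_maps_nth_le[OF assms(1) i]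
    by (simp add: mono_maps_length step_nth nth_replicate)
qed (use assms in \<open>simp add: mono_maps_length\<close>)

lemma twist_fixed:
  assumes F: "\<And>i. i < k \<Longrightarrow> id_htpy M (F i)" and a: "\<alpha> \<in> mono_maps m n" "\<And>i. i \<le> m \<Longrightarrow> k \<le> \<alpha> ! i"
    and x: "x \<in> cells M m"
  shows "twist F n k m x \<alpha> = x"
  using F a(2)
proof (induction k)
  case (Suc k)
  have "map ((!) (step (Suc k) n)) \<alpha> = replicate (Suc m) 1"
    by (rule map_step_const[OF a(1) Suc.prems(2)])
  then have "F k m x (map ((!) (step (Suc k) n)) \<alpha>) = x"
    using Suc.prems(1)[of k] x by (simp add: id_htpy_def)
  moreover have "k \<le> \<alpha> ! i" if "i \<le> m" for i using Suc.prems(2)[OF that] by simp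
  ultimately show ?case using Suc.IH Suc.prems(1) by simp
qed simp

lemma twist_unit:
  assumes M: "partial_monoid M" and F: "\<And>i. i < k \<Longrightarrow> id_htpy M (F i)" and i: "i < k" and k: "k \<le> n"
  shows "twist F n k 1 (unit M) [i, Suc i] = F i 1 (unit M) [0, 1]"
  using F i k
proof (induction k)
  case (Suc k)
  have Fs: "smap2 M 1 M (F j)" if "j \<le> k" for j using Suc.prems(1)[of j] that by (simp add: id_htpy_def)
  show ?case
  proof (cases "i = k")
    case True
    have s: "map ((!) (step (Suc k) n)) [i, Suc i] = [0, 1]" using True Suc.prems by (simp add: step_nth)
    have c: "F k 1 (unit M) [0, 1] \<in> cells M 1" by (rule smap2_cells[OF Fs unit_cells[OF M]]) auto
    have "twist F n k 1 (F k 1 (unit M) [0, 1]) [i, Suc i] = F k 1 (unit M) [0, 1]"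
      by (rule twist_fixed[OF _ _ _ c]) (use True Suc.prems in \<open>auto simp: nth_Cons'\<close>)
    then show ?thesis using s True by simp
  next
    case False
    then have s: "map ((!) (step (Suc k) n)) [i, Suc i] = [0, 0]" using Suc.prems by (simp add: step_nth)
    have "F k 1 (unit M) [0, 0] = unit M" by (rule smap2_unit[OF M M Fs]) auto
    then show ?thesis using s False Suc by simp
  qed
qed simp

lemma twist_bij:
  assumes M: "partial_group M" and F: "\<And>i. i < k \<Longrightarrow> id_htpy M (F i)"
    and b: "\<And>i n. i < k \<Longrightarrow> bij_betw (\<lambda>x. F i n x (replicate (Suc n) 0)) (cells M n) (cells M n)"
    and a: "\<alpha> \<in> mono_maps m n"
  shows "bij_betw (\<lambda>x. twist F n k m x \<alpha>) (cells M m) (cells M m)"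
  using F b
proof (induction k)
  case (Suc k)
  have "bij_betw (\<lambda>x. F k m x (map ((!) (step (Suc k) n)) \<alpha>)) (cells M m) (cells M m)"
    by (rule id_htpy_bij[OF M Suc.prems(1,2) comp_in_mono_maps[OF step_mono a]]) auto
  from bij_betw_trans[OF this Suc.IH] Suc.prems show ?case by (simp add: comp_def)
qed (simp add: bij_betw_def)

context partial_group_extension
begin

lemma ntriv_n: "ntriv n c Q \<Longrightarrow> x \<in> cells M m \<Longrightarrow> Q m x (replicate (Suc m) n) = \<iota> m x"
  by (simp add: ntriv_def)

text \<open>The restriction of Q to an edge need not be \<iota> at the end of that edge. It is
  normalised there first, which changes a by an automorphism of M only.\<close>

lemma triv_edge_NN:
  assumes c: "c \<in> cells H n" and Q: "triv n c Q" and i: "i < n" and a: "a \<in> cells M 1"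
    and K: "ihtpy K" "K 1 (unit M) [0, 1] = Q 1 a [i, Suc i]"
  shows "a \<in> NN M" and "strong_ihtpy K \<Longrightarrow> a \<in> NNs M"
proof -
  have g: "[i, Suc i] \<in> mono_maps 1 n" using i by simp
  let ?h = "edge H n i (Suc i) c"
  have hc: "?h \<in> cells H 1" using i by (simp add: edge_cells[OF simpH c])
  let ?R = "\<lambda>m y \<alpha>. Q m y (map ((!) [i, Suc i]) \<alpha>)"
  have R: "triv 1 ?h ?R" by (rule triv_restrict[OF c Q g])
  define q where "q = (\<lambda>m x. \<kappa> m (?R m x (replicate (Suc m) 1)))"
  have iso: "simplicial_iso M M q" unfolding q_def by (rule triv_at_iso[OF hc R]) simp
  then have qb: "bij_betw (q 1) (cells M 1) (cells M 1)" and qm: "simplicial_map M M q" by (auto simp: simplicial_iso_def)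
  define p where "p = (\<lambda>m. inv_into (cells M m) (q m))"
  have piso: "simplicial_iso M M p" unfolding p_def by (rule simplicial_iso_inv_into[OF iso simpM])
  define R' where "R' = (\<lambda>m x \<alpha>. ?R m (p m x) \<alpha>)"
  have R': "ntriv 1 ?h R'"
    unfolding ntriv_def R'_def p_def q_def using triv_normalise[OF hc R, of 1] by blast
  define b where "b = q 1 a"
  have bc: "b \<in> cells M 1" unfolding b_def by (rule simplicial_map_cells[OF qm a])
  have pb: "p 1 b = a" unfolding p_def b_def by (rule bij_betw_inv_into_left[OF qb a])
  have e: "R' 1 b [0, 1] = Q 1 a [i, Suc i]" unfolding R'_def pb by simp
  have "defines_htpy M E \<iota> (R' 1 b [0, 1])" unfolding defines_htpy_iff e using K by blast
  then have "b \<in> NN M" using ntriv_NN_iff[OF hc R' bc] by simp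
  then show "a \<in> NN M" using NN_iso[OF pmM piso, of b] pb by simp
  assume "strong_ihtpy K"
  then have "b \<in> NNs M" using ntriv_NNs[OF hc R' bc] K(2) e by simp
  then show "a \<in> NNs M" using NNs_iso[OF pmM piso, of b] pb by simp
qed

text \<open>Let a be the coordinate of e in some normalised trivialisation over \<tau>(e). By
  \<open>triv_edge_NN\<close> the spine of a consists of elements of homotopies of the identity, and
  composing the trivialisation with their \<open>twist\<close> gives e the unit cell as its
  coordinate. Strength of the homotopies enters only into bijectivity of the composite, so the
  remaining claims can serve to prove it for a section.\<close>

lemma ihtpy_simplex:
  assumes e: "e \<in> cells E n"
    and Z: "\<And>i. i < n \<Longrightarrow> ihtpy (Z i)" "\<And>i. i < n \<Longrightarrow> Z i 1 (unit M) [0, 1] = edge E n i (Suc i) e"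
  shows "\<exists>Q. smap2 M n E Q \<and> (\<forall>m. \<forall>x \<in> cells M m. Q m x (replicate (Suc m) n) = \<iota> m x) \<and>
    Q n (vertex_cell M n) [0..<Suc n] = e \<and>
    (\<forall>m x \<alpha>. x \<in> cells M m \<longrightarrow> \<alpha> \<in> mono_maps m n \<longrightarrow> \<tau> m (Q m x \<alpha>) = act H n \<alpha> (\<tau> n e)) \<and>
    ((\<forall>i<n. strong_ihtpy (Z i)) \<longrightarrow> ntriv n (\<tau> n e) Q)"
proof -
  have c: "\<tau> n e \<in> cells H n" by (rule simplicial_map_cells[OF tau e])
  obtain Q where Q: "ntriv n (\<tau> n e) Q" using ntriv_ex[OF c] by blast
  note Qt = ntriv_triv[OF Q]
  obtain a where a: "a \<in> cells M n" and Qa: "Q n a [0..<Suc n] = e" using triv_surj_id[OF e Qt] by blast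
  have ai: "edge M n i (Suc i) a \<in> cells M 1" if "i < n" for i
    by (rule edge_cells[OF simpM a]) (use that in auto)
  have Zi: "Z i 1 (unit M) [0, 1] = Q 1 (edge M n i (Suc i) a) [i, Suc i]" if "i < n" for i
    using smap2_edge[OF triv_smap2[OF Qt] a id_in_mono_maps, of i "Suc i"] Z(2)[OF that] Qa that by simp
  have "\<exists>F. id_htpy M F \<and> F 1 (unit M) [0, 1] = edge M n i (Suc i) a \<and> (strong_ihtpy (Z i) \<longrightarrow>
      (\<forall>m. bij_betw (\<lambda>x. F m x (replicate (Suc m) 0)) (cells M m) (cells M m)))" if i: "i < n" for i
    using triv_edge_NN[OF c Qt i ai[OF i] Z(1)[OF i] Zi[OF i]]
    by (cases "strong_ihtpy (Z i)") (auto simp: NN_iff[OF pmM] NNs_def)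
  then obtain F where F: "\<And>i. i < n \<Longrightarrow> id_htpy M (F i)" and
    Fa: "\<And>i. i < n \<Longrightarrow> F i 1 (unit M) [0, 1] = edge M n i (Suc i) a" and
    Fb: "\<And>i m. i < n \<Longrightarrow> strong_ihtpy (Z i) \<Longrightarrow> bij_betw (\<lambda>x. F i m x (replicate (Suc m) 0)) (cells M m) (cells M m)"
    by metis
  have Fs: "smap2 M n M (twist F n n)" by (rule twist_smap2) (use F in \<open>simp add: id_htpy_def\<close>)
  let ?Q = "\<lambda>m x \<alpha>. Q m (twist F n n m x \<alpha>) \<alpha>"
  have 1: "smap2 M n E ?Q" by (rule smap2_comp[OF Fs triv_smap2[OF Qt]])
  have 2: "?Q m x (replicate (Suc m) n) = \<iota> m x" if x: "x \<in> cells M m" for m x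
  proof -
    have "twist F n n m x (replicate (Suc m) n) = x"
      by (rule twist_fixed[OF F _ _ x]) (auto simp: nth_replicate)
    then show ?thesis using ntriv_n[OF Q x] by simp
  qed
  have "twist F n n n (vertex_cell M n) [0..<Suc n] = a"
  proof (rule pm_eqI[OF pmM smap2_cells[OF Fs vertex_cell_cells[OF pmM] id_in_mono_maps] a])
    fix i assume i: "i < n"
    show "edge M n i (Suc i) (twist F n n n (vertex_cell M n) [0..<Suc n]) = edge M n i (Suc i) a"
      using i smap2_edge[OF Fs vertex_cell_cells[OF pmM] id_in_mono_maps, of i "Suc i"] edge_vertex_cell[OF pmM, of i "Suc i" n]
        twist_unit[OF pmM F i order_refl] Fa[OF i] by simp
  qed
  then have 3: "?Q n (vertex_cell M n) [0..<Suc n] = e" using Qa by simp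
  have 4: "\<tau> m (?Q m x \<alpha>) = act H n \<alpha> (\<tau> n e)" if "x \<in> cells M m" "\<alpha> \<in> mono_maps m n" for m x \<alpha>
    by (rule triv_tau[OF Qt that(2) smap2_cells[OF Fs that]])
  have 5: "ntriv n (\<tau> n e) ?Q" if "\<forall>i<n. strong_ihtpy (Z i)"
  proof -
    have "triv n (\<tau> n e) ?Q"
      by (rule triv_comp[OF Qt Fs]) (rule twist_bij[OF pgM F Fb], use that in auto)
    then show ?thesis unfolding ntriv_def using 2 by blast
  qed
  show ?thesis
    by (rule exI[of _ ?Q]) (use 1 2 3 4 5 in blast)
qed

end

section \<open>Regular sections\<close>

locale regular_section_of_extension = partial_group_extension M \<iota> E \<tau> H
  for M :: "'a sset" and \<iota> :: "nat \<Rightarrow> 'a \<Rightarrow> 'e" and E :: "'e sset" and \<tau> :: "nat \<Rightarrow> 'e \<Rightarrow> 'h" and H :: "'h sset" +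
  fixes \<sigma> :: "nat \<Rightarrow> 'h \<Rightarrow> 'e"
  assumes sec: "\<sigma> \<in> sections E \<tau> H" and reg: "regular_section M \<iota> E H \<sigma>"
begin

lemma sigma: "simplicial_map H E \<sigma>" and tau_sigma: "c \<in> cells H n \<Longrightarrow> \<tau> n (\<sigma> n c) = c"
  using sec by (auto simp: sections_def Hom_def)

lemma sigma_cells: "c \<in> cells H n \<Longrightarrow> \<sigma> n c \<in> cells E n"
  by (rule simplicial_map_cells[OF sigma])

lemma sigma_unit: "\<sigma> 1 (unit H) = unit E"
  by (rule simplicial_map_unit[OF pmH pmE sigma])

lemma sigma_defines:
  assumes h: "h \<in> cells H 1"
  shows "defines_htpy M E \<iota> (\<sigma> 1 h)"
proof -
  have "\<sigma> 1 h \<in> normalizer_cells M \<iota> E 1" using reg h by (simp add: regular_section_def)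
  moreover have "spine E 1 (\<sigma> 1 h) = [\<sigma> 1 h]" using edge_id[OF simpE sigma_cells[OF h]] by (simp add: spine_def)
  ultimately show ?thesis by (simp add: normalizer_cells_def)
qed

section \<open>Conjugation by a regular section\<close>

definition conj_htpy :: "'h \<Rightarrow> nat \<Rightarrow> 'a \<Rightarrow> nat list \<Rightarrow> 'e" where
  "conj_htpy h = (SOME K. ihtpy K \<and> K 1 (unit M) [0, 1] = \<sigma> 1 h)"

lemma conj_htpy: assumes "h \<in> cells H 1" shows "ihtpy (conj_htpy h)" and "conj_htpy h 1 (unit M) [0, 1] = \<sigma> 1 h"
proof -
  have "\<exists>K. ihtpy K \<and> K 1 (unit M) [0, 1] = \<sigma> 1 h" using sigma_defines[OF assms] by (simp only: defines_htpy_iff)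
  from someI_ex[OF this] show "ihtpy (conj_htpy h)" and "conj_htpy h 1 (unit M) [0, 1] = \<sigma> 1 h" by (auto simp: conj_htpy_def)
qed

definition conj_by :: "'h \<Rightarrow> nat \<Rightarrow> 'a \<Rightarrow> 'a" where
  "conj_by h n = (\<lambda>x \<in> cells M n. \<kappa> n (conj_htpy h n x (replicate (Suc n) 0)))"

lemma conj_htpy_0: "h \<in> cells H 1 \<Longrightarrow> x \<in> cells M n \<Longrightarrow> conj_htpy h n x (replicate (Suc n) 0) = \<iota> n (conj_by h n x)"
  by (simp add: conj_by_def iota_kappa ihtpy_fibre conj_htpy)

lemma conj_map:
  assumes h: "h \<in> cells H 1"
  shows "simplicial_map M M (conj_by h)"
proof (rule simplicial_map_cong[OF _ simpM])
  show "simplicial_map M M (\<lambda>n x. \<kappa> n (conj_htpy h n x (replicate (Suc n) 0)))"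
    by (rule kappa_map[OF smap2_at[OF ihtpy_smap2[OF conj_htpy(1)[OF h]]] _ simpM])
      (use ihtpy_fibre[OF conj_htpy(1)[OF h]] in auto)
qed (simp add: conj_by_def)

lemma conj_cells: "h \<in> cells H 1 \<Longrightarrow> x \<in> cells M n \<Longrightarrow> conj_by h n x \<in> cells M n"
  by (rule simplicial_map_cells[OF conj_map])

lemma conj_unit:
  assumes x: "x \<in> cells M n"
  shows "conj_by (unit H) n x = x"
proof -
  have u: "unit H \<in> cells H 1" by (rule unit_cells[OF pmH])
  have L: "ihtpy (\<lambda>m x \<alpha>. \<iota> m x)" unfolding ihtpy_def using smap2_const[OF iota] by blast
  have rep: "replicate (Suc n) 0 \<in> mono_maps n 1" by simp
  have "conj_htpy (unit H) 1 (unit M) [0, 1] = \<iota> 1 (unit M)"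
    using conj_htpy(2)[OF u] sigma_unit simplicial_map_unit[OF pmM pmE iota] by simp
  from ihtpy_unique[OF conj_htpy(1)[OF u] L this x rep] have "conj_htpy (unit H) n x (replicate (Suc n) 0) = \<iota> n x" .
  then show ?thesis using conj_htpy_0[OF u x] iota_inj[OF conj_cells[OF u x] x] by simp
qed

text \<open>Restricted to the edge from i to n, Q is a homotopy of \<iota> with element
  \<open>\<sigma>(c\<^sub>i\<^sub>n)\<close>, hence the one that defines conjugation by
  \<open>c\<^sub>i\<^sub>n\<close>.\<close>

lemma section_simplex_at:
  assumes c: "c \<in> cells H n" and Q: "smap2 M n E Q"
    and Qn: "\<And>m x. x \<in> cells M m \<Longrightarrow> Q m x (replicate (Suc m) n) = \<iota> m x"
    and Qc: "Q n (vertex_cell M n) [0..<Suc n] = \<sigma> n c"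
  shows "i \<le> j \<Longrightarrow> j \<le> n \<Longrightarrow> Q 1 (unit M) [i, j] = \<sigma> 1 (edge H n i j c)"
    and "i \<le> n \<Longrightarrow> x \<in> cells M m \<Longrightarrow> Q m x (replicate (Suc m) i) = \<iota> m (conj_by (edge H n i n c) m x)"
proof -
  show 1: "Q 1 (unit M) [i, j] = \<sigma> 1 (edge H n i j c)" if "i \<le> j" "j \<le> n" for i j
    using smap2_edge[OF Q vertex_cell_cells[OF pmM] id_in_mono_maps that] Qc that edge_vertex_cell[OF pmM that]
      simplicial_map_edge[OF sigma c that] by simp
  assume i: "i \<le> n" and x: "x \<in> cells M m"
  let ?h = "edge H n i n c"
  have h: "?h \<in> cells H 1" using i by (simp add: edge_cells[OF simpH c])
  have g: "[i, n] \<in> mono_maps 1 n" using i by simp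
  let ?L = "\<lambda>m x \<alpha>. Q m x (map ((!) [i, n]) \<alpha>)"
  have L: "ihtpy ?L"
    unfolding ihtpy_def using smap2_restrict[OF Q g] Qn by simp
  have "?L m x (replicate (Suc m) 0) = conj_htpy ?h m x (replicate (Suc m) 0)"
    by (rule ihtpy_unique[OF L conj_htpy(1)[OF h] _ x]) (use 1[OF i order_refl] conj_htpy(2)[OF h] in auto)
  then show "Q m x (replicate (Suc m) i) = \<iota> m (conj_by ?h m x)"
    using conj_htpy_0[OF h x] by simp
qed

lemma section_simplex:
  assumes c: "c \<in> cells H n"
  shows "\<exists>Q. smap2 M n E Q \<and> (\<forall>m. \<forall>x \<in> cells M m. Q m x (replicate (Suc m) n) = \<iota> m x) \<and>
    Q n (vertex_cell M n) [0..<Suc n] = \<sigma> n c \<and>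
    (\<forall>m x \<alpha>. x \<in> cells M m \<longrightarrow> \<alpha> \<in> mono_maps m n \<longrightarrow> \<tau> m (Q m x \<alpha>) = act H n \<alpha> c) \<and>
    ((\<forall>h \<in> cells H 1. strong_ihtpy (conj_htpy h)) \<longrightarrow> ntriv n c Q)"
proof -
  have h: "edge H n i (Suc i) c \<in> cells H 1" if "i < n" for i using that by (simp add: edge_cells[OF simpH c])
  obtain Q where "smap2 M n E Q" "\<forall>m. \<forall>x \<in> cells M m. Q m x (replicate (Suc m) n) = \<iota> m x"
    "Q n (vertex_cell M n) [0..<Suc n] = \<sigma> n c"
    "\<forall>m x \<alpha>. x \<in> cells M m \<longrightarrow> \<alpha> \<in> mono_maps m n \<longrightarrow> \<tau> m (Q m x \<alpha>) = act H n \<alpha> (\<tau> n (\<sigma> n c))"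
    "(\<forall>i<n. strong_ihtpy (conj_htpy (edge H n i (Suc i) c))) \<longrightarrow> ntriv n (\<tau> n (\<sigma> n c)) Q"
    using ihtpy_simplex[OF sigma_cells[OF c], of "\<lambda>i. conj_htpy (edge H n i (Suc i) c)"] conj_htpy(1)[OF h] conj_htpy(2)[OF h]
      simplicial_map_edge[OF sigma c] by auto
  then show ?thesis using tau_sigma[OF c] h by (intro exI[of _ Q]) auto
qed

lemma conj_mul:
  assumes m: "mul H g h k" and x: "x \<in> cells M n"
  shows "conj_by k n x = conj_by g n (conj_by h n x)"
proof -
  obtain c where c: "c \<in> cells H 2" and e: "edge H 2 0 1 c = g" "edge H 2 1 2 c = h" "edge H 2 0 2 c = k"
    using m unfolding mul_def by blast
  have gc: "g \<in> cells H 1" and hc: "h \<in> cells H 1" and kc: "k \<in> cells H 1"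
    using mul_cells[OF simpH m] by auto
  obtain Q where Q: "smap2 M 2 E Q" and Q2: "\<And>m x. x \<in> cells M m \<Longrightarrow> Q m x (replicate (Suc m) 2) = \<iota> m x"
    and Qc: "Q 2 (vertex_cell M 2) [0..<Suc 2] = \<sigma> 2 c"
    and Qt: "\<And>m x \<alpha>. x \<in> cells M m \<Longrightarrow> \<alpha> \<in> mono_maps m 2 \<Longrightarrow> \<tau> m (Q m x \<alpha>) = act H 2 \<alpha> c"
    using section_simplex[OF c] by blast
  note at = section_simplex_at[OF c Q Q2 Qc]
  have Q1: "Q m x (replicate (Suc m) 1) = \<iota> m (conj_by h m x)" if "x \<in> cells M m" for m x
    using at(2)[of 1 x m] that e by simp
  have d: "[0, 1] \<in> mono_maps 1 2" by simp
  let ?L = "\<lambda>m x \<alpha>. Q m x (map ((!) [0, 1]) \<alpha>)"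
  let ?L' = "\<lambda>m x \<alpha>. conj_htpy g m (conj_by h m x) \<alpha>"
  have "?L n x (replicate (Suc n) 0) = ?L' n x (replicate (Suc n) 0)"
  proof (rule unique_over[OF gc smap2_restrict[OF Q d] smap2_pre[OF ihtpy_smap2[OF conj_htpy(1)[OF gc]] conj_map[OF hc]] _ _ _ _ x])
    fix m y \<alpha> assume y: "y \<in> cells M m" and a: "\<alpha> \<in> mono_maps m 1"
    show "\<tau> m (Q m y (map ((!) [0, 1]) \<alpha>)) = act H 1 \<alpha> g"
      using Qt[OF y comp_in_mono_maps[OF d a]] act_act[OF simpH d a c] e by simp
    show "\<tau> m (conj_htpy g m (conj_by h m y) \<alpha>) = act H 1 \<alpha> g"
      using ihtpy_tau[OF conj_htpy(1)[OF gc] conj_cells[OF hc y] a] conj_htpy(2)[OF gc] tau_sigma[OF gc] by simp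
  next
    show "Q 1 y (map ((!) [0, 1]) [1, 1]) = conj_htpy g 1 (conj_by h 1 y) [1, 1]" if "y \<in> cells M 1" for y
      using Q1[OF that] ihtpy_11[OF conj_htpy(1)[OF gc] conj_cells[OF hc that]] unfolding replicate_2 by simp
    show "Q 1 (unit M) (map ((!) [0, 1]) [0, 1]) = conj_htpy g 1 (conj_by h 1 (unit M)) [0, 1]"
      using at(1)[of 0 1] e conj_htpy(2)[OF gc] simplicial_map_unit[OF pmM pmM conj_map[OF hc]] by simp
  qed simp
  then have "\<iota> n (conj_by k n x) = \<iota> n (conj_by g n (conj_by h n x))"
    using at(2)[of 0 x n] x e conj_htpy_0[OF gc conj_cells[OF hc x]] by simp
  then show ?thesis by (rule iota_inj[rotated 2]) (use x conj_cells gc hc kc in auto)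
qed

lemma conj_inv1:
  assumes h: "h \<in> cells H 1" and x: "x \<in> cells M n"
  shows "conj_by h n (conj_by (inv1 H h) n x) = x" and "conj_by (inv1 H h) n (conj_by h n x) = x"
  using conj_mul[OF mul_inv1[OF pgH h] x] conj_mul[OF inv1_mul[OF pgH h] x] conj_unit[OF x] by auto

lemma conj_bij: assumes "h \<in> cells H 1" shows "bij_betw (conj_by h n) (cells M n) (cells M n)"
  by (rule bij_betw_byWitness[where f' = "conj_by (inv1 H h) n"])
    (use assms conj_inv1 conj_cells inv1_cells[OF pgH] in auto)

lemma conj_inj: "h \<in> cells H 1 \<Longrightarrow> x \<in> cells M n \<Longrightarrow> y \<in> cells M n \<Longrightarrow> conj_by h n x = conj_by h n y \<Longrightarrow> x = y"
  using conj_inv1(2) by metis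

lemma conj_iso: "h \<in> cells H 1 \<Longrightarrow> simplicial_iso M M (conj_by h)"
  unfolding simplicial_iso_def using conj_map conj_bij by blast

text \<open>Conjugation by the inverse element of H provides the inverse, since the section is
  defined and regular there as well.\<close>

lemma conj_htpy_strong:
  assumes h: "h \<in> cells H 1"
  shows "strong_ihtpy (conj_htpy h)"
  unfolding strong_ihtpy_def
proof (intro conjI allI)
  fix m
  have i: "bij_betw (\<iota> m) (cells M m) (fibre m)" unfolding fibre_def by (rule iota_bij)
  show "bij_betw (\<lambda>x. conj_htpy h m x (replicate (Suc m) 0)) (cells M m) (fibre m)"
    using bij_betw_trans[OF conj_bij[OF h] i] by (subst bij_betw_cong[of _ _ "\<iota> m \<circ> conj_by h m"]) (auto simp: conj_htpy_0 h)
qed (rule conj_htpy(1)[OF h])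

section \<open>Trivialisations through the section, and coordinates on E\<close>

definition section_triv :: "nat \<Rightarrow> 'h \<Rightarrow> nat \<Rightarrow> 'a \<Rightarrow> nat list \<Rightarrow> 'e" where
  "section_triv n c = (SOME Q. ntriv n c Q \<and> Q n (vertex_cell M n) [0..<Suc n] = \<sigma> n c)"

lemma section_triv:
  assumes c: "c \<in> cells H n"
  shows "ntriv n c (section_triv n c)" and "section_triv n c n (vertex_cell M n) [0..<Suc n] = \<sigma> n c"
proof -
  have "\<exists>Q. ntriv n c Q \<and> Q n (vertex_cell M n) [0..<Suc n] = \<sigma> n c"
    using section_simplex[OF c] conj_htpy_strong by blast
  from someI_ex[OF this] show "ntriv n c (section_triv n c)" and "section_triv n c n (vertex_cell M n) [0..<Suc n] = \<sigma> n c"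
    unfolding section_triv_def by auto
qed

text \<open>\<open>pair n x c\<close> is the simplex with edges \<open>x\<^sub>i\<^sub>j \<sigma>(c\<^sub>i\<^sub>j)\<close>, except that \<open>x\<^sub>i\<^sub>j\<close> is first moved
  from the vertex 0 to the vertex i by the inverse of \<open>conj_by(c\<^sub>0\<^sub>i)\<close>. These are the coordinates of E
  as a semidirect product.\<close>

definition pair :: "nat \<Rightarrow> 'a \<Rightarrow> 'h \<Rightarrow> 'e" where
  "pair n x c = section_triv n c n (conj_by (inv1 H (edge H n 0 n c)) n x) [0..<Suc n]"

lemma edge_cells_H: "c \<in> cells H n \<Longrightarrow> i \<le> j \<Longrightarrow> j \<le> n \<Longrightarrow> edge H n i j c \<in> cells H 1"
  by (rule edge_cells[OF simpH])

lemma edge_cells_M: "x \<in> cells M n \<Longrightarrow> i \<le> j \<Longrightarrow> j \<le> n \<Longrightarrow> edge M n i j x \<in> cells M 1"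
  by (rule edge_cells[OF simpM])

lemma conj_edges: "c \<in> cells H n \<Longrightarrow> i \<le> j \<Longrightarrow> j \<le> k \<Longrightarrow> k \<le> n \<Longrightarrow> x \<in> cells M m \<Longrightarrow>
  conj_by (edge H n i j c) m (conj_by (edge H n j k c) m x) = conj_by (edge H n i k c) m x"
  using conj_mul[OF mul_edges[OF simpH]] by simp

lemma conj_surj: "h \<in> cells H 1 \<Longrightarrow> x \<in> cells M n \<Longrightarrow> \<exists>y \<in> cells M n. conj_by h n y = x"
  using conj_inv1(1) conj_cells inv1_cells[OF pgH] by blast

lemma pair_bij:
  assumes c: "c \<in> cells H n"
  shows "bij_betw (\<lambda>x. pair n x c) (cells M n) {e \<in> cells E n. \<tau> n e = c}"
proof -
  have "bij_betw (conj_by (inv1 H (edge H n 0 n c)) n) (cells M n) (cells M n)"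
    by (rule conj_bij[OF inv1_cells[OF pgH edge_cells_H[OF c]]]) auto
  moreover have "bij_betw (\<lambda>x. section_triv n c n x [0..<Suc n]) (cells M n) {e \<in> cells E n. \<tau> n e = c}"
    using triv_bij[OF ntriv_triv[OF section_triv(1)[OF c]] id_in_mono_maps] act_id[OF simpH c] by simp
  ultimately show ?thesis unfolding pair_def using bij_betw_trans by (fastforce simp: comp_def)
qed

lemma pair_cells: "c \<in> cells H n \<Longrightarrow> x \<in> cells M n \<Longrightarrow> pair n x c \<in> cells E n"
  and pair_tau: "c \<in> cells H n \<Longrightarrow> x \<in> cells M n \<Longrightarrow> \<tau> n (pair n x c) = c"
  using pair_bij[of c n] by (auto simp: bij_betw_def)

lemma pair_inj: "c \<in> cells H n \<Longrightarrow> x \<in> cells M n \<Longrightarrow> y \<in> cells M n \<Longrightarrow> pair n x c = pair n y c \<Longrightarrow> x = y"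
  using pair_bij[of c n] by (auto simp: bij_betw_def dest: inj_onD)

lemma pair_surj:
  assumes e: "e \<in> cells E n" "\<tau> n e = c"
  shows "\<exists>x \<in> cells M n. pair n x c = e"
proof -
  have "c \<in> cells H n" using simplicial_map_cells[OF tau e(1)] e(2) by simp
  then have "e \<in> (\<lambda>x. pair n x c) ` cells M n" using pair_bij[of c n] e by (simp add: bij_betw_def)
  then show ?thesis by blast
qed

lemma pair_mul_edge:
  assumes c: "c \<in> cells H n" and x: "x \<in> cells M n" and ij: "i \<le> j" "j \<le> n"
    and w: "w \<in> cells M 1" "conj_by (edge H n 0 i c) 1 w = edge M n i j x"
  shows "mul E (\<iota> 1 w) (\<sigma> 1 (edge H n i j c)) (edge E n i j (pair n x c))"
proof -
  note Q = section_triv[OF c]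
  note Qt = ntriv_triv[OF Q(1)]
  note at = section_simplex_at[OF c triv_smap2[OF Qt] ntriv_n[OF Q(1)] Q(2)]
  have h: "edge H n 0 n c \<in> cells H 1" "edge H n 0 i c \<in> cells H 1" "edge H n i n c \<in> cells H 1"
    using edge_cells_H[OF c] ij by auto
  let ?y = "conj_by (inv1 H (edge H n 0 n c)) n x"
  have yc: "?y \<in> cells M n" using conj_cells inv1_cells[OF pgH] h x by blast
  let ?z = "edge M n i j ?y"
  have zc: "?z \<in> cells M 1" using edge_cells_M[OF yc ij] .
  have ze: "?z = conj_by (inv1 H (edge H n 0 n c)) 1 (edge M n i j x)"
    using simplicial_map_edge[OF conj_map[OF inv1_cells[OF pgH h(1)]] x ij] by simp
  \<comment> \<open>In \<open>section_triv\<close> coordinates are seen from the last vertex.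
    Multiplicativity along 0, i, n shows that the one seen from i is w.\<close>
  have "conj_by (edge H n 0 i c) 1 (conj_by (edge H n i n c) 1 ?z) = conj_by (edge H n 0 i c) 1 w"
    using conj_edges[OF c, of 0 i n ?z 1] ij zc ze conj_inv1(1)[OF h(1) edge_cells_M[OF x ij]] w(2) by simp
  then have z: "conj_by (edge H n i n c) 1 ?z = w"
    by (rule conj_inj[OF h(2), rotated 2]) (use conj_cells h zc w in auto)
  have e: "edge E n i j (pair n x c) = section_triv n c 1 ?z [i, j]"
    unfolding pair_def using smap2_edge[OF triv_smap2[OF Qt] yc id_in_mono_maps ij] ij by simp
  have "section_triv n c 1 ?z [i, i] = \<iota> 1 w" using at(2)[of i ?z 1] ij zc z unfolding replicate_2 by simp
  then show ?thesis
    using smap2_mul_left[OF pmE pmM triv_smap2[OF Qt] zc ij] at(1)[of i j] ij e by simp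
qed

lemma pair_mul: "x \<in> cells M 1 \<Longrightarrow> h \<in> cells H 1 \<Longrightarrow> mul E (\<iota> 1 x) (\<sigma> 1 h) (pair 1 x h)"
  using pair_mul_edge[of h 1 x 0 1 x] edge_id[OF simpH, of h] edge_id[OF simpM, of x]
    edge_id[OF simpE pair_cells, of h x] edge_degenerate[OF pmH, of h 1 0] conj_unit by simp

lemma pair_edge:
  assumes c: "c \<in> cells H n" and x: "x \<in> cells M n" and ij: "i \<le> j" "j \<le> n"
    and w: "w \<in> cells M 1" "conj_by (edge H n 0 i c) 1 w = edge M n i j x"
  shows "edge E n i j (pair n x c) = pair 1 w (edge H n i j c)"
  using pair_mul_edge[OF assms] pair_mul[OF w(1) edge_cells_H[OF c ij]] mul_fun[OF pmE] by blast

text \<open>Injectivity of \<open>pair\<close> makes \<open>pair_edge\<close> an equivalence. In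
  this form words of M are compared with simplices of E.\<close>

lemma pair_edge_iff:
  assumes c: "c \<in> cells H n" and x: "x \<in> cells M n" and ij: "i \<le> j" "j \<le> n" and w: "w \<in> cells M 1"
  shows "edge E n i j (pair n x c) = pair 1 w (edge H n i j c) \<longleftrightarrow> edge M n i j x = conj_by (edge H n 0 i c) 1 w"
proof -
  have h: "edge H n 0 i c \<in> cells H 1" using edge_cells_H[OF c] ij by auto
  obtain y where y: "y \<in> cells M 1" "conj_by (edge H n 0 i c) 1 y = edge M n i j x"
    using conj_surj[OF h edge_cells_M[OF x ij]] by blast
  have "edge E n i j (pair n x c) = pair 1 y (edge H n i j c)" by (rule pair_edge[OF c x ij y])
  moreover have "pair 1 y (edge H n i j c) = pair 1 w (edge H n i j c) \<longleftrightarrow> y = w"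
    using pair_inj[OF edge_cells_H[OF c ij] y(1) w] by auto
  moreover have "y = w \<longleftrightarrow> edge M n i j x = conj_by (edge H n 0 i c) 1 w"
    using conj_inj[OF h y(1) w] y(2) by auto
  ultimately show ?thesis by simp
qed

text \<open>The new cell starts at the vertex \<open>\<beta> ! 0\<close>, so its coordinate is
  translated there from the vertex 0. For all degeneracies and all faces except d_0 this is no
  change.\<close>

lemma pair_act:
  assumes c: "c \<in> cells H n" and x: "x \<in> cells M n" and b: "\<beta> \<in> mono_maps m n"
    and y: "y \<in> cells M m" "conj_by (edge H n 0 (\<beta> ! 0) c) m y = act M n \<beta> x"
  shows "act E n \<beta> (pair n x c) = pair m y (act H n \<beta> c)"
proof (rule pm_eqI_edges[OF pmE act_cells[OF simpE b pair_cells[OF c x]] pair_cells[OF act_cells[OF simpH b c] y(1)]])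
  fix i j assume ij: "i \<le> j" "j \<le> m"
  have bs: "\<beta> ! i \<le> \<beta> ! j" "\<beta> ! j \<le> n" "\<beta> ! 0 \<le> \<beta> ! i" "\<beta> ! i \<le> n"
    using mono_maps_nth_mono[OF b] mono_maps_nth_le[OF b] ij by auto
  have h: "edge H n (\<beta> ! 0) (\<beta> ! i) c \<in> cells H 1" using edge_cells_H[OF c] bs by auto
  obtain w where w: "w \<in> cells M 1" "conj_by (edge H n (\<beta> ! 0) (\<beta> ! i) c) 1 w = edge M m i j y"
    using conj_surj[OF h edge_cells_M[OF y(1) ij]] by blast
  have h0: "edge H n 0 (\<beta> ! 0) c \<in> cells H 1" using edge_cells_H[OF c] bs by auto
  have "conj_by (edge H n 0 (\<beta> ! i) c) 1 w = conj_by (edge H n 0 (\<beta> ! 0) c) 1 (edge M m i j y)"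
    using conj_edges[OF c, of 0 "\<beta> ! 0" "\<beta> ! i" w 1] bs w by simp
  also have "\<dots> = edge M n (\<beta> ! i) (\<beta> ! j) x"
    using simplicial_map_edge[OF conj_map[OF h0] y(1) ij] y(2) edge_act[OF simpM b x ij] by simp
  finally have 1: "edge E n (\<beta> ! i) (\<beta> ! j) (pair n x c) = pair 1 w (edge H n (\<beta> ! i) (\<beta> ! j) c)"
    by (intro pair_edge[OF c x bs(1,2) w(1)])
  have 2: "edge E m i j (pair m y (act H n \<beta> c)) = pair 1 w (edge H m i j (act H n \<beta> c))"
    by (rule pair_edge[OF act_cells[OF simpH b c] y(1) ij w(1)])
      (use w(2) ij in \<open>simp add: edge_act[OF simpH b c]\<close>)
  show "edge E m i j (act E n \<beta> (pair n x c)) = edge E m i j (pair m y (act H n \<beta> c))"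
    using 1 2 edge_act[OF simpE b pair_cells[OF c x] ij] edge_act[OF simpH b c ij] by simp
qed

lemma pair_vertex_cell:
  assumes x: "x \<in> cells M 1"
  shows "pair 1 x (unit H) = \<iota> 1 x"
  using pair_mul[OF x unit_cells[OF pmH]] mul_unit_right[OF pmE iota_cells[OF x]] sigma_unit mul_fun[OF pmE] by auto

section \<open>The inversion of E\<close>

definition proj :: "nat \<Rightarrow> 'e \<Rightarrow> 'a" where
  "proj n e = inv_into (cells M n) (\<lambda>x. pair n x (\<tau> n e)) e"

lemma proj: assumes e: "e \<in> cells E n" shows "proj n e \<in> cells M n" and "pair n (proj n e) (\<tau> n e) = e"
proof -
  note b = pair_bij[OF simplicial_map_cells[OF tau e]]
  show "proj n e \<in> cells M n" unfolding proj_def by (rule inv_into_into) (use b e in \<open>simp add: bij_betw_def\<close>)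
  show "pair n (proj n e) (\<tau> n e) = e" unfolding proj_def using bij_betw_inv_into_right[OF b] e by simp
qed

lemma proj_pair: "c \<in> cells H n \<Longrightarrow> x \<in> cells M n \<Longrightarrow> proj n (pair n x c) = x"
  using bij_betw_inv_into_left[OF pair_bij[of c n], of x] by (simp add: proj_def pair_tau)

text \<open>In degree 1 this is (x \<sigma>(h))\<inverse> = \<sigma>(h)\<inverse> x\<inverse>, with
  the two factors exchanged by conjugation. In degree n the vertex 0 of \<nu>(c) is the vertex n of
  c, so the inverted coordinate is translated there by the inverse of
  \<open>c\<^sub>0\<^sub>n\<close>.\<close>

definition nuE :: "nat \<Rightarrow> 'e \<Rightarrow> 'e" where
  "nuE n e = pair n (conj_by (inv1 H (edge H n 0 n (\<tau> n e))) n (nu M n (proj n e))) (nu H n (\<tau> n e))"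

lemma nuE_pair: "c \<in> cells H n \<Longrightarrow> x \<in> cells M n \<Longrightarrow>
  nuE n (pair n x c) = pair n (conj_by (inv1 H (edge H n 0 n c)) n (nu M n x)) (nu H n c)"
  by (simp add: nuE_def proj_pair pair_tau)

lemma pgE: "partial_group E"
  unfolding partial_group_def
proof (intro conjI exI)
  show "partial_monoid E" by (rule pmE)
  have ih: "inv1 H (edge H n i j c) \<in> cells H 1" if "c \<in> cells H n" "i \<le> j" "j \<le> n" for c n i j
    by (rule inv1_cells[OF pgH edge_cells_H[OF that]])
  have rn: "conj_by (inv1 H (edge H n 0 n c)) n (nu M n x) \<in> cells M n" if "c \<in> cells H n" "x \<in> cells M n" for c n x
    using conj_cells[OF ih nu_cells[OF pgM]] that by simp
  show "inversion E nuE"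
  proof (rule inversionI[OF pmE])
    fix n e assume e: "e \<in> cells E n"
    note c = simplicial_map_cells[OF tau e]
    show "nuE n e \<in> cells E n"
      unfolding nuE_def by (rule pair_cells[OF nu_cells[OF pgH c] rn[OF c proj(1)[OF e]]])
  next
    fix n e i j assume e: "e \<in> cells E n" and ij: "i \<le> j" "j \<le> (n::nat)"
    note c = simplicial_map_cells[OF tau e] and x = proj(1)[OF e]
    define c x where "c = \<tau> n e" and "x = proj n e"
    have c: "c \<in> cells H n" and x: "x \<in> cells M n" and ex: "e = pair n x c"
      unfolding c_def x_def using c x proj(2)[OF e] by auto
    let ?k = "edge H n (n - j) (n - i) c"
    have kc: "?k \<in> cells H 1" using edge_cells_H[OF c] ij by simp
    have h0: "edge H n 0 (n - j) c \<in> cells H 1" using edge_cells_H[OF c] by simp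
    have xk: "edge M n (n - j) (n - i) x \<in> cells M 1" using edge_cells_M[OF x] ij by simp
    obtain y where y: "y \<in> cells M 1" "conj_by (edge H n 0 (n - j) c) 1 y = edge M n (n - j) (n - i) x"
      using conj_surj[OF h0 xk] by blast
    have iy: "inv1 M y \<in> cells M 1" by (rule inv1_cells[OF pgM y(1)])
    have "edge E n (n - j) (n - i) e = pair 1 y ?k"
      unfolding ex by (rule pair_edge[OF c x _ _ y]) (use ij in auto)
    then have R: "nuE 1 (edge E n (n - j) (n - i) e) = pair 1 (conj_by (inv1 H ?k) 1 (inv1 M y)) (inv1 H ?k)"
      using nuE_pair[OF kc y(1)] edge_id[OF simpH kc] by simp
    have ik: "inv1 H ?k \<in> cells H 1" by (rule inv1_cells[OF pgH kc])
    have wc: "conj_by (inv1 H ?k) 1 (inv1 M y) \<in> cells M 1" by (rule conj_cells[OF ik iy])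
    \<comment> \<open>Both coordinates are to be seen from the vertex n of c, where \<nu>(c) starts.
      The common value is y\<inverse>, given at n - j, translated along the edge from n - j to
      n.\<close>
    let ?l = "edge H n (n - i) n c"
    have "conj_by (edge H n 0 i (nu H n c)) 1 (conj_by (inv1 H ?k) 1 (inv1 M y)) = conj_by (inv1 H ?l) 1 (conj_by (inv1 H ?k) 1 (inv1 M y))"
      using nu_edge[OF pgH c, of 0 i] ij by simp
    also have "\<dots> = conj_by (inv1 H (edge H n (n - j) n c)) 1 (inv1 M y)"
      by (rule conj_mul[OF inv1_mul_rev[OF pgH mul_edges[OF simpH c]] iy, symmetric]) (use ij in auto)
    also have "\<dots> = conj_by (inv1 H (edge H n 0 n c)) 1 (conj_by (edge H n 0 (n - j) c) 1 (inv1 M y))"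
    proof -
      have jc: "edge H n (n - j) n c \<in> cells H 1" using edge_cells_H[OF c] by simp
      have "conj_by (edge H n 0 (n - j) c) 1 (inv1 M y) =
        conj_by (edge H n 0 n c) 1 (conj_by (inv1 H (edge H n (n - j) n c)) 1 (inv1 M y))"
        using conj_edges[OF c, of 0 "n - j" n "conj_by (inv1 H (edge H n (n - j) n c)) 1 (inv1 M y)" 1]
          conj_cells[OF inv1_cells[OF pgH jc] iy] conj_inv1(1)[OF jc iy] by simp
      then show ?thesis
        using conj_inv1(2)[OF edge_cells_H[OF c, of 0 n] conj_cells[OF inv1_cells[OF pgH jc] iy]] by simp
    qed
    also have "conj_by (edge H n 0 (n - j) c) 1 (inv1 M y) = inv1 M (edge M n (n - j) (n - i) x)"
      using simplicial_map_inv1[OF pgM pgM conj_map[OF h0] y(1)] y(2) by simp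
    also have "conj_by (inv1 H (edge H n 0 n c)) 1 (inv1 M (edge M n (n - j) (n - i) x)) =
      edge M n i j (conj_by (inv1 H (edge H n 0 n c)) n (nu M n x))"
      using simplicial_map_edge[OF conj_map[OF ih[OF c]] nu_cells[OF pgM x] ij, of 0 n] nu_edge[OF pgM x ij] by simp
    finally have "edge E n i j (nuE n e) = pair 1 (conj_by (inv1 H ?k) 1 (inv1 M y)) (edge H n i j (nu H n c))"
      unfolding ex nuE_pair[OF c x] by (intro pair_edge[OF nu_cells[OF pgH c] rn[OF c x] ij wc])
    then show "edge E n i j (nuE n e) = nuE 1 (edge E n (n - j) (n - i) e)"
      unfolding R using nu_edge[OF pgH c ij] by simp
  next
    fix e assume e: "e \<in> cells E 1"
    define h x where "h = \<tau> 1 e" and "x = proj 1 e"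
    have h: "h \<in> cells H 1" and x: "x \<in> cells M 1" and ex: "e = pair 1 x h"
      unfolding h_def x_def using simplicial_map_cells[OF tau e] proj[OF e] by auto
    have ih: "inv1 H h \<in> cells H 1" by (rule inv1_cells[OF pgH h])
    have ix: "inv1 M x \<in> cells M 1" by (rule inv1_cells[OF pgM x])
    have 1: "nuE 1 e = pair 1 (conj_by (inv1 H h) 1 (inv1 M x)) (inv1 H h)"
      unfolding ex nuE_pair[OF h x] using edge_id[OF simpH h] by simp
    have "inv1 M (conj_by (inv1 H h) 1 (inv1 M x)) = conj_by (inv1 H h) 1 x"
      using simplicial_map_inv1[OF pgM pgM conj_map[OF ih] ix] inv1_inv1[OF pgM x] by simp
    then show "nuE 1 (nuE 1 e) = e"
      unfolding 1 nuE_pair[OF ih conj_cells[OF ih ix]] using edge_id[OF simpH ih] inv1_inv1[OF pgH h] conj_inv1(1)[OF h x] ex by simp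
  next
    fix n e assume e: "e \<in> cells E n" and n: "1 \<le> (n::nat)"
    define c x where "c = \<tau> n e" and "x = proj n e"
    have c: "c \<in> cells H n" and x: "x \<in> cells M n" and ex: "e = pair n x c"
      unfolding c_def x_def using simplicial_map_cells[OF tau e] proj[OF e] by auto
    obtain k where k: "k \<in> cells H (n + n)" and k1: "act H (n + n) [0..<Suc n] k = nu H n c"
      and k2: "act H (n + n) [n..<Suc (n + n)] k = c" and k3: "edge H (n + n) 0 (n + n) k = unit H"
      using nu_faces[OF pgH c n] by blast
    obtain u where u: "u \<in> cells M (n + n)" and u1: "act M (n + n) [0..<Suc n] u = nu M n x"
      and u2: "act M (n + n) [n..<Suc (n + n)] u = x" and u3: "edge M (n + n) 0 (n + n) u = unit M"
      using nu_faces[OF pgM x n] by blast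
    have a: "[0..<Suc n] \<in> mono_maps n (n + n)" and b: "[n..<Suc (n + n)] \<in> mono_maps n (n + n)"
      using upt_mono_maps[of 0 n "n + n"] upt_mono_maps[of n "n + n" "n + n"] by auto
    \<comment> \<open>The simplex k = [\<nu>(c)|c] starts at the vertex n of c, so the whole of u =
      [\<nu>(x)|x] is translated there by \<open>?h\<close>. Its second half starts at the vertex n
      of k, and the edge leading to it is again \<open>?h\<close>; the translation cancels and
      leaves x.\<close>
    let ?h = "inv1 H (edge H n 0 n c)"
    have hc: "?h \<in> cells H 1" by (rule ih[OF c]) auto
    note rh = conj_map[OF hc]
    let ?v = "conj_by ?h (n + n) u"
    have vc: "?v \<in> cells M (n + n)" by (rule conj_cells[OF hc u])
    have v1: "act M (n + n) [0..<Suc n] ?v = conj_by ?h n (nu M n x)"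
      using simplicial_map_act[OF rh a u] u1 by simp
    have v2: "act M (n + n) [n..<Suc (n + n)] ?v = conj_by ?h n x"
      using simplicial_map_act[OF rh b u] u2 by simp
    have v3: "edge M (n + n) 0 (n + n) ?v = unit M"
      using simplicial_map_edge[OF rh u, of 0 "n + n"] u3 simplicial_map_unit[OF pmM pmM rh] by simp
    have k0: "edge H (n + n) 0 0 k = unit H" by (rule edge_degenerate[OF pmH k]) simp
    have kn: "edge H (n + n) 0 n k = ?h"
      using edge_act[OF simpH a k, of 0 n] k1 nu_edge[OF pgH c, of 0 n] by simp
    show "\<exists>w\<in>cells E (n + n). act E (n + n) [0..<Suc n] w = nuE n e \<and>
      act E (n + n) [n..<Suc (n + n)] w = e \<and> edge E (n + n) 0 (n + n) w = unit E"
    proof (intro bexI conjI)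
      show "pair (n + n) ?v k \<in> cells E (n + n)" by (rule pair_cells[OF k vc])
      show "act E (n + n) [0..<Suc n] (pair (n + n) ?v k) = nuE n e"
        unfolding ex nuE_pair[OF c x]
        by (subst pair_act[OF k vc a rn[OF c x]]) (use k0 v1 k1 conj_unit[OF rn[OF c x]] in \<open>simp_all add: nth_append\<close>)
      show "act E (n + n) [n..<Suc (n + n)] (pair (n + n) ?v k) = e"
        unfolding ex by (subst pair_act[OF k vc b x]) (use kn v2 k2 in simp_all)
      show "edge E (n + n) 0 (n + n) (pair (n + n) ?v k) = unit E"
        using pair_edge[OF k vc, of 0 "n + n" "unit M"] k0 k3 v3 conj_unit unit_cells[OF pmM]
          pair_vertex_cell[OF unit_cells[OF pmM]] simplicial_map_unit[OF pmM pmE iota] by simp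
    qed
  qed
qed

end

section \<open>Sections and derivations\<close>

lemma edge_face:
  assumes X: "simplicial_set X" and u: "u \<in> cells X n" and k: "k \<le> n" "1 \<le> n" and ij: "i \<le> j" "j < n"
  shows "edge X (n - 1) i j (face X n k u) = edge X n (if i < k then i else Suc i) (if j < k then j else Suc j) u"
proof -
  have "j \<le> n - 1" "i < n" using ij by auto
  then show ?thesis
    unfolding face_def
    using edge_act[OF X face_list_mono[OF k] u ij(1)] face_list_nth[OF k, of i] face_list_nth[OF k, of j] ij by simp
qed

lemma face_cells: "simplicial_set X \<Longrightarrow> u \<in> cells X n \<Longrightarrow> k \<le> n \<Longrightarrow> 1 \<le> n \<Longrightarrow> face X n k u \<in> cells X (n - 1)"
  unfolding face_def by (rule act_cells[OF _ face_list_mono])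

lemma degen_cells: "simplicial_set X \<Longrightarrow> u \<in> cells X n \<Longrightarrow> k \<le> n \<Longrightarrow> degen X n k u \<in> cells X (Suc n)"
  unfolding degen_def by (rule act_cells[OF _ degen_list_mono])

lemma edge_degen:
  assumes X: "simplicial_set X" and u: "u \<in> cells X n" and k: "k \<le> n" and ij: "i \<le> j" "j \<le> Suc n"
  shows "edge X (Suc n) i j (degen X n k u) = edge X n (if i \<le> k then i else i - 1) (if j \<le> k then j else j - 1) u"
  unfolding degen_def
  using edge_act[OF X degen_list_mono[OF k] u ij] degen_list_nth[OF k, of i] degen_list_nth[OF k, of j] ij by simp

text \<open>The equivalence of derivations is generated by a relation and its converse, that of
  sections by chains in one direction. They correspond because S is symmetric and R inherits the
  symmetry through f.\<close>

lemma quotient_bij: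
  assumes b: "bij_betw f A B" and R: "R \<subseteq> A \<times> A" and S: "S \<subseteq> B \<times> B" "sym S"
    and RS: "\<And>a a'. a \<in> A \<Longrightarrow> a' \<in> A \<Longrightarrow> (a, a') \<in> R \<longleftrightarrow> (f a, f a') \<in> S"
  shows "\<exists>F. bij_betw F (A // (R \<union> R\<inverse>)\<^sup>*) (B // S\<^sup>*) \<and> (\<forall>a \<in> A. F ((R \<union> R\<inverse>)\<^sup>* `` {a}) = S\<^sup>* `` {f a})"
proof -
  have "R\<inverse> \<subseteq> R"
  proof clarify
    fix a a' assume a: "(a', a) \<in> R"
    then have "a \<in> A" "a' \<in> A" using R by auto
    with a RS S(2) show "(a, a') \<in> R" by (auto dest: symD)
  qed
  then have RR: "R \<union> R\<inverse> = R" by blast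
  have img: "S\<^sup>* `` {f a} = f ` (R\<^sup>* `` {a})" if a: "a \<in> A" for a
  proof
    have "a' \<in> A \<and> (f a, f a') \<in> S\<^sup>*" if "(a, a') \<in> R\<^sup>*" for a'
      using that
    proof (induction rule: rtrancl_induct)
      case (step y z)
      then have "z \<in> A" "(f y, f z) \<in> S" using R RS by auto
      with step show ?case by auto
    qed (use a in auto)
    then show "f ` (R\<^sup>* `` {a}) \<subseteq> S\<^sup>* `` {f a}" by auto
    have "\<exists>a' \<in> A. b = f a' \<and> (a, a') \<in> R\<^sup>*" if "(f a, b) \<in> S\<^sup>*" for b
      using that
    proof (induction rule: rtrancl_induct)
      case (step y z)
      then obtain a' where a': "a' \<in> A" "y = f a'" "(a, a') \<in> R\<^sup>*" by blast
      have "z \<in> B" using step S by auto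
      then obtain a'' where a'': "a'' \<in> A" "z = f a''" using b by (auto simp: bij_betw_def)
      then have "(a', a'') \<in> R" using RS a' step by auto
      then have "(a, a'') \<in> R\<^sup>*" using a'(3) by (rule rtrancl.rtrancl_into_rtrancl[rotated])
      then show ?case using a'' by blast
    qed (use a in auto)
    then show "S\<^sup>* `` {f a} \<subseteq> f ` (R\<^sup>* `` {a})" by auto
  qed
  have sub: "X \<subseteq> A" if X: "X \<in> A // R\<^sup>*" for X
  proof -
    obtain a where a: "a \<in> A" "X = R\<^sup>* `` {a}" using X by (rule quotientE)
    have "a' \<in> A" if "(a, a') \<in> R\<^sup>*" for a'
      using that by (induction rule: rtrancl_induct) (use a R in auto)
    then show ?thesis using a by auto
  qed
  have "bij_betw ((`) f) (A // R\<^sup>*) (B // S\<^sup>*)"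
    unfolding bij_betw_def
  proof
    show "inj_on ((`) f) (A // R\<^sup>*)"
      by (rule inj_onI) (use b inj_on_image_eq_iff[OF _ sub sub, of f] in \<open>simp add: bij_betw_def\<close>)
    show "(`) f ` (A // R\<^sup>*) = B // S\<^sup>*"
    proof
      show "(`) f ` (A // R\<^sup>*) \<subseteq> B // S\<^sup>*"
      proof clarify
        fix X assume "X \<in> A // R\<^sup>*"
        then obtain a where a: "a \<in> A" "X = R\<^sup>* `` {a}" by (elim quotientE)
        moreover have "f a \<in> B" using a b by (auto simp: bij_betw_def)
        ultimately show "f ` X \<in> B // S\<^sup>*" using img[OF a(1)] by (metis quotientI)
      qed
      show "B // S\<^sup>* \<subseteq> (`) f ` (A // R\<^sup>*)"
      proof
        fix Y assume "Y \<in> B // S\<^sup>*"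
        then obtain b' where b': "b' \<in> B" "Y = S\<^sup>* `` {b'}" by (elim quotientE)
        then obtain a where a: "a \<in> A" "b' = f a" using b by (auto simp: bij_betw_def)
        then show "Y \<in> (`) f ` (A // R\<^sup>*)" using img[OF a(1)] b' by (metis quotientI imageI)
      qed
    qed
  qed
  then show ?thesis unfolding RR using img by (intro exI[of _ "(`) f"]) auto
qed

lemma mixed_word_length [simp]: "k \<le> n \<Longrightarrow> length (mixed_word H \<rho> \<theta> y \<theta>' n h k) = Suc n"
  by (simp add: mixed_word_def)

lemma mixed_word_nth:
  assumes "k \<le> n" "i < Suc n"
  shows "mixed_word H \<rho> \<theta> y \<theta>' n h k ! i =
    (if i < k then act_by \<rho> (act H n [0, i] h) 1 (\<theta> 1 (act H n [i, Suc i] h))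
     else if i = k then act_by \<rho> (act H n [0, k] h) 1 y
     else act_by \<rho> (act H n [0, i - 1] h) 1 (\<theta>' 1 (act H n [i - 1, Suc (i - 1)] h)))"
proof -
  consider "i < k" | "i = k" | j where "i = k + Suc j"
    by (metis less_iff_Suc_add linorder_neqE_nat add_Suc_right)
  then show ?thesis
    using assms by cases (auto simp: mixed_word_def nth_append)
qed

context partial_group_extension
begin

lemma regular_section_iff:
  assumes s: "s \<in> sections E \<tau> H"
  shows "regular_section M \<iota> E H s \<longleftrightarrow> (\<forall>h \<in> cells H 1. defines_htpy M E \<iota> (s 1 h))"
proof
  have sm: "simplicial_map H E s" using s by (simp add: sections_def Hom_def)
  assume R: "regular_section M \<iota> E H s"
  show "\<forall>h \<in> cells H 1. defines_htpy M E \<iota> (s 1 h)"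
  proof
    fix h assume h: "h \<in> cells H 1"
    have "s 1 h \<in> normalizer_cells M \<iota> E 1" using R h by (simp add: regular_section_def)
    moreover have "spine E 1 (s 1 h) = [s 1 h]"
      using edge_id[OF simpE simplicial_map_cells[OF sm h]] by (simp add: spine_def)
    ultimately show "defines_htpy M E \<iota> (s 1 h)" by (simp add: normalizer_cells_def)
  qed
next
  have sm: "simplicial_map H E s" using s by (simp add: sections_def Hom_def)
  assume "\<forall>h \<in> cells H 1. defines_htpy M E \<iota> (s 1 h)"
  then show "regular_section M \<iota> E H s"
    unfolding regular_section_def normalizer_cells_def
    by (auto simp: spine_def simplicial_map_cells[OF sm] simplicial_map_edge[OF sm] edge_cells[OF simpH])
qed

end

context regular_section_of_extension
begin

section \<open>The action by conjugation\<close>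

definition rho :: "nat \<Rightarrow> 'h \<Rightarrow> (nat \<Rightarrow> 'a \<Rightarrow> 'a) list" where
  "rho n = (\<lambda>c \<in> cells H n. map (\<lambda>i. conj_by (edge H n i (Suc i) c)) [0..<n])"

lemma conj_Aut: "h \<in> cells H 1 \<Longrightarrow> conj_by h \<in> carrier (Aut M)"
  using conj_map conj_iso by (simp add: Aut_def Hom_def conj_by_def)

lemma conj_mult:
  assumes "mul H g h k"
  shows "mult (Aut M) (conj_by g) (conj_by h) = conj_by k"
proof (intro ext)
  fix n x
  have "x \<in> cells M n \<Longrightarrow> conj_by k n x = conj_by g n (conj_by h n x)" by (rule conj_mul[OF assms])
  moreover have "x \<notin> cells M n \<Longrightarrow> conj_by k n x = undefined" by (simp add: conj_by_def)
  ultimately show "mult (Aut M) (conj_by g) (conj_by h) n x = conj_by k n x" by (simp add: Aut_def compose_def restrict_def)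
qed

lemma conj_one: "one (Aut M) = conj_by (unit H)"
proof (intro ext)
  fix n x
  show "one (Aut M) n x = conj_by (unit H) n x"
    using conj_unit[of x n] by (cases "x \<in> cells M n") (auto simp: Aut_def conj_by_def)
qed

text \<open>Operators of the bar construction multiply blocks of consecutive entries; along a
  simplex of H these products telescope to conjugation by the edge that spans the block.\<close>

lemma conj_foldr:
  assumes c: "c \<in> cells H n" and ab: "a \<le> b" "b \<le> n"
  shows "foldr (mult (Aut M)) (map (\<lambda>i. conj_by (edge H n i (Suc i) c)) [a..<b]) (one (Aut M)) = conj_by (edge H n a b c)"
  using ab(1)
proof (induction a rule: inc_induct)
  case base
  show ?case using edge_degenerate[OF pmH c ab(2)] conj_one by simp
next
  case (step a)
  have "mul H (edge H n a (Suc a) c) (edge H n (Suc a) b c) (edge H n a b c)"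
    by (rule mul_edges[OF simpH c]) (use step ab in auto)
  with step conj_mult show ?case by (simp add: upt_conv_Cons)
qed

lemma rho_actions: "rho \<in> actions H M"
  unfolding actions_def Hom_def
proof (intro CollectI conjI allI)
  show "rho n \<in> extensional (cells H n)" for n by (simp add: rho_def)
  show "simplicial_map H (bar (Aut M)) rho"
    unfolding simplicial_map_def
  proof (intro conjI allI ballI)
    fix n c assume "c \<in> cells H n"
    then show "rho n c \<in> cells (bar (Aut M)) n"
      by (auto simp: rho_def bar_def intro!: conj_Aut edge_cells_H)
  next
    fix m n \<alpha> c assume a: "\<alpha> \<in> mono_maps m n" and c: "c \<in> cells H n"
    have "rho m (act H n \<alpha> c) ! i = act (bar (Aut M)) n \<alpha> (rho n c) ! i" if i: "i < m" for i
    proof -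
      have le: "\<alpha> ! i \<le> \<alpha> ! Suc i" "\<alpha> ! Suc i \<le> n"
        using mono_maps_nth_mono[OF a, of i "Suc i"] mono_maps_nth_le[OF a, of "Suc i"] i by auto
      have "map ((!) (map (\<lambda>i. conj_by (edge H n i (Suc i) c)) [0..<n])) [\<alpha> ! i..<\<alpha> ! Suc i] =
        map (\<lambda>i. conj_by (edge H n i (Suc i) c)) [\<alpha> ! i..<\<alpha> ! Suc i]"
        using le by auto
      note eq = this
      show ?thesis
        using i c act_cells[OF simpH a c] conj_foldr[OF c le] mono_maps_length[OF a]
        by (simp add: rho_def bar_def edge_act[OF simpH a c] eq)
    qed
    then show "rho m (act H n \<alpha> c) = act (bar (Aut M)) n \<alpha> (rho n c)"
      using c act_cells[OF simpH a c] mono_maps_length[OF a]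
      by (intro nth_equalityI) (auto simp: rho_def bar_def)
  qed
qed

lemma act_by_rho: "h \<in> cells H 1 \<Longrightarrow> act_by rho h = conj_by h"
  using edge_id[OF simpH, of h] by (simp add: act_by_def rho_def)

lemma rho_conjugation: "conjugation_action M \<iota> E H \<sigma> rho"
  unfolding conjugation_action_def
proof
  fix h assume h: "h \<in> cells H 1"
  show "htpy M E (\<lambda>n. \<iota> n \<circ> act_by rho h n) (\<sigma> 1 h) \<iota>"
    unfolding htpy_iff act_by_rho[OF h]
    using conj_htpy[OF h] conj_htpy_0[OF h] by (intro exI[of _ "conj_htpy h"]) (auto simp: ihtpy_def)
qed

section \<open>Derivations as coordinates of sections\<close>

lemma derivation_cells: "\<theta> \<in> derivations H M rho \<Longrightarrow> c \<in> cells H n \<Longrightarrow> \<theta> n c \<in> cells M n"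
  by (auto simp: derivations_def)

lemma derivation_unit:
  assumes d: "\<theta> \<in> derivations H M rho"
  shows "\<theta> 1 (unit H) = unit M"
proof -
  have "degen M 0 0 (\<theta> 0 (vertex H)) = \<theta> (Suc 0) (degen H 0 0 (vertex H))"
    using d pm_vertex[OF pmH] unfolding derivations_def by auto
  moreover have "\<theta> 0 (vertex H) = vertex M"
    using pm_vertex_unique[OF pmM derivation_cells[OF d pm_vertex[OF pmH]]] .
  ultimately show ?thesis by (simp add: unit_def)
qed

text \<open>The axioms only speak of faces and degeneracies. An edge is reached by induction,
  removing vertices other than its own: the twisted face d_0 if the edge does not start at 0, an
  untwisted one if it does.\<close>

lemma derivation_edge:
  assumes d: "\<theta> \<in> derivations H M rho" and c: "c \<in> cells H n" and ij: "i \<le> j" "j \<le> n"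
  shows "edge M n i j (\<theta> n c) = conj_by (edge H n 0 i c) 1 (\<theta> 1 (edge H n i j c))"
proof (cases "i = j")
  case True
  have h: "edge H n 0 i c \<in> cells H 1" using edge_cells_H[OF c, of 0 i] ij by auto
  show ?thesis
    using True ij edge_degenerate[OF pmH c, of j] edge_degenerate[OF pmM derivation_cells[OF d c], of j] derivation_unit[OF d]
      simplicial_map_unit[OF pmM pmM conj_map[OF h]] by simp
next
  case False
  then have "i < j" using ij by simp
  then show ?thesis
    using c ij(2)
  proof (induction n arbitrary: i j c)
    case (Suc n)
    note c = Suc.prems(2)
    have d0: "face M (Suc n) 0 (\<theta> (Suc n) c) = conj_by (edge H (Suc n) 0 1 c) n (\<theta> n (face H (Suc n) 0 c))"
      using d c act_by_rho[OF edge_cells_H[OF c, of 0 1]] unfolding derivations_def by auto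
    have dk: "face M (Suc n) k (\<theta> (Suc n) c) = \<theta> n (face H (Suc n) k c)" if "1 \<le> k" "k \<le> Suc n" for k
      using d c that unfolding derivations_def by auto
    have fc: "face H (Suc n) k c \<in> cells H n" if "k \<le> Suc n" for k
      using face_cells[OF simpH c that] by simp
    have eM: "edge M n p q (face M (Suc n) k (\<theta> (Suc n) c)) =
      edge M (Suc n) (if p < k then p else Suc p) (if q < k then q else Suc q) (\<theta> (Suc n) c)"
      if "k \<le> Suc n" "p \<le> q" "q \<le> n" for k p q
      using edge_face[OF simpM derivation_cells[OF d c] that(1), of p q] that by simp
    have eH: "edge H n p q (face H (Suc n) k c) =
      edge H (Suc n) (if p < k then p else Suc p) (if q < k then q else Suc q) c"
      if "k \<le> Suc n" "p \<le> q" "q \<le> n" for k p q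
      using edge_face[OF simpH c that(1), of p q] that by simp
    have u: "edge H m 0 0 b = unit H" if "b \<in> cells H m" for m b by (rule edge_degenerate[OF pmH that]) simp
    have tc: "\<theta> 1 (edge H (Suc n) i j c) \<in> cells M 1"
      by (rule derivation_cells[OF d edge_cells_H[OF c]]) (use Suc.prems in auto)
    consider "n = 0" | "i = 0" "n \<ge> 1" | "i \<ge> 1" by linarith
    then show ?case
    proof cases
      case 1
      then have "i = 0" "j = 1" using Suc.prems by auto
      then show ?thesis using 1 c u[OF c] conj_unit[OF derivation_cells[OF d c]]
        by (simp add: edge_id[OF simpH] edge_id[OF simpM derivation_cells[OF d]])
    next
      case 2
      \<comment> \<open>The vertex k to be removed must be neither 0 nor j: it is the last one,
        unless j is, and then 1, which differs from j because n \<ge> 1. The position of j in the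
        face is j'.\<close>
      define k where "k = (if j = Suc n then 1 else Suc n)"
      define j' where "j' = (if k < j then j - 1 else j)"
      have k: "1 \<le> k" "k \<le> Suc n" "0 < j'" "j' \<le> n" "(if j' < k then j' else Suc j') = j"
        using 2 Suc.prems unfolding k_def j'_def by auto
      have "edge M (Suc n) 0 j (\<theta> (Suc n) c) = edge M n 0 j' (\<theta> n (face H (Suc n) k c))"
        using eM[of k 0 j'] k dk[OF k(1,2)] by simp
      also have "\<dots> = conj_by (edge H n 0 0 (face H (Suc n) k c)) 1 (\<theta> 1 (edge H n 0 j' (face H (Suc n) k c)))"
        by (rule Suc.IH) (use k fc in auto)
      also have "\<dots> = conj_by (unit H) 1 (\<theta> 1 (edge H (Suc n) 0 j c))"
        using eH[of k 0 j'] k u[OF fc[OF k(2)]] by simp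
      finally show ?thesis using 2 u[OF c] by simp
    next
      case 3
      have h1: "edge H (Suc n) 0 1 c \<in> cells H 1" by (rule edge_cells_H[OF c]) auto
      have "edge M (Suc n) i j (\<theta> (Suc n) c) = edge M n (i - 1) (j - 1) (conj_by (edge H (Suc n) 0 1 c) n (\<theta> n (face H (Suc n) 0 c)))"
        using eM[of 0 "i - 1" "j - 1"] d0 3 Suc.prems by simp
      also have "\<dots> = conj_by (edge H (Suc n) 0 1 c) 1 (edge M n (i - 1) (j - 1) (\<theta> n (face H (Suc n) 0 c)))"
        by (rule simplicial_map_edge[OF conj_map[OF h1] derivation_cells[OF d fc]]) (use Suc.prems in auto)
      also have "edge M n (i - 1) (j - 1) (\<theta> n (face H (Suc n) 0 c)) =
        conj_by (edge H n 0 (i - 1) (face H (Suc n) 0 c)) 1 (\<theta> 1 (edge H n (i - 1) (j - 1) (face H (Suc n) 0 c)))"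
        by (rule Suc.IH) (use Suc.prems 3 fc in auto)
      also have "\<dots> = conj_by (edge H (Suc n) 1 i c) 1 (\<theta> 1 (edge H (Suc n) i j c))"
        using eH[of 0 0 "i - 1"] eH[of 0 "i - 1" "j - 1"] 3 Suc.prems by simp
      also have "conj_by (edge H (Suc n) 0 1 c) 1 \<dots> = conj_by (edge H (Suc n) 0 i c) 1 (\<theta> 1 (edge H (Suc n) i j c))"
        by (rule conj_edges[OF c _ _ _ tc]) (use 3 Suc.prems in auto)
      finally show ?thesis .
    qed
  qed simp
qed

definition section_of :: "(nat \<Rightarrow> 'h \<Rightarrow> 'a) \<Rightarrow> nat \<Rightarrow> 'h \<Rightarrow> 'e" where
  "section_of \<theta> n = (\<lambda>c \<in> cells H n. pair n (\<theta> n c) c)"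

definition derivation_of :: "(nat \<Rightarrow> 'h \<Rightarrow> 'e) \<Rightarrow> nat \<Rightarrow> 'h \<Rightarrow> 'a" where
  "derivation_of s n = (\<lambda>c \<in> cells H n. proj n (s n c))"

lemma section_of_section:
  assumes d: "\<theta> \<in> derivations H M rho"
  shows "section_of \<theta> \<in> sections E \<tau> H"
proof -
  have "simplicial_map H E (\<lambda>n c. pair n (\<theta> n c) c)"
  proof (rule simplicial_map_edgeI[OF simpH pmE])
    fix n c i j assume c: "c \<in> cells H n" and ij: "i \<le> j" "j \<le> (n::nat)"
    show "edge E n i j (pair n (\<theta> n c) c) = pair 1 (\<theta> 1 (edge H n i j c)) (edge H n i j c)"
      by (rule pair_edge[OF c derivation_cells[OF d c] ij derivation_cells[OF d edge_cells_H[OF c ij]] derivation_edge[OF d c ij, symmetric]])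
  qed (use pair_cells derivation_cells[OF d] in blast)
  then have "simplicial_map H E (section_of \<theta>)"
    by (rule simplicial_map_cong[OF _ simpH]) (simp add: section_of_def)
  moreover have "\<forall>n. section_of \<theta> n \<in> extensional (cells H n)" by (simp add: section_of_def)
  ultimately show ?thesis
    unfolding sections_def Hom_def using pair_tau derivation_cells[OF d] by (auto simp: section_of_def)
qed

lemma derivation_of_pair:
  assumes s: "s \<in> sections E \<tau> H" and c: "c \<in> cells H n"
  shows "derivation_of s n c \<in> cells M n" and "pair n (derivation_of s n c) c = s n c"
proof -
  have "s n c \<in> cells E n" "\<tau> n (s n c) = c" using s c by (auto simp: sections_def Hom_def simplicial_map_cells)
  then show "derivation_of s n c \<in> cells M n" and "pair n (derivation_of s n c) c = s n c"
    using proj[of "s n c" n] c by (auto simp: derivation_of_def)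
qed

text \<open>This contains all axioms of a derivation at once: \<open>\<beta> ! 0\<close> is 1 for
  d_0 and 0 for the other faces and the degeneracies.\<close>

lemma derivation_of_act:
  assumes s: "s \<in> sections E \<tau> H" and c: "c \<in> cells H n" and b: "\<beta> \<in> mono_maps m n"
  shows "act M n \<beta> (derivation_of s n c) = conj_by (edge H n 0 (\<beta> ! 0) c) m (derivation_of s m (act H n \<beta> c))"
proof -
  have sm: "simplicial_map H E s" using s by (simp add: sections_def Hom_def)
  note x = derivation_of_pair(1)[OF s c] and c' = act_cells[OF simpH b c]
  have h: "edge H n 0 (\<beta> ! 0) c \<in> cells H 1" using edge_cells_H[OF c] mono_maps_nth_le[OF b, of 0] by simp
  obtain y where y: "y \<in> cells M m" "conj_by (edge H n 0 (\<beta> ! 0) c) m y = act M n \<beta> (derivation_of s n c)"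
    using conj_surj[OF h act_cells[OF simpM b x]] by blast
  have "pair m y (act H n \<beta> c) = pair m (derivation_of s m (act H n \<beta> c)) (act H n \<beta> c)"
    using pair_act[OF c x b y] derivation_of_pair(2)[OF s c] derivation_of_pair(2)[OF s c'] simplicial_map_act[OF sm b c] by simp
  then have "y = derivation_of s m (act H n \<beta> c)" by (rule pair_inj[OF c' y(1) derivation_of_pair(1)[OF s c']])
  then show ?thesis using y(2) by simp
qed

lemma derivation_of_derivation:
  assumes s: "s \<in> sections E \<tau> H"
  shows "derivation_of s \<in> derivations H M rho"
  unfolding derivations_def
proof (intro CollectI conjI allI impI ballI)
  fix n
  show "derivation_of s n \<in> cells H n \<rightarrow>\<^sub>E cells M n"
    using derivation_of_pair(1)[OF s] by (auto simp: PiE_def derivation_of_def)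
next
  fix n c assume n: "1 \<le> (n::nat)" and c: "c \<in> cells H n"
  have h: "edge H n 0 1 c \<in> cells H 1" using edge_cells_H[OF c] n by simp
  have "([0..<0] @ [Suc 0..<Suc n]) ! 0 = 1" using face_list_nth[of 0 n 0] n by simp
  then show "face M n 0 (derivation_of s n c) = act_by rho (act H n [0, 1] c) (n - 1) (derivation_of s (n - 1) (face H n 0 c))"
    unfolding face_def act_by_rho[OF h] using derivation_of_act[OF s c face_list_mono[of 0 n]] n by simp
next
  fix n c i assume n: "1 \<le> (n::nat)" and c: "c \<in> cells H n" and i: "i \<in> {1..n}"
  have b: "[0..<i] @ [Suc i..<Suc n] \<in> mono_maps (n - 1) n" by (rule face_list_mono) (use i n in auto)
  have z: "([0..<i] @ [Suc i..<Suc n]) ! 0 = 0" using face_list_nth[of i n 0] n i by simp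
  have u: "edge H n 0 0 c = unit H" by (rule edge_degenerate[OF pmH c]) simp
  show "face M n i (derivation_of s n c) = derivation_of s (n - 1) (face H n i c)"
    unfolding face_def derivation_of_act[OF s c b] z u by (rule conj_unit[OF derivation_of_pair(1)[OF s act_cells[OF simpH b c]]])
next
  fix n c i assume c: "c \<in> cells H n" and i: "i \<in> {0..n}"
  have b: "[0..<Suc i] @ [i..<Suc n] \<in> mono_maps (Suc n) n" by (rule degen_list_mono) (use i in auto)
  have z: "([0..<Suc i] @ [i..<Suc n]) ! 0 = 0" using degen_list_nth[of i n 0] i by simp
  have u: "edge H n 0 0 c = unit H" by (rule edge_degenerate[OF pmH c]) simp
  show "degen M n i (derivation_of s n c) = derivation_of s (Suc n) (degen H n i c)"
    unfolding degen_def derivation_of_act[OF s c b] z u by (rule conj_unit[OF derivation_of_pair(1)[OF s act_cells[OF simpH b c]]])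
qed

lemma section_of_bij: "bij_betw section_of (derivations H M rho) (sections E \<tau> H)"
proof (rule bij_betw_byWitness[where f' = derivation_of])
  show "\<forall>\<theta> \<in> derivations H M rho. derivation_of (section_of \<theta>) = \<theta>"
  proof (intro ballI ext)
    fix \<theta> n c assume d: "\<theta> \<in> derivations H M rho"
    show "derivation_of (section_of \<theta>) n c = \<theta> n c"
    proof (cases "c \<in> cells H n")
      case True
      then show ?thesis using proj_pair[OF True derivation_cells[OF d True]] by (simp add: derivation_of_def section_of_def)
    next
      case False
      then show ?thesis using d by (auto simp: derivation_of_def derivations_def PiE_def extensional_def)
    qed
  qed
  show "\<forall>s \<in> sections E \<tau> H. section_of (derivation_of s) = s"
  proof (intro ballI ext)
    fix s n c assume s: "s \<in> sections E \<tau> H"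
    show "section_of (derivation_of s) n c = s n c"
    proof (cases "c \<in> cells H n")
      case True
      then show ?thesis using derivation_of_pair(2)[OF s True] by (simp add: section_of_def)
    next
      case False
      then show ?thesis using s by (auto simp: section_of_def sections_def Hom_def extensional_def)
    qed
  qed
qed (use section_of_section derivation_of_derivation in auto)

lemma section_of_mul:
  assumes d: "\<theta> \<in> derivations H M rho" and h: "h \<in> cells H 1"
  shows "mul E (\<iota> 1 (\<theta> 1 h)) (\<sigma> 1 h) (section_of \<theta> 1 h)"
  using pair_mul[OF derivation_cells[OF d h] h] h by (simp add: section_of_def)

text \<open>In higher degrees the spine consists of translates of values of \<theta> in degree 1,
  and \<open>NN M\<close> is stable under automorphisms.\<close>

lemma regular_derivation_iff:
  assumes d: "\<theta> \<in> derivations H M rho"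
  shows "regular_derivation H M \<theta> \<longleftrightarrow> (\<forall>h \<in> cells H 1. \<theta> 1 h \<in> NN M)"
proof
  assume R: "regular_derivation H M \<theta>"
  show "\<forall>h \<in> cells H 1. \<theta> 1 h \<in> NN M"
  proof
    fix h assume h: "h \<in> cells H 1"
    have "\<theta> 1 h \<in> BN M 1" using R h by (simp add: regular_derivation_def)
    moreover have "spine M 1 (\<theta> 1 h) = [\<theta> 1 h]" using edge_id[OF simpM derivation_cells[OF d h]] by (simp add: spine_def)
    ultimately show "\<theta> 1 h \<in> NN M" by (simp add: BN_def)
  qed
next
  assume N: "\<forall>h \<in> cells H 1. \<theta> 1 h \<in> NN M"
  show "regular_derivation H M \<theta>"
    unfolding regular_derivation_def BN_def
  proof (intro allI ballI CollectI conjI subsetI)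
    fix n c x assume c: "c \<in> cells H n" and "x \<in> set (spine M n (\<theta> n c))"
    then obtain i where i: "i < n" and x: "x = edge M n i (Suc i) (\<theta> n c)" by (auto simp: spine_def)
    have h: "edge H n 0 i c \<in> cells H 1" "edge H n i (Suc i) c \<in> cells H 1" using edge_cells_H[OF c] i by auto
    show "x \<in> NN M"
      unfolding x using derivation_edge[OF d c, of i "Suc i"] i NN_iso[OF pmM conj_iso[OF h(1)]] N h(2) by auto
  qed (use derivation_cells[OF d] in blast)
qed

text \<open>Both sides are decided on edges, where the section is \<theta>(h) \<sigma>(h) and
  \<sigma>(h) is the element of a strong homotopy; so \<open>regular_iff\<close> applies.\<close>

lemma section_of_regular:
  assumes d: "\<theta> \<in> derivations H M rho"
  shows "regular_derivation H M \<theta> \<longleftrightarrow> regular_section M \<iota> E H (section_of \<theta>)"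
proof -
  have "\<theta> 1 h \<in> NN M \<longleftrightarrow> defines_htpy M E \<iota> (section_of \<theta> 1 h)" if h: "h \<in> cells H 1" for h
    using regular_iff(1)[OF conj_htpy_strong[OF h] derivation_cells[OF d h]] section_of_mul[OF d h] conj_htpy(2)[OF h] by simp
  then show ?thesis
    unfolding regular_derivation_iff[OF d] regular_section_iff[OF section_of_section[OF d]] by simp
qed

text \<open>The degeneracy puts a unit into the spine of c at the place where y stands, and the
  twists in the mixed word are the translations to the vertex 0 built into \<open>pair\<close>. So
  the mixed words are the top simplices of prisms in E, read in coordinates.\<close>

lemma mixed_word_pair:
  assumes d: "\<theta> \<in> derivations H M rho" and d': "\<theta>' \<in> derivations H M rho" and y: "y \<in> cells M 1"
    and c: "c \<in> cells H n" and k: "k \<le> n" and w: "w \<in> cells M (Suc n)"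
  shows "(\<forall>i<Suc n. edge M (Suc n) i (Suc i) w = mixed_word H rho \<theta> y \<theta>' n c k ! i) \<longleftrightarrow>
    (\<forall>i<k. edge E (Suc n) i (Suc i) (pair (Suc n) w (degen H n k c)) = section_of \<theta> 1 (edge H n i (Suc i) c)) \<and>
    edge E (Suc n) k (Suc k) (pair (Suc n) w (degen H n k c)) = \<iota> 1 y \<and>
    (\<forall>i. k \<le> i \<longrightarrow> i < n \<longrightarrow>
      edge E (Suc n) (Suc i) (Suc (Suc i)) (pair (Suc n) w (degen H n k c)) = section_of \<theta>' 1 (edge H n i (Suc i) c))"
proof -
  let ?D = "degen H n k c"
  note D = degen_cells[OF simpH c k]
  have a: "act_by rho (edge H n 0 i c) = conj_by (edge H n 0 i c)" if "i \<le> n" for i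
    by (rule act_by_rho[OF edge_cells_H[OF c]]) (use that in auto)
  have 1: "edge M (Suc n) i (Suc i) w = mixed_word H rho \<theta> y \<theta>' n c k ! i \<longleftrightarrow>
    edge E (Suc n) i (Suc i) (pair (Suc n) w ?D) = section_of \<theta> 1 (edge H n i (Suc i) c)" if i: "i < k" for i
  proof -
    have h: "edge H n i (Suc i) c \<in> cells H 1" using edge_cells_H[OF c] i k by auto
    show ?thesis
      using pair_edge_iff[OF D w _ _ derivation_cells[OF d h], of i "Suc i"] edge_degen[OF simpH c k, of i "Suc i"]
        edge_degen[OF simpH c k, of 0 i] i k a[of i] h by (simp add: mixed_word_nth section_of_def)
  qed
  have 2: "edge M (Suc n) k (Suc k) w = mixed_word H rho \<theta> y \<theta>' n c k ! k \<longleftrightarrow>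
    edge E (Suc n) k (Suc k) (pair (Suc n) w ?D) = \<iota> 1 y"
    using pair_edge_iff[OF D w _ _ y, of k "Suc k"] edge_degen[OF simpH c k, of k "Suc k"]
      edge_degen[OF simpH c k, of 0 k] k a[of k] edge_degenerate[OF pmH c k] pair_vertex_cell[OF y] by (simp add: mixed_word_nth)
  have 3: "edge M (Suc n) (Suc i) (Suc (Suc i)) w = mixed_word H rho \<theta> y \<theta>' n c k ! Suc i \<longleftrightarrow>
    edge E (Suc n) (Suc i) (Suc (Suc i)) (pair (Suc n) w ?D) = section_of \<theta>' 1 (edge H n i (Suc i) c)"
    if i: "k \<le> i" "i < n" for i
  proof -
    have h: "edge H n i (Suc i) c \<in> cells H 1" using edge_cells_H[OF c] i k by auto
    show ?thesis
      using pair_edge_iff[OF D w _ _ derivation_cells[OF d' h], of "Suc i" "Suc (Suc i)"] edge_degen[OF simpH c k, of "Suc i" "Suc (Suc i)"]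
        edge_degen[OF simpH c k, of 0 "Suc i"] i k a[of i] h by (simp add: mixed_word_nth section_of_def plus_1_eq_Suc)
  qed
  have split: "(\<forall>i<Suc n. P i) \<longleftrightarrow> (\<forall>i<k. P i) \<and> P k \<and> (\<forall>i. k \<le> i \<longrightarrow> i < n \<longrightarrow> P (Suc i))" for P
  proof (intro iffI conjI allI impI)
    fix i assume *: "(\<forall>i<k. P i) \<and> P k \<and> (\<forall>i. k \<le> i \<longrightarrow> i < n \<longrightarrow> P (Suc i))" and i: "i < Suc n"
    consider "i < k" | "i = k" | j where "i = Suc j" "k \<le> j" using not0_implies_Suc by (cases i) force+
    then show "P i" using * i by cases auto
  qed (use k in auto)
  show ?thesis unfolding split using 1 2 3 by blast
qed

text \<open>Through \<open>mixed_word_pair\<close>, equality of the products of the mixed words is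
  the agreement of the long edges of a prism. \<open>smap2_word\<close> gives one direction and
  \<open>htpyI\<close> the other.\<close>

lemma htpy_iff_defines_equiv:
  assumes d: "\<theta> \<in> derivations H M rho" and d': "\<theta>' \<in> derivations H M rho" and y: "y \<in> cells M 1"
  shows "htpy H E (section_of \<theta>) (\<iota> 1 y) (section_of \<theta>') \<longleftrightarrow> defines_equiv H M rho \<theta> y \<theta>'"
proof
  note s = section_of_section[OF d] and s' = section_of_section[OF d']
  have sm: "simplicial_map H E (section_of \<theta>)" "simplicial_map H E (section_of \<theta>')"
    using s s' by (auto simp: sections_def Hom_def)
  {
    assume "htpy H E (section_of \<theta>) (\<iota> 1 y) (section_of \<theta>')"
    then obtain K where K: "smap2 H 1 E K"
      and K0: "\<And>n c. c \<in> cells H n \<Longrightarrow> K n c (replicate (Suc n) 0) = section_of \<theta> n c"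
      and K1: "\<And>n c. c \<in> cells H n \<Longrightarrow> K n c (replicate (Suc n) 1) = section_of \<theta>' n c"
      and Ky: "K 1 (unit H) [0, 1] = \<iota> 1 y"
      unfolding htpy_iff by blast
    have K00: "K 1 h [0, 0] = section_of \<theta> 1 h" and K11: "K 1 h [1, 1] = section_of \<theta>' 1 h" if "h \<in> cells H 1" for h
      using K0[OF that] K1[OF that] unfolding replicate_2 by auto
    have tau_section_of: "\<tau> 1 (section_of \<theta> 1 h) = h" "\<tau> 1 (section_of \<theta>' 1 h) = h" if "h \<in> cells H 1" for h
      using s s' that by (auto simp: sections_def)
    have main: "mixed_word H rho \<theta> y \<theta>' n c k \<in> words M \<and>
        pair 1 (mprod M (mixed_word H rho \<theta> y \<theta>' n c k)) (edge H n 0 n c) = K 1 (edge H n 0 n c) [0, 1]"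
      if c: "c \<in> cells H n" and k: "k \<le> n" for n c k
    proof -
      obtain v where v: "v \<in> cells E (Suc n)"
        and v1: "\<And>i. i < k \<Longrightarrow> edge E (Suc n) i (Suc i) v = K 1 (edge H n i (Suc i) c) [0, 0]"
        and v2: "edge E (Suc n) k (Suc k) v = \<iota> 1 y"
        and v3: "\<And>i. k \<le> i \<Longrightarrow> i < n \<Longrightarrow> edge E (Suc n) (Suc i) (Suc (Suc i)) v = K 1 (edge H n i (Suc i) c) [1, 1]"
        and v4: "edge E (Suc n) 0 (Suc n) v = K 1 (edge H n 0 n c) [0, 1]"
        using smap2_word[OF pmE pmH K c k] Ky by auto
      have hc: "edge H n i (Suc i) c \<in> cells H 1" if "i < n" for i using edge_cells_H[OF c] that by auto
      have v1': "edge E (Suc n) i (Suc i) v = section_of \<theta> 1 (edge H n i (Suc i) c)" if "i < k" for i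
        using v1[OF that] K00[OF hc] that k by auto
      have v3': "edge E (Suc n) (Suc i) (Suc (Suc i)) v = section_of \<theta>' 1 (edge H n i (Suc i) c)" if "k \<le> i" "i < n" for i
        using v3[OF that] K11[OF hc] that by auto
      note D = degen_cells[OF simpH c k]
      \<comment> \<open>Since the element of K lies in the fibre, v lies over the degenerate
        simplex, so its coordinate can be compared with the mixed word.\<close>
      have "\<tau> (Suc n) v = degen H n k c"
      proof (rule pm_eqI[OF pmH simplicial_map_cells[OF tau v] D])
        fix i assume i: "i < Suc n"
        have t: "edge H (Suc n) i (Suc i) (\<tau> (Suc n) v) = \<tau> 1 (edge E (Suc n) i (Suc i) v)"
          using simplicial_map_edge[OF tau v, of i "Suc i"] i by simp
        note e = edge_degen[OF simpH c k, of i "Suc i"]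
        consider "i < k" | "i = k" | j where "i = Suc j" "k \<le> j" using not0_implies_Suc by (cases i) force+
        then show "edge H (Suc n) i (Suc i) (\<tau> (Suc n) v) = edge H (Suc n) i (Suc i) (degen H n k c)"
        proof cases
          case 1
          then show ?thesis unfolding t using e i k v1'[of i] tau_section_of(1)[OF hc[of i]] by simp
        next
          case 2
          then show ?thesis unfolding t using e i v2 tau_iota[OF y] edge_degenerate[OF pmH c k] by (simp add: vertex_cell_1)
        next
          case 3
          then show ?thesis unfolding t using e i v3'[of j] tau_section_of(2)[OF hc[of j]] by (simp add: plus_1_eq_Suc)
        qed
      qed
      then obtain w where w: "w \<in> cells M (Suc n)" and vw: "pair (Suc n) w (degen H n k c) = v"
        using pair_surj[OF v] by blast
      have we: "\<forall>i<Suc n. edge M (Suc n) i (Suc i) w = mixed_word H rho \<theta> y \<theta>' n c k ! i"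
        unfolding mixed_word_pair[OF d d' y c k w] vw using v1' v2 v3' by simp
      have "mixed_word H rho \<theta> y \<theta>' n c k \<in> words M"
        by (subst words_iff[of _ "Suc n"]) (use we w k in auto)
      moreover have "mprod M (mixed_word H rho \<theta> y \<theta>' n c k) = edge M (Suc n) 0 (Suc n) w"
        by (rule mprod_eqI[OF pmM w]) (use we k in auto)
      moreover have "edge E (Suc n) 0 (Suc n) v = pair 1 (edge M (Suc n) 0 (Suc n) w) (edge H (Suc n) 0 (Suc n) (degen H n k c))"
        unfolding vw[symmetric]
        by (rule pair_edge[OF D w _ _ edge_cells_M[OF w]]) (use edge_degenerate[OF pmH D, of 0] conj_unit[OF edge_cells_M[OF w, of 0 "Suc n"]] in auto)
      moreover have "edge H (Suc n) 0 (Suc n) (degen H n k c) = edge H n 0 n c"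
        using edge_degen[OF simpH c k, of 0 "Suc n"] k by simp
      ultimately show ?thesis using v4 by simp
    qed
    show "defines_equiv H M rho \<theta> y \<theta>'"
      unfolding defines_equiv_def
    proof (intro allI ballI conjI impI)
      fix n c k assume c: "c \<in> cells H n" and k: "k \<le> n"
      show "mixed_word H rho \<theta> y \<theta>' n c k \<in> words M" using main[OF c k] by blast
      have pc: "mprod M (mixed_word H rho \<theta> y \<theta>' n c k) \<in> cells M 1" if k: "k \<le> n" for k
      proof -
        have "mixed_word H rho \<theta> y \<theta>' n c k \<in> words M" using main[OF c k] by blast
        then obtain w where w: "w \<in> cells M (Suc n)" "\<And>i. i < Suc n \<Longrightarrow> edge M (Suc n) i (Suc i) w = mixed_word H rho \<theta> y \<theta>' n c k ! i"
          by (subst (asm) words_iff[of _ "Suc n"]) (use k in auto)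
        show ?thesis using mprod_eqI[OF pmM w(1) _ w(2)] k edge_cells_M[OF w(1), of 0 "Suc n"] by simp
      qed
      show "mprod M (mixed_word H rho \<theta> y \<theta>' n c k) = mprod M (mixed_word H rho \<theta> y \<theta>' n c 0)"
        by (rule pair_inj[OF edge_cells_H[OF c, of 0 n] pc[OF k] pc[of 0]]) (use main[OF c k] main[OF c, of 0] in auto)
    qed
  }
  assume eq: "defines_equiv H M rho \<theta> y \<theta>'"
  have main: "\<exists>v \<in> cells E (Suc n).
      (\<forall>i<k. edge E (Suc n) i (Suc i) v = section_of \<theta> 1 (edge H n i (Suc i) c)) \<and>
      edge E (Suc n) k (Suc k) v = \<iota> 1 y \<and>
      (\<forall>i. k \<le> i \<longrightarrow> i < n \<longrightarrow> edge E (Suc n) (Suc i) (Suc (Suc i)) v = section_of \<theta>' 1 (edge H n i (Suc i) c)) \<and>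
      edge E (Suc n) 0 (Suc n) v = pair 1 (mprod M (mixed_word H rho \<theta> y \<theta>' n c 0)) (edge H n 0 n c)"
    if c: "c \<in> cells H n" and k: "k \<le> n" for n c k
  proof -
    have "mixed_word H rho \<theta> y \<theta>' n c k \<in> words M" using eq c k unfolding defines_equiv_def by blast
    then obtain w where w: "w \<in> cells M (Suc n)" and we: "\<forall>i<Suc n. edge M (Suc n) i (Suc i) w = mixed_word H rho \<theta> y \<theta>' n c k ! i"
      by (subst (asm) words_iff[of _ "Suc n"]) (use k in auto)
    note D = degen_cells[OF simpH c k]
    have "edge E (Suc n) 0 (Suc n) (pair (Suc n) w (degen H n k c)) =
      pair 1 (edge M (Suc n) 0 (Suc n) w) (edge H (Suc n) 0 (Suc n) (degen H n k c))"
      by (rule pair_edge[OF D w _ _ edge_cells_M[OF w]]) (use edge_degenerate[OF pmH D, of 0] conj_unit[OF edge_cells_M[OF w, of 0 "Suc n"]] in auto)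
    also have "edge H (Suc n) 0 (Suc n) (degen H n k c) = edge H n 0 n c"
      using edge_degen[OF simpH c k, of 0 "Suc n"] k by simp
    also have "edge M (Suc n) 0 (Suc n) w = mprod M (mixed_word H rho \<theta> y \<theta>' n c k)"
      by (rule mprod_eqI[OF pmM w, symmetric]) (use we k in auto)
    also have "\<dots> = mprod M (mixed_word H rho \<theta> y \<theta>' n c 0)" using eq c k unfolding defines_equiv_def by blast
    finally show ?thesis
      using we[unfolded mixed_word_pair[OF d d' y c k w]] pair_cells[OF D w] by blast
  qed
  show "htpy H E (section_of \<theta>) (\<iota> 1 y) (section_of \<theta>')"
  proof (rule htpyI[OF pmE pmH sm iota_cells[OF y]])
    fix n c k assume "c \<in> cells H n" and "k \<le> (n::nat)"
    from main[OF this] show "\<exists>v \<in> cells E (Suc n).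
      (\<forall>i<k. edge E (Suc n) i (Suc i) v = section_of \<theta> 1 (edge H n i (Suc i) c)) \<and>
      edge E (Suc n) k (Suc k) v = \<iota> 1 y \<and>
      (\<forall>i. k \<le> i \<longrightarrow> i < n \<longrightarrow> edge E (Suc n) (Suc i) (Suc (Suc i)) v = section_of \<theta>' 1 (edge H n i (Suc i) c))" by blast
  next
    fix h assume h: "h \<in> cells H 1"
    \<comment> \<open>For n = 1 the mixed words with k = 0 and k = 1 are the two ways around the
      square over h.\<close>
    let ?p = "pair 1 (mprod M (mixed_word H rho \<theta> y \<theta>' 1 h 0)) (edge H 1 0 1 h)"
    obtain v where v: "v \<in> cells E 2" "edge E 2 0 1 v = \<iota> 1 y" "edge E 2 1 2 v = section_of \<theta>' 1 h" "edge E 2 0 2 v = ?p"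
      using main[OF h, of 0] edge_id[OF simpH h] by auto
    obtain u where u: "u \<in> cells E 2" "edge E 2 0 1 u = section_of \<theta> 1 h" "edge E 2 1 2 u = \<iota> 1 y" "edge E 2 0 2 u = ?p"
      using main[OF h, of 1] edge_id[OF simpH h] by auto
    show "\<exists>c. mul E (section_of \<theta> 1 h) (\<iota> 1 y) c \<and> mul E (\<iota> 1 y) (section_of \<theta>' 1 h) c"
      unfolding mul_def using u v by blast
  qed
qed

text \<open>Reversal takes an inversion on the target, here that of E. Sections commute with the
  inversions, so the ends of the reversed homotopy are again s' and s.\<close>

lemma htpy_sym:
  assumes s: "s \<in> sections E \<tau> H" and s': "s' \<in> sections E \<tau> H" and h: "htpy H E s x s'"
  shows "htpy H E s' (inv1 E x) s"
proof -
  have sm: "simplicial_map H E s" "simplicial_map H E s'"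
    using s s' by (auto simp: sections_def Hom_def)
  obtain K where K: "smap2 H 1 E K"
    and K0: "\<And>n c. c \<in> cells H n \<Longrightarrow> K n c (replicate (Suc n) 0) = s n c"
    and K1: "\<And>n c. c \<in> cells H n \<Longrightarrow> K n c (replicate (Suc n) 1) = s' n c"
    and Kx: "K 1 (unit H) [0, 1] = x"
    using h unfolding htpy_iff by blast
  have rep: "revl (replicate (Suc n) 0) = replicate (Suc n) 1" "revl (replicate (Suc n) 1) = replicate (Suc n) 0" for n
    by (auto simp: revl_def map_replicate_const)
  show ?thesis
    unfolding htpy_iff
  proof (intro exI conjI allI ballI)
    show "smap2 H 1 E (\<lambda>m c \<alpha>. nu E m (K m (nu H m c) (revl \<alpha>)))" by (rule smap2_reverse[OF pgE pgH K])
    show "nu E n (K n (nu H n c) (revl (replicate (Suc n) 0))) = s' n c" if c: "c \<in> cells H n" for n c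
      using K1[OF nu_cells[OF pgH c]] simplicial_map_nu[OF pgH pgE sm(2) c] nu_nu[OF pgE simplicial_map_cells[OF sm(2) c]]
      unfolding rep by simp
    show "nu E n (K n (nu H n c) (revl (replicate (Suc n) 1))) = s n c" if c: "c \<in> cells H n" for n c
      using K0[OF nu_cells[OF pgH c]] simplicial_map_nu[OF pgH pgE sm(1) c] nu_nu[OF pgE simplicial_map_cells[OF sm(1) c]]
      unfolding rep by simp
    show "nu E 1 (K 1 (nu H 1 (unit H)) (revl [0, 1])) = inv1 E x"
      using Kx inv1_unit[OF pgH] by (simp add: revl_def)
  qed
qed

text \<open>If \<open>T = \<tau> \<circ> K\<close> is the homotopy of the identity of H below a homotopy K of sections and T'
  is its reverse, then \<open>(c, \<alpha>) \<mapsto> K(T'(c, \<alpha>), \<alpha>)\<close> is a homotopy between the same sections and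
  has its element in the fibre.\<close>

lemma htpy_fibre:
  assumes s: "s \<in> sections E \<tau> H" and s': "s' \<in> sections E \<tau> H" and h: "htpy H E s x s'"
  shows "\<exists>y \<in> cells M 1. htpy H E s (\<iota> 1 y) s'"
proof -
  obtain K where K: "smap2 H 1 E K"
    and K0: "\<And>n c. c \<in> cells H n \<Longrightarrow> K n c (replicate (Suc n) 0) = s n c"
    and K1: "\<And>n c. c \<in> cells H n \<Longrightarrow> K n c (replicate (Suc n) 1) = s' n c"
    using h unfolding htpy_iff by blast
  define T where "T = (\<lambda>m c \<alpha>. \<tau> m (K m c \<alpha>))"
  have T: "smap2 H 1 H T" unfolding T_def by (rule smap2_post[OF K tau])
  have T0: "T n c (replicate (Suc n) 0) = c" "T n c (replicate (Suc n) 1) = c" if "c \<in> cells H n" for n c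
    using K0[OF that] K1[OF that] s s' that by (auto simp: T_def sections_def)
  define T' where "T' = (\<lambda>m c \<alpha>. nu H m (T m (nu H m c) (revl \<alpha>)))"
  have T': "smap2 H 1 H T'" unfolding T'_def by (rule smap2_reverse[OF pgH pgH T])
  have rep: "revl (replicate (Suc n) 0) = replicate (Suc n) 1" "revl (replicate (Suc n) 1) = replicate (Suc n) 0" for n
    by (auto simp: revl_def map_replicate_const)
  have T'0: "T' n c (replicate (Suc n) 0) = c" "T' n c (replicate (Suc n) 1) = c" if c: "c \<in> cells H n" for n c
    using T0[OF nu_cells[OF pgH c]] nu_nu[OF pgH c] unfolding T'_def rep by auto
  let ?G = "\<lambda>m c \<alpha>. K m (T' m c \<alpha>) \<alpha>"
  have G: "smap2 H 1 E ?G" by (rule smap2_comp[OF T' K])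
  define z where "z = T 1 (unit H) [0, 1]"
  have u: "unit H \<in> cells H 1" by (rule unit_cells[OF pmH])
  have z: "z \<in> cells H 1" unfolding z_def by (rule smap2_cells[OF T u]) simp
  have T'u: "T' 1 (unit H) [0, 1] = inv1 H z"
    using inv1_unit[OF pgH] by (simp add: T'_def z_def revl_def)
  note iz = inv1_cells[OF pgH z]
  have T00: "T 1 (inv1 H z) [0, 0] = inv1 H z" using T0(1)[OF iz] unfolding replicate_2 .
  \<comment> \<open>With z the image in H of the old element, the new element lies over z\<inverse>
    z: the first factor is contributed by T', the second by K.\<close>
  have "mul H (inv1 H z) z (T 1 (inv1 H z) [0, 1])"
    using smap2_mul_left[OF pmH pmH T iz, of 0 1] T00 by (simp add: z_def)
  then have "\<tau> 1 (?G 1 (unit H) [0, 1]) = unit H"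
    unfolding T'u using inv1_mul[OF pgH z] mul_fun[OF pmH] by (auto simp: T_def)
  moreover have "?G 1 (unit H) [0, 1] \<in> cells E 1" by (rule smap2_cells[OF G u]) simp
  ultimately have f: "?G 1 (unit H) [0, 1] \<in> fibre 1" by (simp add: fibre_def vertex_cell_1)
  show ?thesis
  proof (rule bexI[OF _ kappa_cells[OF f]])
    show "htpy H E s (\<iota> 1 (\<kappa> 1 (?G 1 (unit H) [0, 1]))) s'"
      unfolding iota_kappa[OF f] htpy_iff
      by (rule exI[of _ ?G]) (use G T'0 K0 K1 in auto)
  qed
qed

lemma regular_section_correspondence:
  "\<exists>\<rho> \<in> actions H M. conjugation_action M \<iota> E H \<sigma> \<rho> \<and>
    (\<exists>\<phi> \<Phi>.
       bij_betw \<phi> (derivations H M \<rho>) (sections E \<tau> H) \<and>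
       (\<forall>\<theta> \<in> derivations H M \<rho>. \<forall>h \<in> cells H 1.
          [\<iota> 1 (\<theta> 1 h), \<sigma> 1 h] \<in> words E \<and>
          \<phi> \<theta> 1 h = mprod E [\<iota> 1 (\<theta> 1 h), \<sigma> 1 h]) \<and>
       bij_betw \<Phi> (H1 H M \<rho>) (section_classes E \<tau> H) \<and>
       (\<forall>\<theta> \<in> derivations H M \<rho>.
          \<Phi> (derivation_equiv H M \<rho> `` {\<theta>}) = section_equiv E \<tau> H `` {\<phi> \<theta>}) \<and>
       (\<forall>\<theta> \<in> derivations H M \<rho>.
          regular_derivation H M \<theta> \<longleftrightarrow> regular_section M \<iota> E H (\<phi> \<theta>)))"
proof -
  let ?A = "derivations H M rho" and ?B = "sections E \<tau> H"
  let ?R = "{(\<theta>, \<theta>'). \<theta> \<in> ?A \<and> \<theta>' \<in> ?A \<and> (\<exists>y \<in> cells M 1. defines_equiv H M rho \<theta> y \<theta>')}"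
  let ?S = "{(s, s'). s \<in> ?B \<and> s' \<in> ?B \<and> (\<exists>x \<in> cells E 1. htpy H E s x s')}"
  have RS: "(\<theta>, \<theta>') \<in> ?R \<longleftrightarrow> (section_of \<theta>, section_of \<theta>') \<in> ?S" if d: "\<theta> \<in> ?A" "\<theta>' \<in> ?A" for \<theta> \<theta>'
  proof -
    have "(\<exists>y \<in> cells M 1. defines_equiv H M rho \<theta> y \<theta>') \<longleftrightarrow> (\<exists>y \<in> cells M 1. htpy H E (section_of \<theta>) (\<iota> 1 y) (section_of \<theta>'))"
      using htpy_iff_defines_equiv[OF d] by blast
    also have "\<dots> \<longleftrightarrow> (\<exists>x \<in> cells E 1. htpy H E (section_of \<theta>) x (section_of \<theta>'))"
      using htpy_fibre[OF section_of_section[OF d(1)] section_of_section[OF d(2)]] iota_cells by blast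
    finally show ?thesis using d section_of_section by auto
  qed
  have "sym ?S"
    using htpy_sym inv1_cells[OF pgE] by (intro symI) blast
  from quotient_bij[OF section_of_bij _ _ this RS]
  obtain \<Phi> where \<Phi>: "bij_betw \<Phi> (?A // (?R \<union> ?R\<inverse>)\<^sup>*) (?B // ?S\<^sup>*)"
    "\<And>\<theta>. \<theta> \<in> ?A \<Longrightarrow> \<Phi> ((?R \<union> ?R\<inverse>)\<^sup>* `` {\<theta>}) = ?S\<^sup>* `` {section_of \<theta>}"
    by blast
  have de: "derivation_equiv H M rho = (?R \<union> ?R\<inverse>)\<^sup>*" by (simp add: derivation_equiv_def Let_def)
  have se: "section_equiv E \<tau> H = ?S\<^sup>*" by (simp add: section_equiv_def)
  show ?thesis
  proof (intro bexI[OF _ rho_actions] conjI exI ballI)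
    show "conjugation_action M \<iota> E H \<sigma> rho" by (rule rho_conjugation)
    show "bij_betw section_of ?A ?B" by (rule section_of_bij)
    show "bij_betw \<Phi> (H1 H M rho) (section_classes E \<tau> H)"
      unfolding H1_def section_classes_def de se by (rule \<Phi>(1))
    fix \<theta> assume d: "\<theta> \<in> ?A"
    show "\<Phi> (derivation_equiv H M rho `` {\<theta>}) = section_equiv E \<tau> H `` {section_of \<theta>}"
      unfolding de se by (rule \<Phi>(2)[OF d])
    show "regular_derivation H M \<theta> = regular_section M \<iota> E H (section_of \<theta>)" by (rule section_of_regular[OF d])
    fix h assume h: "h \<in> cells H 1"
    show "[\<iota> 1 (\<theta> 1 h), \<sigma> 1 h] \<in> words E" using section_of_mul[OF d h] words_pair_iff[OF pmE] by blast
    show "section_of \<theta> 1 h = mprod E [\<iota> 1 (\<theta> 1 h), \<sigma> 1 h]" using mprod_pair[OF pmE section_of_mul[OF d h]] by simp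
  qed
qed

end

section \<open>The obstruction class\<close>

text \<open>Solves b' a' z = p for z, where b and a undo b' and a'. With partial products this takes
  a single simplex that contains all factors: [a|b|p] is its face without the vertices 3 and 4, and
  the product from the left collapses to z. The coboundary equation is solved in both directions by
  it, for \<eta> and for \<theta>(gh).\<close>

lemma word5:
  assumes M: "partial_monoid M" and u: "u \<in> cells M 5"
    and e: "edge M 5 0 1 u = a" "edge M 5 1 2 u = b" "edge M 5 2 3 u = b'" "edge M 5 3 4 u = a'" "edge M 5 4 5 u = z"
    and aa: "mul M a a' (unit M)" and bb: "mul M b b' (unit M)"
    and p: "mprod M [b', a', z] = p"
  shows "[a, b, p] \<in> words M" and "mprod M [a, b, p] = z"
proof -
  note S = pm_simplicial[OF M]
  have m1: "[2, 3, 4, 5] \<in> mono_maps 3 5" and m2: "[0, 1, 2, 5] \<in> mono_maps 3 5"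
    by (auto simp: mono_maps_def)
  have i3: "i = 0 \<or> i = 1 \<or> i = 2" if "i < 3" for i :: nat using that by arith
  have "mprod M [b', a', z] = edge M 3 0 3 (act M 5 [2, 3, 4, 5] u)"
    by (rule mprod_eqI[OF M act_cells[OF S m1 u]]) (use e in \<open>auto simp: edge_act[OF S m1 u] dest!: i3\<close>)
  then have p': "edge M 5 2 5 u = p" using p by (simp add: edge_act[OF S m1 u])
  have e13: "edge M 5 1 3 u = unit M"
    using mul_edges[OF S u, of 1 2 3] e bb mul_fun[OF M] by auto
  have a: "a \<in> cells M 1" and z: "z \<in> cells M 1" using edge_cells[OF S u] e by auto
  have e03: "edge M 5 0 3 u = a"
    using mul_edges[OF S u, of 0 1 3] e e13 mul_unit_right[OF M a] mul_fun[OF M] by auto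
  have e04: "edge M 5 0 4 u = unit M"
    using mul_edges[OF S u, of 0 3 4] e e03 aa mul_fun[OF M] by auto
  have e05: "edge M 5 0 5 u = z"
    using mul_edges[OF S u, of 0 4 5] e e04 mul_unit_left[OF M z] mul_fun[OF M] by auto
  let ?v = "act M 5 [0, 1, 2, 5] u"
  have v: "?v \<in> cells M 3" by (rule act_cells[OF S m2 u])
  have ve: "edge M 3 i (Suc i) ?v = [a, b, p] ! i" if "i < 3" for i
    using i3[OF that] e p' by (auto simp: edge_act[OF S m2 u])
  show "[a, b, p] \<in> words M" by (subst words_iff[of _ 3]) (use v ve in auto)
  have "mprod M [a, b, p] = edge M 3 0 3 ?v" by (rule mprod_eqI[OF M v _ ve]) auto
  then show "mprod M [a, b, p] = z" using e05 by (simp add: edge_act[OF S m2 u])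
qed

lemma words5:
  assumes "[a, b, c, d, e] \<in> words M"
  shows "\<exists>u \<in> cells M 5. edge M 5 0 1 u = a \<and> edge M 5 1 2 u = b \<and> edge M 5 2 3 u = c \<and> edge M 5 3 4 u = d \<and> edge M 5 4 5 u = e"
proof -
  obtain u where u: "u \<in> cells M 5" and "\<forall>i<5. edge M 5 i (Suc i) u = [a, b, c, d, e] ! i"
    using assms by (subst (asm) words_iff[of _ 5]) auto
  then show ?thesis
    by (intro bexI[OF _ u]) (auto dest: spec[of _ 0] spec[of _ 1] spec[of _ 2] spec[of _ 3] spec[of _ 4])
qed

lemma mprod3_unit:
  assumes M: "partial_monoid M" and "mul M a b c"
  shows "mprod M [a, b, unit M] = c"
proof -
  note S = pm_simplicial[OF M]
  obtain u where u: "u \<in> cells M 2" "edge M 2 0 1 u = a" "edge M 2 1 2 u = b" "edge M 2 0 2 u = c"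
    using assms(2) unfolding mul_def by blast
  have d: "[0, 1, 2, 2] \<in> mono_maps 3 2" by (auto simp: mono_maps_def)
  have i3: "i = 0 \<or> i = 1 \<or> i = 2" if "i < 3" for i :: nat using that by arith
  have "mprod M [a, b, unit M] = edge M 3 0 3 (act M 2 [0, 1, 2, 2] u)"
    by (rule mprod_eqI[OF M act_cells[OF S d u(1)]])
      (use u edge_degenerate[OF M u(1), of 2] in \<open>auto simp: edge_act[OF S d u(1)] dest!: i3\<close>)
  then show ?thesis using u by (simp add: edge_act[OF S d u(1)])
qed

lemma single_word: "partial_monoid M \<Longrightarrow> x \<in> cells M 1 \<Longrightarrow> [x] \<in> words M"
  by (subst words_iff[of _ 1]) (auto simp: edge_id pm_simplicial intro!: bexI[of _ x])

locale twisted_extension = partial_group_extension M \<iota> E \<tau> H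
  for M :: "'a sset" and \<iota> :: "nat \<Rightarrow> 'a \<Rightarrow> 'e" and E :: "'e sset" and \<tau> :: "nat \<Rightarrow> 'e \<Rightarrow> 'h" and H :: "'h sset" +
  fixes t :: "'h \<Rightarrow> nat \<Rightarrow> 'a \<Rightarrow> 'a" and \<eta> :: "'h \<Rightarrow> 'h \<Rightarrow> 'a" and \<psi> :: "nat \<Rightarrow> 'e \<Rightarrow> ('a \<times> 'h) list"
  assumes tp: "twisting_pair M H t \<eta>"
    and psi_iso: "simplicial_iso E (twisted_product M H t \<eta>) \<psi>"
    and psi_incl: "\<forall>n. \<forall>x \<in> cells M n. \<psi> n (\<iota> n x) = twisted_incl M H n x"
    and psi_proj: "\<forall>n. \<forall>e \<in> cells E n. twisted_proj H n (\<psi> n e) = \<tau> n e"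
begin

abbreviation "E' \<equiv> twisted_product M H t \<eta>"
abbreviation "tm \<equiv> twisted_mult M H t \<eta>"
abbreviation "e0 \<equiv> (unit M, unit H)"

section \<open>The elements (x, g) of a twisted product\<close>

lemma t_iso: "g \<in> cells H 1 \<Longrightarrow> simplicial_iso M M (t g)"
  using tp by (simp add: twisting_pair_def Aut_def)

lemma t_map: "g \<in> cells H 1 \<Longrightarrow> simplicial_map M M (t g)"
  using t_iso by (simp add: simplicial_iso_def)

lemma t_cells: "g \<in> cells H 1 \<Longrightarrow> x \<in> cells M n \<Longrightarrow> t g n x \<in> cells M n"
  by (rule simplicial_map_cells[OF t_map])

lemma t_unit: "x \<in> cells M n \<Longrightarrow> t (unit H) n x = x"
  using tp by (simp add: twisting_pair_def Aut_def)

lemma eta_NN: "[g, h] \<in> words H \<Longrightarrow> \<eta> g h \<in> NN M"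
  using tp by (simp add: twisting_pair_def)

lemma eta_unit: "g \<in> cells H 1 \<Longrightarrow> \<eta> g (unit H) = unit M" "g \<in> cells H 1 \<Longrightarrow> \<eta> (unit H) g = unit M"
  using tp by (auto simp: twisting_pair_def)

lemma psi: "simplicial_map E E' \<psi>" and psi_bij: "bij_betw (\<psi> n) (cells E n) (cells E' n)"
  using psi_iso by (auto simp: simplicial_iso_def)

lemma uM: "unit M \<in> cells M 1" and uH: "unit H \<in> cells H 1"
  by (auto intro: unit_cells pmM pmH)

lemma cells_E'_iff: "ps \<in> cells E' n \<longleftrightarrow> length ps = n \<and> set ps \<subseteq> cells M 1 \<times> cells H 1 \<and>
    map snd ps \<in> words H \<and> untwist t ps \<in> words M"
  by (simp add: twisted_product_def)

lemma edge_E': "edge E' n i j ps = [foldl tm e0 (map ((!) ps) [i..<j])]"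
  by (simp add: twisted_product_def)

lemma mprod_H: "g \<in> cells H 1 \<Longrightarrow> mprod H [unit H, g] = g" "g \<in> cells H 1 \<Longrightarrow> mprod H [g, unit H] = g"
  by (auto intro: mprod_pair pmH mul_unit_left mul_unit_right)

lemma tm_e0: "x \<in> cells M 1 \<Longrightarrow> g \<in> cells H 1 \<Longrightarrow> tm e0 (x, g) = (x, g)"
  by (simp add: twisted_mult_def t_unit eta_unit mprod_H mprod3_unit[OF pmM mul_unit_left[OF pmM]])

lemma tm_iota: "x \<in> cells M 1 \<Longrightarrow> g \<in> cells H 1 \<Longrightarrow> tm (x, unit H) (unit M, g) = (x, g)"
  by (simp add: twisted_mult_def t_unit uM eta_unit mprod_H mprod3_unit[OF pmM mul_unit_right[OF pmM]])

lemma tm_conj: "x \<in> cells M 1 \<Longrightarrow> g \<in> cells H 1 \<Longrightarrow> tm (unit M, g) (x, unit H) = (t g 1 x, g)"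
  by (simp add: twisted_mult_def eta_unit mprod_H t_cells mprod3_unit[OF pmM mul_unit_left[OF pmM]])

definition el :: "'a \<Rightarrow> 'h \<Rightarrow> 'e" where
  "el x g = inv_into (cells E 1) (\<psi> 1) [(x, g)]"

lemma pair_E': "x \<in> cells M 1 \<Longrightarrow> g \<in> cells H 1 \<Longrightarrow> [(x, g)] \<in> cells E' 1"
  by (simp add: cells_E'_iff single_word pmM pmH)

lemma el: assumes "x \<in> cells M 1" "g \<in> cells H 1"
  shows "el x g \<in> cells E 1" and "\<psi> 1 (el x g) = [(x, g)]"
proof -
  show "el x g \<in> cells E 1"
    unfolding el_def by (rule inv_into_into) (use psi_bij[of 1] pair_E'[OF assms] in \<open>simp add: bij_betw_def\<close>)
  show "\<psi> 1 (el x g) = [(x, g)]"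
    unfolding el_def by (rule bij_betw_inv_into_right[OF psi_bij pair_E'[OF assms]])
qed

lemma el_eqI: "e \<in> cells E 1 \<Longrightarrow> \<psi> 1 e = [(x, g)] \<Longrightarrow> e = el x g"
  unfolding el_def using bij_betw_inv_into_left[OF psi_bij] by metis

lemma el_ex:
  assumes e: "e \<in> cells E 1"
  shows "\<exists>x \<in> cells M 1. e = el x (\<tau> 1 e)"
proof -
  have "\<psi> 1 e \<in> cells E' 1" by (rule simplicial_map_cells[OF psi e])
  then have l: "length (\<psi> 1 e) = 1" and s: "set (\<psi> 1 e) \<subseteq> cells M 1 \<times> cells H 1"
    by (auto simp: cells_E'_iff)
  then obtain x g where xg: "\<psi> 1 e = [(x, g)]"
    by (cases "\<psi> 1 e") (auto simp: One_nat_def simp del: Suc_0_eq_1)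
  have x: "x \<in> cells M 1" and g: "g \<in> cells H 1" using s xg by auto
  have "\<tau> 1 e = word H [g]" using psi_proj e xg by (metis list.simps(8) list.simps(9) snd_conv twisted_proj_def)
  also have "\<dots> = g" by (rule word_eqI[OF pmH g]) (auto simp: edge_id[OF simpH g])
  finally show ?thesis using el_eqI[OF e xg] x by blast
qed

lemma el_inj: "x \<in> cells M 1 \<Longrightarrow> y \<in> cells M 1 \<Longrightarrow> g \<in> cells H 1 \<Longrightarrow> el x g = el y g \<Longrightarrow> x = y"
  using el(2) by (metis list.inject prod.inject)

lemma iota_el: "x \<in> cells M 1 \<Longrightarrow> \<iota> 1 x = el x (unit H)"
  by (rule el_eqI[OF iota_cells]) (use psi_incl in \<open>auto simp: twisted_incl_def spine_def edge_id[OF simpM]\<close>)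

lemma E'_simplex:
  assumes ps: "ps \<in> cells E' n"
  shows "\<exists>e \<in> cells E n. (\<forall>i<n. edge E n i (Suc i) e = el (fst (ps ! i)) (snd (ps ! i))) \<and>
    (\<forall>i j. i \<le> j \<longrightarrow> j \<le> n \<longrightarrow> edge E n i j e =
      el (fst (foldl tm e0 (map ((!) ps) [i..<j]))) (snd (foldl tm e0 (map ((!) ps) [i..<j])))) \<and> \<psi> n e = ps"
proof -
  have "ps \<in> \<psi> n ` cells E n" using psi_bij[of n] ps by (simp add: bij_betw_def)
  then obtain e where e: "e \<in> cells E n" and pe: "\<psi> n e = ps" by blast
  have 1: "edge E n i j e = el (fst (foldl tm e0 (map ((!) ps) [i..<j]))) (snd (foldl tm e0 (map ((!) ps) [i..<j])))"
    if ij: "i \<le> j" "j \<le> n" for i j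
    by (rule el_eqI[OF edge_cells[OF simpE e ij]])
      (use simplicial_map_edge[OF psi e ij] pe edge_E' in simp)
  have 2: "edge E n i (Suc i) e = el (fst (ps ! i)) (snd (ps ! i))" if i: "i < n" for i
  proof -
    have "ps ! i \<in> cells M 1 \<times> cells H 1" using ps i nth_mem[of i ps] by (auto simp: cells_E'_iff)
    then have "tm e0 (ps ! i) = ps ! i" using tm_e0[of "fst (ps ! i)" "snd (ps ! i)"] by (auto simp: mem_Times_iff)
    then show ?thesis using 1[of i "Suc i"] i by (simp add: upt_Suc)
  qed
  show ?thesis using e pe 1 2 by blast
qed

text \<open>Untwisting the word of this 2-simplex gives [x|t(g)(z)]. So its existence does not
  involve \<eta>(g, h), although its product does.\<close>

lemma el_mul:
  assumes x: "x \<in> cells M 1" and g: "g \<in> cells H 1" and z: "z \<in> cells M 1" and h: "h \<in> cells H 1"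
    and gh: "[g, h] \<in> words H" and w: "[x, t g 1 z] \<in> words M"
  shows "mul E (el x g) (el z h) (el (fst (tm (x, g) (z, h))) (snd (tm (x, g) (z, h))))"
proof -
  have "[(x, g), (z, h)] \<in> cells E' 2" using assms by (auto simp: cells_E'_iff)
  then obtain e where e: "e \<in> cells E 2" "edge E 2 0 1 e = el x g" "edge E 2 1 2 e = el z h"
    "edge E 2 0 2 e = el (fst (foldl tm e0 (map ((!) [(x, g), (z, h)]) [0..<2])))
      (snd (foldl tm e0 (map ((!) [(x, g), (z, h)]) [0..<2])))"
    using E'_simplex[of "[(x, g), (z, h)]" 2] by (auto simp: all_less_2)
  have l: "map ((!) [(x, g), (z, h)]) [0..<2] = [(x, g), (z, h)]" by (simp add: numeral_2_eq_2 upt_conv_Cons del: Suc_0_eq_1)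
  show ?thesis unfolding mul_def using e tm_e0[OF x g] unfolding l by auto
qed

text \<open>The two factorisations show that conjugation by (1, g) acts on the fibre as t(g); this
  predicts the other end of the homotopy in \<open>s_htpy\<close>.\<close>

lemma s_mul:
  assumes x: "x \<in> cells M 1" and g: "g \<in> cells H 1"
  shows "mul E (\<iota> 1 x) (el (unit M) g) (el x g)" and "mul E (el (unit M) g) (\<iota> 1 x) (el (t g 1 x) g)"
proof -
  have w: "[a, unit M] \<in> words M" "[unit M, a] \<in> words M" if "a \<in> cells M 1" for a
    using that words_pair_iff[OF pmM] mul_unit_right[OF pmM] mul_unit_left[OF pmM] by blast+
  have wH: "[g, unit H] \<in> words H" "[unit H, g] \<in> words H"
    using g words_pair_iff[OF pmH] mul_unit_right[OF pmH] mul_unit_left[OF pmH] by blast+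
  show "mul E (\<iota> 1 x) (el (unit M) g) (el x g)"
    using el_mul[OF x uH uM g wH(2)] w(1)[OF x] by (simp add: t_unit uM tm_iota x g iota_el)
  show "mul E (el (unit M) g) (\<iota> 1 x) (el (t g 1 x) g)"
    using el_mul[OF uM g x uH wH(1)] w(2)[OF t_cells[OF g x]] by (simp add: tm_conj x g iota_el)
qed

lemma untwist_cells: "set ps \<subseteq> cells M 1 \<times> cells H 1 \<Longrightarrow> set (untwist t ps) \<subseteq> cells M 1"
  by (induction ps) (auto intro!: t_cells)

lemma untwist_unit:
  assumes "set xs \<subseteq> cells M 1" "set ps \<subseteq> cells M 1 \<times> cells H 1"
  shows "untwist t (map (\<lambda>x. (x, unit H)) xs @ ps) = xs @ untwist t ps"
  using assms(1)
proof (induction xs)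
  case (Cons x xs)
  have "set (xs @ untwist t ps) \<subseteq> cells M 1" using Cons.prems untwist_cells[OF assms(2)] by auto
  then have "map (t (unit H) 1) (xs @ untwist t ps) = xs @ untwist t ps"
    by (intro map_idI) (auto simp: t_unit)
  with Cons show ?case by simp
qed simp

text \<open>The top simplices of the prisms exist because the words that they require untwist to
  degeneracies of t(g)(y): the entries after (1, g) receive t(g), those before it carry it
  already.\<close>

lemma s_htpy:
  assumes g: "g \<in> cells H 1"
  shows "htpy M E (\<lambda>n. \<iota> n \<circ> t g n) (el (unit M) g) \<iota>"
proof (rule htpyI[OF pmE pmM simplicial_map_comp[OF t_map[OF g] iota] iota el(1)[OF uM g]])
  fix n y k assume y: "y \<in> cells M n" and k: "k \<le> n"
  let ?e = "\<lambda>i. edge M n i (Suc i) y"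
  have ec: "?e i \<in> cells M 1" if "i < n" for i by (rule edge_cells[OF simpM y]) (use that in auto)
  let ?xs = "map (\<lambda>i. t g 1 (?e i)) [0..<k]" and ?ys = "map ?e [k..<n]"
  let ?ps = "map (\<lambda>x. (x, unit H)) ?xs @ (unit M, g) # map (\<lambda>x. (x, unit H)) ?ys"
  have xs: "set ?xs \<subseteq> cells M 1" using ec k t_cells[OF g] by auto
  have ys: "set ?ys \<subseteq> cells M 1" using ec by auto
  have ps2: "set ((unit M, g) # map (\<lambda>x. (x, unit H)) ?ys) \<subseteq> cells M 1 \<times> cells H 1" using ys uM uH g by auto
  have nth: "?ps ! i = (if i < k then (t g 1 (?e i), unit H) else if i = k then (unit M, g) else (?e (i - 1), unit H))"
    if "i < Suc n" for i
    using that k by (auto simp: nth_append nth_Cons')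
  have len: "length ?ps = Suc n" using k by simp
  have "?ps \<in> cells E' (Suc n)"
    unfolding cells_E'_iff
  proof (intro conjI)
    show "length ?ps = Suc n" by (rule len)
    show "set ?ps \<subseteq> cells M 1 \<times> cells H 1" using xs ys uM uH g by auto
    show "map snd ?ps \<in> words H"
    proof (subst words_iff[of _ "Suc n"])
      show "length (map snd ?ps) = Suc n" using len by simp
      \<comment> \<open>Pulled back along \<open>step (Suc k) (Suc n)\<close>, the edge g gets a
        spine of units with g at the place k.\<close>
      show "\<exists>u \<in> cells H (Suc n). \<forall>i<Suc n. edge H (Suc n) i (Suc i) u = map snd ?ps ! i"
      proof (intro bexI allI impI)
        fix i assume i: "i < Suc n"
        have "map snd ?ps ! i = snd (?ps ! i)" using i len by (intro nth_map) simp
        then show "edge H (Suc n) i (Suc i) (act H 1 (step (Suc k) (Suc n)) g) = map snd ?ps ! i"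
          using i nth[OF i] edge_degenerate[OF pmH g, of 0] edge_degenerate[OF pmH g, of 1] edge_id[OF simpH g]
          by (simp add: edge_act[OF simpH step_mono g] step_nth)
      qed (rule act_cells[OF simpH step_mono g])
    qed
    have u: "untwist t ?ps = ?xs @ unit M # map (t g 1) ?ys"
      using untwist_unit[OF xs ps2] untwist_unit[OF ys, of "[]"] by simp
    show "untwist t ?ps \<in> words M"
      unfolding u
    proof (subst words_iff[of _ "Suc n"])
      let ?D = "degen M n k (t g n y)"
      note ty = t_cells[OF g y]
      have "edge M (Suc n) i (Suc i) ?D = (?xs @ unit M # map (t g 1) ?ys) ! i" if i: "i < Suc n" for i
      proof -
        consider "i < k" | "i = k" | j where "i = Suc j" "k \<le> j" using not0_implies_Suc by (cases i) force+
        then show ?thesis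
          using i k simplicial_map_edge[OF t_map[OF g] y, of i "Suc i"]
            simplicial_map_edge[OF t_map[OF g] y, of "i - 1" i]
            edge_degen[OF simpM ty k, of i "Suc i"] edge_degenerate[OF pmM ty k]
          by cases (auto simp: nth_append plus_1_eq_Suc)
      qed
      then show "\<exists>u \<in> cells M (Suc n). \<forall>i<Suc n. edge M (Suc n) i (Suc i) u = (?xs @ unit M # map (t g 1) ?ys) ! i"
        using degen_cells[OF simpM ty k] by blast
    qed (use k in simp)
  qed
  then obtain v where v: "v \<in> cells E (Suc n)" and ve: "\<And>i. i < Suc n \<Longrightarrow> edge E (Suc n) i (Suc i) v = el (fst (?ps ! i)) (snd (?ps ! i))"
    using E'_simplex[of ?ps "Suc n"] by blast
  show "\<exists>v \<in> cells E (Suc n).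
      (\<forall>i<k. edge E (Suc n) i (Suc i) v = (\<iota> 1 \<circ> t g 1) (edge M n i (Suc i) y)) \<and>
      edge E (Suc n) k (Suc k) v = el (unit M) g \<and>
      (\<forall>i. k \<le> i \<longrightarrow> i < n \<longrightarrow> edge E (Suc n) (Suc i) (Suc (Suc i)) v = \<iota> 1 (edge M n i (Suc i) y))"
  proof (rule bexI[OF _ v], intro conjI allI impI)
    fix i assume "i < k"
    then show "edge E (Suc n) i (Suc i) v = (\<iota> 1 \<circ> t g 1) (?e i)"
      using k ve[of i] nth[of i] iota_el[OF t_cells[OF g ec[of i]]] by simp
  next
    show "edge E (Suc n) k (Suc k) v = el (unit M) g" using k ve[of k] nth[of k] by simp
  next
    fix i assume "k \<le> i" "i < n"
    then show "edge E (Suc n) (Suc i) (Suc (Suc i)) v = \<iota> 1 (?e i)"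
      using k ve[of "Suc i"] nth[of "Suc i"] iota_el[OF ec[of i]] by simp
  qed
next
  fix y assume y: "y \<in> cells M 1"
  show "\<exists>c. mul E ((\<iota> 1 \<circ> t g 1) y) (el (unit M) g) c \<and> mul E (el (unit M) g) (\<iota> 1 y) c"
    using s_mul(1)[OF t_cells[OF g y] g] s_mul(2)[OF y g] by auto
qed

text \<open>The end at the vertex 0 is \<iota> after t(g), and t(g) is an automorphism for any
  twisting pair.\<close>

lemma s_strong:
  assumes g: "g \<in> cells H 1"
  shows "\<exists>K. strong_ihtpy K \<and> K 1 (unit M) [0, 1] = el (unit M) g"
proof -
  obtain K where K: "smap2 M 1 E K"
    and K0: "\<And>n y. y \<in> cells M n \<Longrightarrow> K n y (replicate (Suc n) 0) = \<iota> n (t g n y)"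
    and K1: "\<And>n y. y \<in> cells M n \<Longrightarrow> K n y (replicate (Suc n) 1) = \<iota> n y"
    and Kg: "K 1 (unit M) [0, 1] = el (unit M) g"
    using s_htpy[OF g] unfolding htpy_iff by auto
  have tb: "bij_betw (t g m) (cells M m) (cells M m)" for m using t_iso[OF g] by (simp add: simplicial_iso_def)
  have ib: "bij_betw (\<iota> m) (cells M m) (fibre m)" for m unfolding fibre_def by (rule iota_bij)
  have "bij_betw (\<lambda>x. K m x (replicate (Suc m) 0)) (cells M m) (fibre m)" for m
    using bij_betw_trans[OF tb ib] by (subst bij_betw_cong[of _ _ "\<iota> m \<circ> t g m"]) (auto simp: K0)
  then have "strong_ihtpy K" unfolding strong_ihtpy_def ihtpy_def using K K1 by blast
  then show ?thesis using Kg by blast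
qed

lemma el_regular:
  assumes "x \<in> cells M 1" "g \<in> cells H 1"
  shows "defines_htpy M E \<iota> (el x g) \<longleftrightarrow> x \<in> NN M"
    and "strong_ihtpy L \<Longrightarrow> L 1 (unit M) [0, 1] = el x g \<Longrightarrow> x \<in> NNs M"
  using s_strong[OF assms(2)] regular_iff[OF _ assms(1)] s_mul(1)[OF assms] by metis+

section \<open>The two implications of (a)\<close>

lemma vanishes_if_section:
  assumes s: "\<sigma> \<in> sections E \<tau> H" and R: "regular_section M \<iota> E H \<sigma>"
  shows "class_vanishes M H t \<eta>"
proof -
  interpret R: regular_section_of_extension M \<iota> E \<tau> H \<sigma> by unfold_locales (use s R in auto)
  have "\<exists>x. x \<in> cells M 1 \<and> \<sigma> 1 g = el x g" if "g \<in> cells H 1" for g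
    using el_ex[OF R.sigma_cells[OF that]] R.tau_sigma[OF that] by auto
  then obtain \<theta> where \<theta>: "\<And>g. g \<in> cells H 1 \<Longrightarrow> \<theta> g \<in> cells M 1" "\<And>g. g \<in> cells H 1 \<Longrightarrow> \<sigma> 1 g = el (\<theta> g) g"
    by metis
  \<comment> \<open>The homotopies of a regular section are strong. This puts not only \<theta>(g)
    but also its inverse into \<open>NN M\<close>, so that the word with inverses formed below
    exists.\<close>
  have N: "\<theta> g \<in> NNs M" if g: "g \<in> cells H 1" for g
    using el_regular(2)[OF \<theta>(1)[OF g] g R.conj_htpy_strong[OF g]] R.conj_htpy(2)[OF g] \<theta>(2)[OF g] by simp
  have N': "\<theta> g \<in> NN M" "inv1 M (\<theta> g) \<in> NN M" if "g \<in> cells H 1" for g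
    using N[OF that] NNs_subset[OF pmM] NNs_inv[OF pgM] by auto
  show ?thesis
    unfolding class_vanishes_def inverse_elt_eq
  proof (intro exI[of _ \<theta>] conjI ballI allI impI)
    show "\<theta> g \<in> NN M" if "g \<in> cells H 1" for g by (rule N'(1)[OF that])
    fix g h assume gh: "[g, h] \<in> words H"
    let ?k = "mprod H [g, h]"
    have m: "mul H g h ?k" by (rule mul_mprod[OF pmH gh])
    have g: "g \<in> cells H 1" and h: "h \<in> cells H 1" and k: "?k \<in> cells H 1" using mul_cells[OF simpH m] by auto
    let ?x = "\<theta> g" and ?w = "t g 1 (\<theta> h)"
    have wN: "?w \<in> NN M" by (rule NN_iso[OF pmM t_iso[OF g] N'(1)[OF h]])
    have wi: "t g 1 (inv1 M (\<theta> h)) = inv1 M ?w" by (rule simplicial_map_inv1[OF pgM pgM t_map[OF g] \<theta>(1)[OF h]])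
    have wiN: "inv1 M ?w \<in> NN M" unfolding wi[symmetric] by (rule NN_iso[OF pmM t_iso[OF g] N'(2)[OF h]])
    \<comment> \<open>The product of \<theta>(g) s(g) and \<theta>(h) s(h) is computed in the
      twisted product and compared with \<theta>(gh) s(gh).\<close>
    have "mul E (\<sigma> 1 g) (\<sigma> 1 h) (\<sigma> 1 ?k)" by (rule mul_map[OF R.sigma m])
    moreover have "mul E (\<sigma> 1 g) (\<sigma> 1 h) (el (mprod M [?x, ?w, \<eta> g h]) ?k)"
      using el_mul[OF \<theta>(1)[OF g] g \<theta>(1)[OF h] h gh] NN_words[OF pmM, of "[?x, ?w]"] wN N'(1)[OF g]
      by (simp add: twisted_mult_def \<theta>(2)[OF g] \<theta>(2)[OF h])
    ultimately have e: "el (mprod M [?x, ?w, \<eta> g h]) ?k = el (\<theta> ?k) ?k"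
      using mul_fun[OF pmE] \<theta>(2)[OF k] by metis
    have "[?x, ?w, \<eta> g h] \<in> words M" by (rule NN_words[OF pmM]) (use wN N'(1)[OF g] eta_NN[OF gh] in auto)
    then obtain u where u: "u \<in> cells M 3" "\<And>i. i < 3 \<Longrightarrow> edge M 3 i (Suc i) u = [?x, ?w, \<eta> g h] ! i"
      by (subst (asm) words_iff[of _ 3]) auto
    have "mprod M [?x, ?w, \<eta> g h] = edge M 3 0 3 u" by (rule mprod_eqI[OF pmM u(1) _ u(2)]) auto
    then have "mprod M [?x, ?w, \<eta> g h] \<in> cells M 1" using edge_cells[OF simpM u(1)] by simp
    then have p: "mprod M [?x, ?w, \<eta> g h] = \<theta> ?k" using el_inj[OF _ \<theta>(1)[OF k] k e] by blast
    \<comment> \<open>The equation \<theta>(g) t(g)(\<theta>(h)) \<eta>(g, h) = \<theta>(gh) is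
      solved for \<eta>(g, h) inside this word.\<close>
    have "[inv1 M ?w, inv1 M ?x, ?x, ?w, \<eta> g h] \<in> words M"
      by (rule NN_words[OF pmM]) (use wN wiN N'[OF g] eta_NN[OF gh] in auto)
    from words5[OF this] obtain v where v: "v \<in> cells M 5" "edge M 5 0 1 v = inv1 M ?w" "edge M 5 1 2 v = inv1 M ?x"
      "edge M 5 2 3 v = ?x" "edge M 5 3 4 v = ?w" "edge M 5 4 5 v = \<eta> g h" by blast
    note w5 = word5[OF pmM v inv1_mul[OF pgM t_cells[OF g \<theta>(1)[OF h]]] inv1_mul[OF pgM \<theta>(1)[OF g]] p]
    show "[t g 1 (inv1 M (\<theta> h)), inv1 M ?x, \<theta> ?k] \<in> words M" unfolding wi by (rule w5(1))
    show "\<eta> g h = mprod M [t g 1 (inv1 M (\<theta> h)), inv1 M ?x, \<theta> ?k]" unfolding wi by (rule w5(2)[symmetric])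
  qed
qed

lemma section_if_vanishes:
  assumes V: "class_vanishes M H t \<eta>"
  shows "\<exists>\<sigma> \<in> sections E \<tau> H. regular_section M \<iota> E H \<sigma>"
proof -
  obtain \<theta> where N: "\<And>g. g \<in> cells H 1 \<Longrightarrow> \<theta> g \<in> NN M"
    and W: "\<And>g h. [g, h] \<in> words H \<Longrightarrow> [t g 1 (inv1 M (\<theta> h)), inv1 M (\<theta> g), \<theta> (mprod H [g, h])] \<in> words M"
    and \<eta>: "\<And>g h. [g, h] \<in> words H \<Longrightarrow> \<eta> g h = mprod M [t g 1 (inv1 M (\<theta> h)), inv1 M (\<theta> g), \<theta> (mprod H [g, h])]"
    using V unfolding class_vanishes_def inverse_elt_eq by blast
  note c = NN_cells[OF N]
  have prod: "mprod M [\<theta> g, t g 1 (\<theta> h), \<eta> g h] = \<theta> (mprod H [g, h])" if gh: "[g, h] \<in> words H" for g h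
  proof -
    have m: "mul H g h (mprod H [g, h])" by (rule mul_mprod[OF pmH gh])
    have g: "g \<in> cells H 1" and h: "h \<in> cells H 1" using mul_cells[OF simpH m] by auto
    have wi: "t g 1 (inv1 M (\<theta> h)) = inv1 M (t g 1 (\<theta> h))" by (rule simplicial_map_inv1[OF pgM pgM t_map[OF g] c[OF h]])
    \<comment> \<open>The last three entries are the word given by the coboundary equation. Only
      \<theta>(g) and t(g)(\<theta>(h)) are prepended as elements of \<open>NN M\<close>, so their
      inverses are not asked to lie there.\<close>
    have "[\<theta> g, t g 1 (\<theta> h), inv1 M (t g 1 (\<theta> h)), inv1 M (\<theta> g), \<theta> (mprod H [g, h])] \<in> words M"
      by (rule NN_Cons_words[OF pmM N[OF g]], rule NN_Cons_words[OF pmM NN_iso[OF pmM t_iso[OF g] N[OF h]]])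
        (use W[OF gh] wi in simp)
    from words5[OF this] obtain v where v: "v \<in> cells M 5" "edge M 5 0 1 v = \<theta> g" "edge M 5 1 2 v = t g 1 (\<theta> h)"
      "edge M 5 2 3 v = inv1 M (t g 1 (\<theta> h))" "edge M 5 3 4 v = inv1 M (\<theta> g)" "edge M 5 4 5 v = \<theta> (mprod H [g, h])"
      by blast
    show ?thesis
      by (rule word5(2)[OF pmM v mul_inv1[OF pgM c[OF g]] mul_inv1[OF pgM t_cells[OF g c[OF h]]]])
        (use \<eta>[OF gh] wi in simp)
  qed
  \<comment> \<open>A section must preserve the unit. The relation at [1|1] reads \<theta>(1)
    \<theta>(1) = \<theta>(1) and cancels.\<close>
  have \<theta>1: "\<theta> (unit H) = unit M"
  proof -
    have m: "mul H (unit H) (unit H) (unit H)" by (rule mul_unit_left[OF pmH uH])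
    then have uu: "[unit H, unit H] \<in> words H" "mprod H [unit H, unit H] = unit H"
      using words_pair_iff[OF pmH] mprod_pair[OF pmH] by blast+
    have 1: "mprod M [\<theta> (unit H), \<theta> (unit H), unit M] = \<theta> (unit H)"
      using prod[OF uu(1)] uu(2) t_unit[OF c[OF uH]] eta_unit(1)[OF uH] by simp
    have "[\<theta> (unit H), \<theta> (unit H)] \<in> words M" by (rule NN_words[OF pmM]) (use N[OF uH] in auto)
    then have "mul M (\<theta> (unit H)) (\<theta> (unit H)) (mprod M [\<theta> (unit H), \<theta> (unit H)])" by (rule mul_mprod[OF pmM])
    with 1 have "mul M (\<theta> (unit H)) (\<theta> (unit H)) (\<theta> (unit H))" using mprod3_unit[OF pmM] by metis
    then show ?thesis using mul_left_cancel[OF pgM _ mul_unit_right[OF pmM c[OF uH]]] by blast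
  qed
  define ps where "ps n c = map (\<lambda>i. (\<theta> (edge H n i (Suc i) c), edge H n i (Suc i) c)) [0..<n]" for n c
  \<comment> \<open>Untwisting applies automorphisms t(g), under which \<open>NN M\<close> is
    stable; so the word with entries (\<theta>(g), g) is a cell as soon as its second components are
    one.\<close>
  have NNu: "set (untwist t qs) \<subseteq> NN M" if "set qs \<subseteq> NN M \<times> cells H 1" for qs
    using that by (induction qs) (auto intro!: NN_iso[OF pmM t_iso])
  have eH: "edge H n i (Suc i) c \<in> cells H 1" if "c \<in> cells H n" "i < n" for n i c
    using edge_cells[OF simpH that(1), of i "Suc i"] that by simp
  have ps: "ps n c \<in> cells E' n" if c: "c \<in> cells H n" for n c
    unfolding cells_E'_iff
  proof (intro conjI)
    show "set (ps n c) \<subseteq> cells M 1 \<times> cells H 1" using eH[OF c] NN_cells[OF N] by (auto simp: ps_def)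
    have "map snd (ps n c) = spine H n c" by (auto simp: ps_def spine_def)
    then show "map snd (ps n c) \<in> words H" using spine_in_words[OF c] by simp
    show "untwist t (ps n c) \<in> words M"
      by (rule NN_words[OF pmM NNu]) (use eH[OF c] N in \<open>auto simp: ps_def\<close>)
  qed (simp add: ps_def)
  have fold: "foldl tm e0 (map ((!) (ps n c)) [i..<j]) = (\<theta> (edge H n i j c), edge H n i j c)"
    if c: "c \<in> cells H n" and ij: "i \<le> j" "j \<le> n" for n c i j
    using ij
  proof (induction j rule: dec_induct)
    \<comment> \<open>The empty fold is \<open>e0\<close>; here \<theta>(1) = 1 enters.\<close>
    case base
    then show ?case using edge_degenerate[OF pmH c, of i] \<theta>1 by simp
  next
    case (step j)
    have m: "mul H (edge H n i j c) (edge H n j (Suc j) c) (edge H n i (Suc j) c)"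
      by (rule mul_edges[OF simpH c]) (use step in auto)
    then have w: "[edge H n i j c, edge H n j (Suc j) c] \<in> words H"
      and p: "mprod H [edge H n i j c, edge H n j (Suc j) c] = edge H n i (Suc j) c"
      using words_pair_iff[OF pmH] mprod_pair[OF pmH] by blast+
    have f: "foldl tm e0 (map ((!) (ps n c)) [i..<Suc j]) =
      tm (\<theta> (edge H n i j c), edge H n i j c) (\<theta> (edge H n j (Suc j) c), edge H n j (Suc j) c)"
      using step by (simp add: ps_def upt_Suc)
    show ?case unfolding f using prod[OF w] p by (simp add: twisted_mult_def)
  qed
  define S where "S n c = inv_into (cells E n) (\<psi> n) (ps n c)" for n c
  have S: "S n c \<in> cells E n" "\<psi> n (S n c) = ps n c" if c: "c \<in> cells H n" for n c
  proof -
    show "S n c \<in> cells E n"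
      unfolding S_def by (rule inv_into_into) (use psi_bij[of n] ps[OF c] in \<open>simp add: bij_betw_def\<close>)
    show "\<psi> n (S n c) = ps n c" unfolding S_def by (rule bij_betw_inv_into_right[OF psi_bij ps[OF c]])
  qed
  have Se: "edge E n i j (S n c) = el (\<theta> (edge H n i j c)) (edge H n i j c)" if c: "c \<in> cells H n" and ij: "i \<le> j" "j \<le> n" for n c i j
    by (rule el_eqI[OF edge_cells[OF simpE S(1)[OF c] ij]])
      (use simplicial_map_edge[OF psi S(1)[OF c] ij] S(2)[OF c] edge_E' fold[OF c ij] in simp)
  have S1: "S 1 h = el (\<theta> h) h" if h: "h \<in> cells H 1" for h
    using Se[OF h, of 0 1] by (simp add: edge_id[OF simpE S(1)[OF h]] edge_id[OF simpH h])
  have Sm: "simplicial_map H E S"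
    by (rule simplicial_map_edgeI[OF simpH pmE S(1)])
      (use Se S1 edge_cells[OF simpH] in auto)
  define \<sigma> where "\<sigma> n = (\<lambda>c \<in> cells H n. S n c)" for n
  have "\<tau> n (S n c) = c" if c: "c \<in> cells H n" for n c
  proof -
    have "\<tau> n (S n c) = word H (map snd (ps n c))" using psi_proj S[OF c] by (metis twisted_proj_def)
    also have "\<dots> = c" by (rule word_eqI[OF pmH c]) (auto simp: ps_def)
    finally show ?thesis .
  qed
  moreover have "simplicial_map H E \<sigma>" by (rule simplicial_map_cong[OF Sm simpH]) (simp add: \<sigma>_def)
  ultimately have sec: "\<sigma> \<in> sections E \<tau> H" by (simp add: sections_def Hom_def \<sigma>_def)
  moreover have "regular_section M \<iota> E H \<sigma>"
    unfolding regular_section_iff[OF sec] using el_regular(1) c N S1 by (auto simp: \<sigma>_def)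
  ultimately show ?thesis by blast
qed

end

theorem theorem5p9:
  fixes M :: "'a sset" and E :: "'e sset" and H :: "'h sset"
    and \<iota> :: "nat \<Rightarrow> 'a \<Rightarrow> 'e" and \<tau> :: "nat \<Rightarrow> 'e \<Rightarrow> 'h"
  assumes "extension M \<iota> E \<tau> H"
  shows
    "(\<forall>t \<eta>. classifying_pair M \<iota> E \<tau> H t \<eta> \<longrightarrow>
        ((\<exists>\<sigma> \<in> sections E \<tau> H. regular_section M \<iota> E H \<sigma>) \<longleftrightarrow> class_vanishes M H t \<eta>)) \<and>
     (\<forall>\<sigma> \<in> sections E \<tau> H. regular_section M \<iota> E H \<sigma> \<longrightarrow>
        (\<exists>\<rho> \<in> actions H M. conjugation_action M \<iota> E H \<sigma> \<rho> \<and>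
          (\<exists>\<phi> \<Phi>.
             bij_betw \<phi> (derivations H M \<rho>) (sections E \<tau> H) \<and>
             (\<forall>\<theta> \<in> derivations H M \<rho>. \<forall>h \<in> cells H 1.
                [\<iota> 1 (\<theta> 1 h), \<sigma> 1 h] \<in> words E \<and>
                \<phi> \<theta> 1 h = mprod E [\<iota> 1 (\<theta> 1 h), \<sigma> 1 h]) \<and>
             bij_betw \<Phi> (H1 H M \<rho>) (section_classes E \<tau> H) \<and>
             (\<forall>\<theta> \<in> derivations H M \<rho>.
                \<Phi> (derivation_equiv H M \<rho> `` {\<theta>}) = section_equiv E \<tau> H `` {\<phi> \<theta>}) \<and>
             (\<forall>\<theta> \<in> derivations H M \<rho>.
                regular_derivation H M \<theta> \<longleftrightarrow> regular_section M \<iota> E H (\<phi> \<theta>)))))"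
proof (intro conjI allI ballI impI)
  interpret partial_group_extension M \<iota> E \<tau> H by unfold_locales (rule assms)
  fix t \<eta> assume C: "classifying_pair M \<iota> E \<tau> H t \<eta>"
  then obtain \<psi> where "simplicial_iso E (twisted_product M H t \<eta>) \<psi>"
    "\<forall>n. \<forall>x \<in> cells M n. \<psi> n (\<iota> n x) = twisted_incl M H n x"
    "\<forall>n. \<forall>e \<in> cells E n. twisted_proj H n (\<psi> n e) = \<tau> n e"
    unfolding classifying_pair_def equivalent_extensions_def by blast
  then interpret twisted_extension M \<iota> E \<tau> H t \<eta> \<psi>
    using C by unfold_locales (auto simp: classifying_pair_def)
  show "(\<exists>\<sigma> \<in> sections E \<tau> H. regular_section M \<iota> E H \<sigma>) \<longleftrightarrow> class_vanishes M H t \<eta>"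
    using vanishes_if_section section_if_vanishes by blast
next
  interpret partial_group_extension M \<iota> E \<tau> H by unfold_locales (rule assms)
  fix \<sigma> assume "\<sigma> \<in> sections E \<tau> H" "regular_section M \<iota> E H \<sigma>"
  then interpret regular_section_of_extension M \<iota> E \<tau> H \<sigma> by unfold_locales
  show "\<exists>\<rho> \<in> actions H M. conjugation_action M \<iota> E H \<sigma> \<rho> \<and>
          (\<exists>\<phi> \<Phi>.
             bij_betw \<phi> (derivations H M \<rho>) (sections E \<tau> H) \<and>
             (\<forall>\<theta> \<in> derivations H M \<rho>. \<forall>h \<in> cells H 1.
                [\<iota> 1 (\<theta> 1 h), \<sigma> 1 h] \<in> words E \<and>
                \<phi> \<theta> 1 h = mprod E [\<iota> 1 (\<theta> 1 h), \<sigma> 1 h]) \<and>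
             bij_betw \<Phi> (H1 H M \<rho>) (section_classes E \<tau> H) \<and>
             (\<forall>\<theta> \<in> derivations H M \<rho>.
                \<Phi> (derivation_equiv H M \<rho> `` {\<theta>}) = section_equiv E \<tau> H `` {\<phi> \<theta>}) \<and>
             (\<forall>\<theta> \<in> derivations H M \<rho>.
                regular_derivation H M \<theta> \<longleftrightarrow> regular_section M \<iota> E H (\<phi> \<theta>)))"
    by (rule regular_section_correspondence)
qed

end
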